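(* Let $q \in \Omega$ be a modified cubic polynomial, let $\alpha : (-\epsilon_r,\epsilon_r)\times(-\epsilon_s,\epsilon_s)\times[0,T] \to Q$ be a two-parameter variation of $q$ with variational vector fields $X = \frac{\partial \alpha}{\partial r}\big|_{(r,s)=(0,0)} \in T_q\Omega$ and $Y = \frac{\partial\alpha}{\partial s}\big|_{(r,s)=(0,0)} \in T_q\Omega$, and let $0<t_1<\dots<t_l<T$ be points such that $\alpha$ is smooth on each strip between consecutive points of $0,t_1,\dots,t_l,T$. Then \begin{align*} \frac{\partial^2}{\partial r\,\partial s}\Big|_{(r,s)=(0,0)} J(\alpha(r,s,\cdot)) &= \int_0^T \Big\langle Y(t), \frac{D^4}{dt^4}X(t) + F(X(t),\dot q(t)) + \nabla_{X(t)}\operatorname{grad}V(q(t)) \Big\rangle\, dt \\ &\quad - \sum_{i=1}^l \Big\langle \frac{D}{dt}Y(t_i), \frac{D^2}{dt^2}X(t_i^+) - \frac{D^2}{dt^2}X(t_i^-)\Big\rangle + \sum_{i=1}^l \Big\langle Y(t_i), \frac{D^3}{dt^3}X(t_i^+) - \frac{D^3}{dt^3}X(t_i^-)\Big\rangle, \end{align*} where \begin{align*} F(X,Y) &= (\nabla^2_Y R)(X,Y)Y + (\nabla_X R)(\nabla_Y Y,Y)Y + R(R(X,Y)Y,Y)Y + R(X,\nabla^2_Y Y)Y \\ &\quad + 2\big[(\nabla_Y R)(\nabla_Y X,Y)Y + (\nabla_Y R)(X,\nabla_Y Y)Y + R(\nabla^2_Y X,Y)Y\big] \\ &\quad + 3\big[(\nabla_Y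 R)(X,Y)\nabla_Y Y + R(X,Y)\nabla^2_Y Y + R(X,\nabla_Y Y)\nabla_Y Y\big] + 4R(\nabla_Y X,Y)\nabla_Y Y . \end{align*}
   Context: $Q$ is a complete connected Riemannian manifold with metric $\langle\cdot,\cdot\rangle$, Levi-Civita connection $\nabla$, and curvature endomorphism $R(X,Y)Z = \nabla_X\nabla_Y Z - \nabla_Y\nabla_X Z - \nabla_{[X,Y]}Z$; $\frac{D}{dt}$ is the covariant derivative along a curve. $V:Q\to\mathbb{R}$ is smooth and non-negative, with gradient $\operatorname{grad}V$. Fix $T>0$ and $\xi=(q_a,v_a)$, $\eta=(q_b,v_b)$ in $TQ$. $\Omega=\Omega^{0,T}_{\xi,\eta}$ is the set of piecewise smooth $C^1$ curves $\gamma:[0,T]\to Q$ with $\gamma(0)=q_a$, $\dot\gamma(0)=v_a$, $\gamma(T)=q_b$, $\dot\gamma(T)=v_b$. For $q\in\Omega$, $T_q\Omega$ is the space of piecewise smooth $C^1$ vector fields $X$ along $q$ with $X(0)=X(T)=0$ and $\frac{DX}{dt}(0)=\frac{DX}{dt}(T)=0$. The functional is $J(q)=\int_0^T\big(\tfrac12\|\tfrac{D}{dt}\dot q(t)\|^2+V(q(t))\big)dt$. A modified cubic polynomial is a smooth curve $q$ satisfying $\frac{D^3\dot q}{dt^3}+R\big(\frac{D\dot q}{dt},\dot q\big)\dot q+\operatorname{grad}V(q(t))=0$. A two-parameter variation of $q$ is a map $\alpha:(-\epsilon_r,\epsilon_r)\times(-\epsilon_s,\epsilon_s)\times[0,T]\to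 Q$ (with $\epsilon_r,\epsilon_s>0$), smooth on each strip $(-\epsilon_r,\epsilon_r)\times(-\epsilon_s,\epsilon_s)\times[t_{i},t_{i+1}]$ of some finite partition of $[0,T]$, such that $\alpha(r,s,\cdot)\in\Omega$ for all $(r,s)$, $\alpha(0,0,\cdot)=q$, $\frac{d}{dr}|_{r=0}\alpha(r,0,\cdot)=X\in T_q\Omega$ and $\frac{d}{ds}|_{s=0}\alpha(0,s,\cdot)=Y\in T_q\Omega$. In $F(X,\dot q)$, derivatives in the direction $\dot q$ are covariant derivatives along $q$: $\nabla_{\dot q}X=\frac{DX}{dt}$, $\nabla^2_{\dot q}X=\frac{D^2X}{dt^2}$, $\nabla_{\dot q}\dot q=\frac{D\dot q}{dt}$, $\nabla^2_{\dot q}\dot q=\frac{D^2\dot q}{dt^2}$, and $\nabla^2_{\dot q}R$ is the second covariant derivative of the tensor field $R$ along $q$. $\frac{D^k}{dt^k}X(t_i^{\pm})$ denote one-sided limits. *)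

theory Defs
  imports "HOL-Analysis.Analysis" "HOL-Library.Function_Algebras"
begin

section \<open>Smooth maps between Euclidean spaces\<close>

primrec C_k_on :: "nat \<Rightarrow> 'a::euclidean_space set \<Rightarrow> ('a \<Rightarrow> 'b::euclidean_space) \<Rightarrow> bool" where
  "C_k_on 0 S f \<longleftrightarrow> continuous_on S f"
| "C_k_on (Suc k) S f \<longleftrightarrow>
     (\<forall>x\<in>S. f differentiable (at x)) \<and> (\<forall>v. C_k_on k S (\<lambda>x. frechet_derivative f (at x) v))"

text \<open>On a set that need not be open, smooth means: locally the restriction of a smooth map
  defined on an open set.\<close>

definition smooth_on :: "'a::euclidean_space set \<Rightarrow> ('a \<Rightarrow> 'b::euclidean_space) \<Rightarrow> bool" where
  "smooth_on S f \<longleftrightarrow> (\<forall>x\<in>S. \<exists>W h. open W \<and> x \<in> W \<and> (\<forall>k. C_k_on k W h) \<and> (\<forall>y\<in>S \<inter> W. h y = f y))"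

definition C1_within :: "real set \<Rightarrow> real set \<Rightarrow> (real \<Rightarrow> 'b::euclidean_space) \<Rightarrow> bool" where
  "C1_within I S f \<longleftrightarrow> (\<forall>t\<in>S. f differentiable (at t within I)) \<and>
     continuous_on S (\<lambda>t. vector_derivative f (at t within I))"


section \<open>Smooth manifolds\<close>

text \<open>The manifold is the whole type \<open>'q\<close>. A chart is a pair of a domain and a coordinate map; the
  values of the coordinate map outside of the domain carry no meaning.\<close>

type_synonym ('q, 'e) chart = "'q set \<times> ('q \<Rightarrow> 'e)"

definition chart_inv :: "('q, 'e) chart \<Rightarrow> 'e \<Rightarrow> 'q" where
  "chart_inv c = inv_into (fst c) (snd c)"

definition charts_at :: "('q, 'e) chart set \<Rightarrow> 'q \<Rightarrow> ('q, 'e) chart set" where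
  "charts_at A p = {c \<in> A. p \<in> fst c}"

locale smooth_manifold =
  fixes A :: "('q::{t2_space, second_countable_topology}, 'e::euclidean_space) chart set"
  assumes charts_cover: "charts_at A p \<noteq> {}"
    and open_domain: "c \<in> A \<Longrightarrow> open (fst c)"
    and open_range: "c \<in> A \<Longrightarrow> open (snd c ` fst c)"
    and chart_homeomorphism:
      "c \<in> A \<Longrightarrow> homeomorphism (fst c) (snd c ` fst c) (snd c) (chart_inv c)"
    and smooth_transition:
      "c \<in> A \<Longrightarrow> d \<in> A \<Longrightarrow> smooth_on (snd c ` (fst c \<inter> fst d)) (snd d \<circ> chart_inv c)"

definition smooth_map_on ::
  "('q::topological_space, 'e::euclidean_space) chart set \<Rightarrow> 'a::euclidean_space set \<Rightarrow> ('a \<Rightarrow> 'q) \<Rightarrow> bool" where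
  "smooth_map_on A S f \<longleftrightarrow>
     continuous_on S f \<and> (\<forall>c\<in>A. smooth_on {x \<in> S. f x \<in> fst c} (snd c \<circ> f))"

definition smooth_fun_on ::
  "('q, 'e::euclidean_space) chart set \<Rightarrow> 'q set \<Rightarrow> ('q \<Rightarrow> real) \<Rightarrow> bool" where
  "smooth_fun_on A U f \<longleftrightarrow> (\<forall>c\<in>A. smooth_on (snd c ` (fst c \<inter> U)) (f \<circ> chart_inv c))"


section \<open>Tangent vectors and vector fields\<close>

text \<open>A tangent vector at \<open>p\<close> is the family of its coordinate representations in all charts
  around \<open>p\<close>, related by the derivatives of the transition maps, and \<open>0\<close> at all
  other charts. The vector space structure is the pointwise one.\<close>

instantiation "fun" :: (type, real_vector) real_vector
begin

definition scaleR_fun :: "real \<Rightarrow> ('a \<Rightarrow> 'b) \<Rightarrow> 'a \<Rightarrow> 'b" where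
  "scaleR_fun a f = (\<lambda>x. a *\<^sub>R f x)"

instance
  by standard (auto simp: scaleR_fun_def plus_fun_def fun_eq_iff scaleR_add_right scaleR_add_left)

end

type_synonym ('q, 'e) tvec = "('q, 'e) chart \<Rightarrow> 'e"

definition tangent_space :: "('q, 'e::euclidean_space) chart set \<Rightarrow> 'q \<Rightarrow> ('q, 'e) tvec set" where
  "tangent_space A p = {v. (\<forall>c. c \<notin> charts_at A p \<longrightarrow> v c = 0) \<and>
     (\<forall>c\<in>charts_at A p. \<forall>d\<in>charts_at A p.
        v d = frechet_derivative (snd d \<circ> chart_inv c) (at (snd c p)) (v c))}"

definition tangent_bundle :: "('q, 'e::euclidean_space) chart set \<Rightarrow> ('q \<times> ('q, 'e) tvec) set" where
  "tangent_bundle A = {(p, v). v \<in> tangent_space A p}"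

text \<open>The vector field on the domain of \<open>c\<close> whose coordinates in the chart \<open>c\<close> are the constant \<open>a\<close>.\<close>

definition coord_field ::
  "('q, 'e::euclidean_space) chart set \<Rightarrow> ('q, 'e) chart \<Rightarrow> 'e \<Rightarrow> 'q \<Rightarrow> ('q, 'e) tvec" where
  "coord_field A c a p = (\<lambda>d. if d \<in> charts_at A p
     then frechet_derivative (snd d \<circ> chart_inv c) (at (snd c p)) a else 0)"

definition vector_field_on ::
  "('q, 'e::euclidean_space) chart set \<Rightarrow> 'q set \<Rightarrow> ('q \<Rightarrow> ('q, 'e) tvec) \<Rightarrow> bool" where
  "vector_field_on A U X \<longleftrightarrow> (\<forall>p\<in>U. X p \<in> tangent_space A p) \<and>
     (\<forall>c\<in>A. smooth_on (snd c ` (fst c \<inter> U)) (\<lambda>x. X (chart_inv c x) c))"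

text \<open>The derivative of a function in the direction of a tangent vector at \<open>p\<close>; it does not depend on
  the chosen chart.\<close>

definition dir_deriv ::
  "('q, 'e::euclidean_space) chart set \<Rightarrow> 'q \<Rightarrow> ('q, 'e) tvec \<Rightarrow> ('q \<Rightarrow> real) \<Rightarrow> real" where
  "dir_deriv A p u f =
     (let c = (SOME c. c \<in> charts_at A p)
      in frechet_derivative (f \<circ> chart_inv c) (at (snd c p)) (u c))"

definition lie_bracket ::
  "('q, 'e::euclidean_space) chart set \<Rightarrow> ('q \<Rightarrow> ('q, 'e) tvec) \<Rightarrow> ('q \<Rightarrow> ('q, 'e) tvec) \<Rightarrow>
     'q \<Rightarrow> ('q, 'e) tvec" where
  "lie_bracket A X Y p = (\<lambda>c. if c \<in> charts_at A p
     then frechet_derivative (\<lambda>x. Y (chart_inv c x) c) (at (snd c p)) (X p c)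
        - frechet_derivative (\<lambda>x. X (chart_inv c x) c) (at (snd c p)) (Y p c)
     else 0)"


section \<open>Riemannian metrics and the Levi-Civita connection\<close>

locale riemannian_manifold = smooth_manifold A
  for A :: "('q::{t2_space, second_countable_topology}, 'e::euclidean_space) chart set" +
  fixes g :: "'q \<Rightarrow> ('q, 'e) tvec \<Rightarrow> ('q, 'e) tvec \<Rightarrow> real"
  assumes metric_add: "u \<in> tangent_space A p \<Longrightarrow> v \<in> tangent_space A p \<Longrightarrow> w \<in> tangent_space A p \<Longrightarrow>
        g p (u + v) w = g p u w + g p v w"
    and metric_scale: "u \<in> tangent_space A p \<Longrightarrow> w \<in> tangent_space A p \<Longrightarrow>
        g p (a *\<^sub>R u) w = a * g p u w"
    and metric_sym: "u \<in> tangent_space A p \<Longrightarrow> v \<in> tangent_space A p \<Longrightarrow> g p u v = g p v u"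
    and metric_pos: "u \<in> tangent_space A p \<Longrightarrow> u \<noteq> 0 \<Longrightarrow> 0 < g p u u"
    and metric_smooth: "open U \<Longrightarrow> vector_field_on A U X \<Longrightarrow> vector_field_on A U Y \<Longrightarrow>
        smooth_fun_on A U (\<lambda>p. g p (X p) (Y p))"

text \<open>A connection acts on locally defined vector fields: \<open>nabla p u Z\<close> is the covariant derivative
  of \<open>Z\<close> in the direction of \<open>u \<in> T\<^sub>pQ\<close>, meaningful if \<open>Z\<close> is a vector field on a neighbourhood
  of \<open>p\<close>. Locality follows from the Leibniz rule, applied to indicator functions of open sets.\<close>

type_synonym ('q, 'e) conn = "'q \<Rightarrow> ('q, 'e) tvec \<Rightarrow> ('q \<Rightarrow> ('q, 'e) tvec) \<Rightarrow> ('q, 'e) tvec"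

locale affine_connection = smooth_manifold A
  for A :: "('q::{t2_space, second_countable_topology}, 'e::euclidean_space) chart set" +
  fixes nabla :: "('q, 'e) conn"
  assumes nabla_smooth: "open U \<Longrightarrow> vector_field_on A U X \<Longrightarrow> vector_field_on A U Z \<Longrightarrow>
        vector_field_on A U (\<lambda>p. nabla p (X p) Z)"
    and nabla_add_dir: "open U \<Longrightarrow> p \<in> U \<Longrightarrow> vector_field_on A U Z \<Longrightarrow>
        u \<in> tangent_space A p \<Longrightarrow> v \<in> tangent_space A p \<Longrightarrow>
        nabla p (u + v) Z = nabla p u Z + nabla p v Z"
    and nabla_scale_dir: "open U \<Longrightarrow> p \<in> U \<Longrightarrow> vector_field_on A U Z \<Longrightarrow>
        u \<in> tangent_space A p \<Longrightarrow> nabla p (a *\<^sub>R u) Z = a *\<^sub>R nabla p u Z"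
    and nabla_add: "open U \<Longrightarrow> p \<in> U \<Longrightarrow> vector_field_on A U Y \<Longrightarrow> vector_field_on A U Z \<Longrightarrow>
        u \<in> tangent_space A p \<Longrightarrow>
        nabla p u (\<lambda>x. Y x + Z x) = nabla p u Y + nabla p u Z"
    and nabla_leibniz: "open U \<Longrightarrow> p \<in> U \<Longrightarrow> smooth_fun_on A U f \<Longrightarrow> vector_field_on A U Z \<Longrightarrow>
        u \<in> tangent_space A p \<Longrightarrow>
        nabla p u (\<lambda>x. f x *\<^sub>R Z x) = dir_deriv A p u f *\<^sub>R Z p + f p *\<^sub>R nabla p u Z"

locale levi_civita = riemannian_manifold A g + affine_connection A nabla
  for A :: "('q::{t2_space, second_countable_topology}, 'e::euclidean_space) chart set"
    and g :: "'q \<Rightarrow> ('q, 'e) tvec \<Rightarrow> ('q, 'e) tvec \<Rightarrow> real"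
    and nabla :: "('q, 'e) conn" +
  assumes torsion_free: "open U \<Longrightarrow> p \<in> U \<Longrightarrow> vector_field_on A U X \<Longrightarrow> vector_field_on A U Y \<Longrightarrow>
        nabla p (X p) Y - nabla p (Y p) X = lie_bracket A X Y p"
    and metric_compatible: "open U \<Longrightarrow> p \<in> U \<Longrightarrow> vector_field_on A U Y \<Longrightarrow> vector_field_on A U Z \<Longrightarrow>
        u \<in> tangent_space A p \<Longrightarrow>
        dir_deriv A p u (\<lambda>x. g x (Y x) (Z x)) = g p (nabla p u Y) (Z p) + g p (Y p) (nabla p u Z)"

definition gradient ::
  "('q, 'e::euclidean_space) chart set \<Rightarrow> ('q \<Rightarrow> ('q, 'e) tvec \<Rightarrow> ('q, 'e) tvec \<Rightarrow> real) \<Rightarrow>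
     ('q \<Rightarrow> real) \<Rightarrow> 'q \<Rightarrow> ('q, 'e) tvec" where
  "gradient A g V p = (THE w. w \<in> tangent_space A p \<and>
     (\<forall>u\<in>tangent_space A p. g p w u = dir_deriv A p u V))"


section \<open>Curvature and its covariant derivative\<close>

definition curvature_field ::
  "('q, 'e::euclidean_space) chart set \<Rightarrow> ('q, 'e) conn \<Rightarrow>
     ('q \<Rightarrow> ('q, 'e) tvec) \<Rightarrow> ('q \<Rightarrow> ('q, 'e) tvec) \<Rightarrow> ('q \<Rightarrow> ('q, 'e) tvec) \<Rightarrow> 'q \<Rightarrow> ('q, 'e) tvec" where
  "curvature_field A nabla X Y Z p =
     nabla p (X p) (\<lambda>x. nabla x (Y x) Z) - nabla p (Y p) (\<lambda>x. nabla x (X x) Z)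
     - nabla p (lie_bracket A X Y p) Z"

text \<open>The value at tangent vectors \<open>u, v, w\<close> at \<open>p\<close> of an expression \<open>K\<close> in three vector fields which is
  tensorial, i.e. depends only on the values of the fields at \<open>p\<close>.\<close>

definition tensor_value ::
  "('q::topological_space, 'e::euclidean_space) chart set \<Rightarrow> 'q \<Rightarrow>
     (('q \<Rightarrow> ('q, 'e) tvec) \<Rightarrow> ('q \<Rightarrow> ('q, 'e) tvec) \<Rightarrow> ('q \<Rightarrow> ('q, 'e) tvec) \<Rightarrow> ('q, 'e) tvec) \<Rightarrow>
     ('q, 'e) tvec \<Rightarrow> ('q, 'e) tvec \<Rightarrow> ('q, 'e) tvec \<Rightarrow> ('q, 'e) tvec" where
  "tensor_value A p K u v w = (THE r. \<forall>U X Y Z. open U \<and> p \<in> U \<and>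
     vector_field_on A U X \<and> vector_field_on A U Y \<and> vector_field_on A U Z \<and>
     X p = u \<and> Y p = v \<and> Z p = w \<longrightarrow> r = K X Y Z)"

text \<open>\<open>curvature A nabla p u v w\<close> is \<open>R(u, v)w\<close>, and \<open>nabla_curvature A nabla p a u v w\<close>
  is \<open>(\<nabla>\<^sub>a R)(u, v)w\<close>.\<close>

definition curvature ::
  "('q::topological_space, 'e::euclidean_space) chart set \<Rightarrow> ('q, 'e) conn \<Rightarrow> 'q \<Rightarrow>
     ('q, 'e) tvec \<Rightarrow> ('q, 'e) tvec \<Rightarrow> ('q, 'e) tvec \<Rightarrow> ('q, 'e) tvec" where
  "curvature A nabla p = tensor_value A p (\<lambda>X Y Z. curvature_field A nabla X Y Z p)"

definition nabla_curvature ::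
  "('q::topological_space, 'e::euclidean_space) chart set \<Rightarrow> ('q, 'e) conn \<Rightarrow> 'q \<Rightarrow>
     ('q, 'e) tvec \<Rightarrow> ('q, 'e) tvec \<Rightarrow> ('q, 'e) tvec \<Rightarrow> ('q, 'e) tvec \<Rightarrow> ('q, 'e) tvec" where
  "nabla_curvature A nabla p a = tensor_value A p (\<lambda>X Y Z.
     nabla p a (\<lambda>x. curvature A nabla x (X x) (Y x) (Z x))
     - curvature A nabla p (nabla p a X) (Y p) (Z p)
     - curvature A nabla p (X p) (nabla p a Y) (Z p)
     - curvature A nabla p (X p) (Y p) (nabla p a Z))"


section \<open>Curves and fields along curves\<close>

text \<open>In all notions below \<open>I\<close> is the parameter interval; at its end points derivatives are one-sided.\<close>

definition velocity ::
  "('q, 'e::euclidean_space) chart set \<Rightarrow> real set \<Rightarrow> (real \<Rightarrow> 'q) \<Rightarrow> real \<Rightarrow> ('q, 'e) tvec" where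
  "velocity A I \<gamma> t = (\<lambda>c. if c \<in> charts_at A (\<gamma> t)
     then vector_derivative (\<lambda>s. snd c (\<gamma> s)) (at t within I) else 0)"

definition smooth_field_along ::
  "('q, 'e::euclidean_space) chart set \<Rightarrow> real set \<Rightarrow> (real \<Rightarrow> 'q) \<Rightarrow> (real \<Rightarrow> ('q, 'e) tvec) \<Rightarrow> bool" where
  "smooth_field_along A S \<gamma> X \<longleftrightarrow> (\<forall>t\<in>S. X t \<in> tangent_space A (\<gamma> t)) \<and>
     (\<forall>c\<in>A. smooth_on {t \<in> S. \<gamma> t \<in> fst c} (\<lambda>t. X t c))"

text \<open>The covariant derivative along \<open>\<gamma>\<close>: if \<open>X = \<Sum>\<^sub>i x\<^sub>i E\<^sub>i\<close> with the coordinate fields \<open>E\<^sub>i\<close> of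
  a chart, then \<open>DX/dt = \<Sum>\<^sub>i (x\<^sub>i' E\<^sub>i + x\<^sub>i \<nabla>\<^bsub>\<gamma>'\<^esub> E\<^sub>i)\<close>. The definition gives its coordinates in
  every chart \<open>c\<close> around \<open>\<gamma> t\<close>, and \<open>coord_field A c (X t c)\<close> is the field
  \<open>\<Sum>\<^sub>i x\<^sub>i E\<^sub>i\<close> with \<open>x\<^sub>i\<close> frozen at time \<open>t\<close>.\<close>

definition cov_deriv ::
  "('q, 'e::euclidean_space) chart set \<Rightarrow> ('q, 'e) conn \<Rightarrow> real set \<Rightarrow> (real \<Rightarrow> 'q) \<Rightarrow>
     (real \<Rightarrow> ('q, 'e) tvec) \<Rightarrow> real \<Rightarrow> ('q, 'e) tvec" where
  "cov_deriv A nabla I \<gamma> X t = (\<lambda>c. if c \<in> charts_at A (\<gamma> t)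
     then vector_derivative (\<lambda>s. X s c) (at t within I)
        + nabla (\<gamma> t) (velocity A I \<gamma> t) (coord_field A c (X t c)) c
     else 0)"

abbreviation cov_deriv_pow ::
  "('q, 'e::euclidean_space) chart set \<Rightarrow> ('q, 'e) conn \<Rightarrow> real set \<Rightarrow> (real \<Rightarrow> 'q) \<Rightarrow> nat \<Rightarrow>
     (real \<Rightarrow> ('q, 'e) tvec) \<Rightarrow> real \<Rightarrow> ('q, 'e) tvec" where
  "cov_deriv_pow A nabla I \<gamma> k X \<equiv> (cov_deriv A nabla I \<gamma> ^^ k) X"

text \<open>The covariant derivative of a field \<open>S\<close> along \<open>\<gamma>\<close> of tensors of the type of the curvature
  tensor, evaluated on \<open>u, v, w\<close> at time \<open>t\<close> by means of smooth local extensions of these vectors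
  to fields along \<open>\<gamma>\<close>.\<close>

definition cov_deriv_tensor ::
  "('q, 'e::euclidean_space) chart set \<Rightarrow> ('q, 'e) conn \<Rightarrow> real set \<Rightarrow> (real \<Rightarrow> 'q) \<Rightarrow>
     (real \<Rightarrow> ('q, 'e) tvec \<Rightarrow> ('q, 'e) tvec \<Rightarrow> ('q, 'e) tvec \<Rightarrow> ('q, 'e) tvec) \<Rightarrow>
     real \<Rightarrow> ('q, 'e) tvec \<Rightarrow> ('q, 'e) tvec \<Rightarrow> ('q, 'e) tvec \<Rightarrow> ('q, 'e) tvec" where
  "cov_deriv_tensor A nabla I \<gamma> S t u v w =
     (let D = cov_deriv A nabla I \<gamma> in
      THE r. \<forall>W X Y Z. open W \<and> t \<in> W \<and>
        smooth_field_along A (I \<inter> W) \<gamma> X \<and> smooth_field_along A (I \<inter> W) \<gamma> Y \<and>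
        smooth_field_along A (I \<inter> W) \<gamma> Z \<and> X t = u \<and> Y t = v \<and> Z t = w \<longrightarrow>
        r = D (\<lambda>s. S s (X s) (Y s) (Z s)) t
            - S t (D X t) v w - S t u (D Y t) w - S t u v (D Z t))"

text \<open>Limit in the tangent bundle of a field along a curve which is continuous at \<open>t\<close>; used with the
  filters \<open>at_left t\<close> and \<open>at_right t\<close>.\<close>

definition field_limit ::
  "('q, 'e::euclidean_space) chart set \<Rightarrow> (real \<Rightarrow> 'q) \<Rightarrow> (real \<Rightarrow> ('q, 'e) tvec) \<Rightarrow> real \<Rightarrow>
     real filter \<Rightarrow> ('q, 'e) tvec" where
  "field_limit A \<gamma> X t F = (\<lambda>c. if c \<in> charts_at A (\<gamma> t) then Lim F (\<lambda>s. X s c) else 0)"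

definition geodesically_complete ::
  "('q::topological_space, 'e::euclidean_space) chart set \<Rightarrow> ('q, 'e) conn \<Rightarrow> bool" where
  "geodesically_complete A nabla \<longleftrightarrow> (\<forall>p. \<forall>v\<in>tangent_space A p.
     \<exists>\<gamma>. smooth_map_on A UNIV \<gamma> \<and> \<gamma> 0 = p \<and> velocity A UNIV \<gamma> 0 = v \<and>
         (\<forall>t. cov_deriv A nabla UNIV \<gamma> (velocity A UNIV \<gamma>) t = 0))"


section \<open>The variational problem\<close>

text \<open>The points \<open>0 = t 0 < t 1 < \<dots> < t l < t (l + 1) = T\<close>.\<close>

definition subdivision :: "real \<Rightarrow> nat \<Rightarrow> (nat \<Rightarrow> real) \<Rightarrow> bool" where
  "subdivision T l t \<longleftrightarrow> t 0 = 0 \<and> t (Suc l) = T \<and> (\<forall>i\<le>l. t i < t (Suc i))"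

text \<open>Curves \<open>[0, T] \<rightarrow> Q\<close> are functions on the reals whose values outside of \<open>[0, T]\<close> are
  irrelevant.\<close>

definition Omega ::
  "('q::topological_space, 'e::euclidean_space) chart set \<Rightarrow> real \<Rightarrow>
     'q \<times> ('q, 'e) tvec \<Rightarrow> 'q \<times> ('q, 'e) tvec \<Rightarrow> (real \<Rightarrow> 'q) set" where
  "Omega A T \<xi> \<eta> = {\<gamma>.
     continuous_on {0..T} \<gamma> \<and>
     (\<forall>c\<in>A. C1_within {0..T} {t \<in> {0..T}. \<gamma> t \<in> fst c} (\<lambda>t. snd c (\<gamma> t))) \<and>
     (\<exists>l t. subdivision T l t \<and> (\<forall>i\<le>l. smooth_map_on A {t i..t (Suc i)} \<gamma>)) \<and>
     (\<gamma> 0, velocity A {0..T} \<gamma> 0) = \<xi> \<and> (\<gamma> T, velocity A {0..T} \<gamma> T) = \<eta>}"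

definition tangent_Omega ::
  "('q, 'e::euclidean_space) chart set \<Rightarrow> ('q, 'e) conn \<Rightarrow> real \<Rightarrow>
     (real \<Rightarrow> 'q) \<Rightarrow> (real \<Rightarrow> ('q, 'e) tvec) set" where
  "tangent_Omega A nabla T q = {X.
     (\<forall>t\<in>{0..T}. X t \<in> tangent_space A (q t)) \<and>
     (\<forall>c\<in>A. C1_within {0..T} {t \<in> {0..T}. q t \<in> fst c} (\<lambda>t. X t c)) \<and>
     (\<exists>l t. subdivision T l t \<and> (\<forall>i\<le>l. smooth_field_along A {t i..t (Suc i)} q X)) \<and>
     X 0 = 0 \<and> X T = 0 \<and>
     cov_deriv A nabla {0..T} q X 0 = 0 \<and> cov_deriv A nabla {0..T} q X T = 0}"

definition J_functional ::
  "('q, 'e::euclidean_space) chart set \<Rightarrow> ('q \<Rightarrow> ('q, 'e) tvec \<Rightarrow> ('q, 'e) tvec \<Rightarrow> real) \<Rightarrow>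
     ('q, 'e) conn \<Rightarrow> ('q \<Rightarrow> real) \<Rightarrow> real \<Rightarrow> (real \<Rightarrow> 'q) \<Rightarrow> real" where
  "J_functional A g nabla V T \<gamma> =
     (let a = cov_deriv A nabla {0..T} \<gamma> (velocity A {0..T} \<gamma>)
      in integral {0..T} (\<lambda>t. 1/2 * g (\<gamma> t) (a t) (a t) + V (\<gamma> t)))"

definition modified_cubic ::
  "('q::topological_space, 'e::euclidean_space) chart set \<Rightarrow>
     ('q \<Rightarrow> ('q, 'e) tvec \<Rightarrow> ('q, 'e) tvec \<Rightarrow> real) \<Rightarrow>
     ('q, 'e) conn \<Rightarrow> ('q \<Rightarrow> real) \<Rightarrow> real \<Rightarrow> (real \<Rightarrow> 'q) \<Rightarrow> bool" where
  "modified_cubic A g nabla V T q \<longleftrightarrow> smooth_map_on A {0..T} q \<and>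
     (let dq = velocity A {0..T} q; D = cov_deriv_pow A nabla {0..T} q
      in \<forall>t\<in>{0..T}. D 3 dq t + curvature A nabla (q t) (D 1 dq t) (dq t) (dq t)
           + gradient A g V (q t) = 0)"

definition smooth_strip ::
  "('q::topological_space, 'e::euclidean_space) chart set \<Rightarrow> real \<Rightarrow> real \<Rightarrow> real set \<Rightarrow>
     (real \<Rightarrow> real \<Rightarrow> real \<Rightarrow> 'q) \<Rightarrow> bool" where
  "smooth_strip A er es I \<alpha> \<longleftrightarrow>
     smooth_map_on A ({-er<..<er} \<times> {-es<..<es} \<times> I) (\<lambda>(r, s, t). \<alpha> r s t)"

definition two_parameter_variation ::
  "('q::topological_space, 'e::euclidean_space) chart set \<Rightarrow> ('q, 'e) conn \<Rightarrow> real \<Rightarrow>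
     'q \<times> ('q, 'e) tvec \<Rightarrow> 'q \<times> ('q, 'e) tvec \<Rightarrow> (real \<Rightarrow> 'q) \<Rightarrow> real \<Rightarrow> real \<Rightarrow>
     (real \<Rightarrow> real \<Rightarrow> real \<Rightarrow> 'q) \<Rightarrow>
     (real \<Rightarrow> ('q, 'e) tvec) \<Rightarrow> (real \<Rightarrow> ('q, 'e) tvec) \<Rightarrow> bool" where
  "two_parameter_variation A nabla T \<xi> \<eta> q er es \<alpha> X Y \<longleftrightarrow>
     0 < er \<and> 0 < es \<and>
     (\<exists>l t. subdivision T l t \<and> (\<forall>i\<le>l. smooth_strip A er es {t i..t (Suc i)} \<alpha>)) \<and>
     (\<forall>r\<in>{-er<..<er}. \<forall>s\<in>{-es<..<es}. \<alpha> r s \<in> Omega A T \<xi> \<eta>) \<and>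
     (\<forall>t\<in>{0..T}. \<alpha> 0 0 t = q t) \<and>
     X \<in> tangent_Omega A nabla T q \<and> Y \<in> tangent_Omega A nabla T q \<and>
     (\<forall>t\<in>{0..T}. X t = velocity A {-er<..<er} (\<lambda>r. \<alpha> r 0 t) 0 \<and>
                 Y t = velocity A {-es<..<es} (\<lambda>s. \<alpha> 0 s t) 0)"

text \<open>\<open>F(X, q')\<close> at time \<open>t\<close>, for a curve \<open>q\<close> on \<open>I\<close> and a field \<open>X\<close> along it. Derivatives in
  the direction of \<open>q'\<close> are covariant derivatives along \<open>q\<close>; in particular \<open>R1\<close> and \<open>R2\<close> are the
  first and second covariant derivatives of \<open>t \<mapsto> R\<^bsub>q(t)\<^esub>\<close>.\<close>

definition F_term ::
  "('q::topological_space, 'e::euclidean_space) chart set \<Rightarrow> ('q, 'e) conn \<Rightarrow> real set \<Rightarrow>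
     (real \<Rightarrow> 'q) \<Rightarrow> (real \<Rightarrow> ('q, 'e) tvec) \<Rightarrow> real \<Rightarrow> ('q, 'e) tvec" where
  "F_term A nabla I q X t =
     (let D = cov_deriv_pow A nabla I q; dq = velocity A I q;
          y = dq t; y1 = D 1 dq t; y2 = D 2 dq t;
          x = X t; x1 = D 1 X t; x2 = D 2 X t;
          Rq = (\<lambda>s. curvature A nabla (q s)); DR = cov_deriv_tensor A nabla I q;
          R = Rq t; R1 = DR Rq t; R2 = DR (DR Rq) t
      in R2 x y y + nabla_curvature A nabla (q t) x y1 y y + R (R x y y) y y + R x y2 y
         + 2 *\<^sub>R (R1 x1 y y + R1 x y1 y + R x2 y y)
         + 3 *\<^sub>R (R1 x y y1 + R x y y2 + R x y1 y1)
         + 4 *\<^sub>R R x1 y y1)"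

end

theory Submission
  imports Defs
begin

text \<open>
  Write \<open>S, X, Z\<close> for the derivatives of the variation \<open>\<alpha>(r, s, t)\<close> in the directions of \<open>s, r, t\<close>,
  and \<open>D\<^sub>t\<close> etc. for covariant derivatives along \<open>\<alpha>\<close>. On a strip \<open>t\<^sub>i \<le> t \<le> t\<^sub>i\<^sub>+\<^sub>1\<close>, where
  everything is smooth, commuting \<open>D\<^sub>s\<close> with \<open>D\<^sub>t\<close> at the price of a curvature term and integrating by
  parts twice gives, for the integrand \<open>f = 1/2 |D\<^sub>t Z|\<^sup>2 + V\<close>,
    \<open>\<partial>\<^sub>s f = \<partial>\<^sub>t B + \<langle>S, E\<rangle>\<close> with
    \<open>B = \<langle>D\<^sub>t S, D\<^sub>t Z\<rangle> - \<langle>S, D\<^sub>t\<^sup>2 Z\<rangle>\<close> and \<open>E = D\<^sub>t\<^sup>3 Z + R(D\<^sub>t Z, Z)Z + grad V\<close>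
  (\<open>first_variation\<close>); the symmetries of the curvature tensor move \<open>S\<close> to the left. Since \<open>E\<close> vanishes
  along the modified cubic \<open>q\<close>, at \<open>r = s = 0\<close>
    \<open>\<partial>\<^sub>r \<partial>\<^sub>s f = \<partial>\<^sub>t \<partial>\<^sub>r B + \<langle>S, D\<^sub>r E\<rangle>\<close>,
  and commuting \<open>D\<^sub>r\<close> through \<open>E\<close> yields \<open>D\<^sub>r E = D\<^sub>t\<^sup>4 X + F(X, Z) + \<nabla>\<^sub>X grad V\<close>
  (\<open>D_er_euler_lagrange\<close>).

  Differentiation under the integral sign and the fundamental theorem of calculus turn this into the
  formula of the theorem, up to the sum over the strips of the differences of \<open>\<partial>\<^sub>r B\<close> at the two ends
  (\<open>second_variation_integral\<close>). At \<open>0\<close> and \<open>T\<close> position and velocity are prescribed, so \<open>B\<close> vanishes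
  there for all \<open>r\<close>. At an inner node \<open>t\<^sub>i\<close> the velocity is continuous for all parameters and the
  acceleration of \<open>q\<close> and its derivative are continuous, so that only the jumps of \<open>D\<^sub>t\<^sup>2 X\<close> and
  \<open>D\<^sub>t\<^sup>3 X\<close> contribute (\<open>boundary_dr_jump\<close>).

  All identities are local, so they are proved in a chart, for maps from an open set of parameters
  into an open set of a Euclidean space that carries Christoffel symbols and a metric. The
  transfer to the manifold consists in finding the coordinate expressions of the invariantly
  defined objects: the connection, which is tensorial in the direction and a derivation, the
  curvature and its covariant derivatives, the gradient, and covariant derivatives along curves. At
  the ends of a strip one-sided derivatives are those of a smooth map on a full neighbourhood
  extending the coordinate expression of \<open>\<alpha>\<close>.
\<close>

section \<open>Smooth functions on open sets\<close>

text \<open>Partial derivatives are directional derivatives along fixed vectors. With the direction as an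
  argument, partial derivatives can be iterated and the chain rule stays a statement about \<open>pd\<close>.\<close>

definition pd :: "'a::real_normed_vector \<Rightarrow> ('a \<Rightarrow> 'b::real_normed_vector) \<Rightarrow> 'a \<Rightarrow> 'b" where
  "pd e f x = frechet_derivative f (at x) e"

lemma pd_eqI: "(f has_derivative f') (at x) \<Longrightarrow> pd e f x = f' e"
  by (simp add: pd_def frechet_derivative_at[symmetric])

lemma has_derivative_pd: "f differentiable (at x) \<Longrightarrow> (f has_derivative (\<lambda>e. pd e f x)) (at x)"
  by (simp add: pd_def frechet_derivative_works[symmetric])

lemma frechet_derivative_cong_open:
  assumes "open S" "x \<in> S" "\<And>y. y \<in> S \<Longrightarrow> f y = g y"
  shows "frechet_derivative f (at x) = frechet_derivative g (at x)"
proof -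
  have "(f has_derivative D) (at x) \<longleftrightarrow> (g has_derivative D) (at x)" for D
    using assms by (metis has_derivative_transform_within_open)
  then show ?thesis by (simp add: frechet_derivative_def)
qed

lemma pd_cong:
  assumes "open S" "x \<in> S" "\<And>y. y \<in> S \<Longrightarrow> f y = g y"
  shows "pd e f x = pd e g x"
  using frechet_derivative_cong_open[OF assms] by (simp add: pd_def)

lemma differentiable_cong_open:
  assumes "open S" "x \<in> S" "\<And>y. y \<in> S \<Longrightarrow> f y = g y" "f differentiable (at x)"
  shows "g differentiable (at x)"
  using assms unfolding differentiable_def by (metis has_derivative_transform_within_open)

lemma C_k_on_cong:
  "open S \<Longrightarrow> (\<And>y. y \<in> S \<Longrightarrow> f y = g y) \<Longrightarrow> C_k_on k S f \<Longrightarrow> C_k_on k S g"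
proof (induction k arbitrary: f g)
  case 0
  then show ?case by (auto cong: continuous_on_cong)
next
  case (Suc k)
  show ?case unfolding C_k_on.simps
  proof (intro conjI ballI allI)
    fix x assume "x \<in> S"
    then show "g differentiable (at x)"
      using Suc.prems by (auto intro: differentiable_cong_open)
  next
    fix v
    have "C_k_on k S (\<lambda>x. frechet_derivative f (at x) v)" using Suc.prems by simp
    moreover have "\<And>x. x \<in> S \<Longrightarrow>
        frechet_derivative f (at x) v = frechet_derivative g (at x) v"
      by (rule fun_cong[OF frechet_derivative_cong_open[OF Suc.prems(1) _ Suc.prems(2)]])
    ultimately show "C_k_on k S (\<lambda>x. frechet_derivative g (at x) v)"
      by (rule Suc.IH[OF Suc.prems(1), rotated])
  qed
qed

lemma C_k_on_SucI:
  assumes "open S" "\<And>x. x \<in> S \<Longrightarrow> (f has_derivative f' x) (at x)"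
    and "\<And>v. C_k_on k S (\<lambda>x. f' x v)"
  shows "C_k_on (Suc k) S f"
proof -
  have "C_k_on k S (\<lambda>x. frechet_derivative f (at x) v)" for v
    by (rule C_k_on_cong[OF assms(1) _ assms(3)[of v]])
      (metis assms(2) frechet_derivative_at)
  then show ?thesis using assms(2) by (auto simp: differentiable_def)
qed

lemma C_k_on_SucD:
  assumes "C_k_on (Suc k) S f"
  shows "x \<in> S \<Longrightarrow> (f has_derivative (\<lambda>e. pd e f x)) (at x)" "C_k_on k S (pd e f)"
  using assms has_derivative_pd[of f x] by (auto simp: pd_def[abs_def])

lemma C_k_on_Suc_imp: "C_k_on (Suc k) S f \<Longrightarrow> C_k_on k S f"
proof (induction k arbitrary: f)
  case 0
  then show ?case
    by (auto intro!: continuous_at_imp_continuous_on differentiable_imp_continuous_within)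
qed auto

lemma C_k_on_subset: "C_k_on k S f \<Longrightarrow> T \<subseteq> S \<Longrightarrow> C_k_on k T f"
  by (induction k arbitrary: f) (auto intro: continuous_on_subset)

text \<open>The definition is a condition on derivatives at single points, hence local.\<close>

lemma C_k_on_local:
  "(\<And>x. x \<in> S \<Longrightarrow> \<exists>W. open W \<and> x \<in> W \<and> C_k_on k W f) \<Longrightarrow> C_k_on k S f"
proof (induction k arbitrary: f)
  case 0
  have "continuous (at x) f" if x: "x \<in> S" for x
  proof -
    obtain W where "open W" "x \<in> W" "continuous_on W f" using 0[OF x] by auto
    then show ?thesis by (simp add: continuous_on_eq_continuous_at)
  qed
  then show ?case by (simp add: continuous_at_imp_continuous_on)
next
  case (Suc k)
  show ?case unfolding C_k_on.simps
  proof (intro conjI ballI allI)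
    fix x assume "x \<in> S"
    from Suc.prems[OF this] show "f differentiable (at x)" by auto
  next
    fix v
    show "C_k_on k S (\<lambda>x. frechet_derivative f (at x) v)"
    proof (rule Suc.IH)
      fix x assume "x \<in> S"
      from Suc.prems[OF this]
      show "\<exists>W. open W \<and> x \<in> W \<and> C_k_on k W (\<lambda>x. frechet_derivative f (at x) v)" by auto
    qed
  qed
qed

lemma C_k_on_const: "C_k_on k S (\<lambda>x. c)"
  by (induction k arbitrary: c) auto

lemma C_k_on_bounded_linear:
  "bounded_linear l \<Longrightarrow> open S \<Longrightarrow> C_k_on k S f \<Longrightarrow> C_k_on k S (\<lambda>x. l (f x))"
proof (induction k arbitrary: f)
  case 0
  then show ?case by (auto intro: bounded_linear.continuous_on)
next
  case (Suc k)
  show ?case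
  proof (rule C_k_on_SucI[OF Suc.prems(2), where f' = "\<lambda>x v. l (pd v f x)"])
    show "((\<lambda>x. l (f x)) has_derivative (\<lambda>v. l (pd v f x))) (at x)" if "x \<in> S" for x
      using C_k_on_SucD(1)[OF Suc.prems(3) that] Suc.prems(1)
      by (rule bounded_linear.has_derivative[rotated])
  qed (use C_k_on_SucD(2)[OF Suc.prems(3)] Suc in auto)
qed

lemma C_k_on_add:
  "open S \<Longrightarrow> C_k_on k S f \<Longrightarrow> C_k_on k S g \<Longrightarrow> C_k_on k S (\<lambda>x. f x + g x)"
proof (induction k arbitrary: f g)
  case 0
  then show ?case by (auto intro: continuous_on_add)
next
  case (Suc k)
  show ?case
    by (rule C_k_on_SucI[OF Suc.prems(1), where f' = "\<lambda>x v. pd v f x + pd v g x"])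
      (use C_k_on_SucD[OF Suc.prems(2)] C_k_on_SucD[OF Suc.prems(3)] Suc
        in \<open>auto intro: has_derivative_add\<close>)
qed

lemma C_k_on_sum:
  assumes "open S" "\<And>i. i \<in> I \<Longrightarrow> C_k_on k S (f i)"
  shows "C_k_on k S (\<lambda>x. \<Sum>i\<in>I. f i x)"
  using assms(2)
  by (induction I rule: infinite_finite_induct) (auto intro: C_k_on_const C_k_on_add assms(1))

lemma C_k_on_bilinear:
  "bounded_bilinear p \<Longrightarrow> open S \<Longrightarrow> C_k_on k S f \<Longrightarrow> C_k_on k S g \<Longrightarrow>
     C_k_on k S (\<lambda>x. p (f x) (g x))"
proof (induction k arbitrary: f g)
  case 0
  then show ?case by (auto intro: bounded_bilinear.continuous_on)
next
  case (Suc k)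
  show ?case
  proof (rule C_k_on_SucI[OF Suc.prems(2), where f' = "\<lambda>x v. p (f x) (pd v g x) + p (pd v f x) (g x)"])
    show "((\<lambda>x. p (f x) (g x)) has_derivative (\<lambda>v. p (f x) (pd v g x) + p (pd v f x) (g x))) (at x)"
      if "x \<in> S" for x
      using C_k_on_SucD(1)[OF Suc.prems(3) that] C_k_on_SucD(1)[OF Suc.prems(4) that]
      by (rule bounded_bilinear.FDERIV[OF Suc.prems(1)])
  next
    fix v
    show "C_k_on k S (\<lambda>x. p (f x) (pd v g x) + p (pd v f x) (g x))"
      using C_k_on_SucD(2)[OF Suc.prems(3)] C_k_on_SucD(2)[OF Suc.prems(4)]
        C_k_on_Suc_imp[OF Suc.prems(3)] C_k_on_Suc_imp[OF Suc.prems(4)] Suc.IH Suc.prems(1,2)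
      by (auto intro!: C_k_on_add)
  qed
qed

lemma linear_euclidean_expand:
  fixes L :: "'a::euclidean_space \<Rightarrow> 'b::real_vector"
  assumes "linear L"
  shows "L u = (\<Sum>i\<in>Basis. (u \<bullet> i) *\<^sub>R L i)"
proof -
  have "L u = L (\<Sum>i\<in>Basis. (u \<bullet> i) *\<^sub>R i)" by (simp add: euclidean_representation)
  also have "\<dots> = (\<Sum>i\<in>Basis. (u \<bullet> i) *\<^sub>R L i)"
    by (simp add: linear_sum[OF assms] linear_scale[OF assms])
  finally show ?thesis .
qed

text \<open>The directional derivative of \<open>g \<circ> f\<close> is a sum over a basis of products of derivatives of \<open>f\<close>
  with derivatives of \<open>g\<close> composed with \<open>f\<close>; this expansion is needed because only directional
  derivatives of \<open>g\<close> in fixed directions are again in the range of the induction hypothesis.\<close>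

lemma C_k_on_compose:
  fixes f :: "'a::euclidean_space \<Rightarrow> 'b::euclidean_space" and g :: "'b \<Rightarrow> 'c::euclidean_space"
  shows "open S \<Longrightarrow> open T \<Longrightarrow> f ` S \<subseteq> T \<Longrightarrow> C_k_on k S f \<Longrightarrow> C_k_on k T g \<Longrightarrow>
    C_k_on k S (\<lambda>x. g (f x))"
proof (induction k arbitrary: g)
  case 0
  then show ?case by (auto intro: continuous_on_compose2)
next
  case (Suc k)
  have D: "((\<lambda>x. g (f x)) has_derivative (\<lambda>v. pd (pd v f x) g (f x))) (at x)" if "x \<in> S" for x
  proof -
    have "f x \<in> T" using that Suc.prems(3) by auto
    with C_k_on_SucD(1)[OF Suc.prems(4) that] C_k_on_SucD(1)[OF Suc.prems(5)]
    show ?thesis by (auto dest: has_derivative_compose)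
  qed
  have eq: "(\<Sum>i\<in>Basis. (pd v f x \<bullet> i) *\<^sub>R pd i g (f x)) = pd (pd v f x) g (f x)"
    if "x \<in> S" for x v
  proof -
    have "f x \<in> T" using that Suc.prems(3) by auto
    then have "linear (\<lambda>e. pd e g (f x))"
      using C_k_on_SucD(1)[OF Suc.prems(5)] has_derivative_linear by blast
    from linear_euclidean_expand[OF this, of "pd v f x"] show ?thesis by simp
  qed
  have sm: "C_k_on k S (\<lambda>x. \<Sum>i\<in>Basis. (pd v f x \<bullet> i) *\<^sub>R pd i g (f x))" for v
    using Suc.prems C_k_on_SucD(2)[OF Suc.prems(4)] C_k_on_SucD(2)[OF Suc.prems(5)]
    by (intro C_k_on_sum C_k_on_bilinear[OF bounded_bilinear_scaleR] Suc.IH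
        C_k_on_bounded_linear[OF bounded_linear_inner_left] C_k_on_Suc_imp[OF Suc.prems(4)]) auto
  have "C_k_on k S (\<lambda>x. pd (pd v f x) g (f x))" for v
    by (rule C_k_on_cong[OF Suc.prems(1) _ sm]) (simp add: eq)
  with D show ?case by (intro C_k_on_SucI[OF Suc.prems(1)])
qed

lemma C_k_on_inverse:
  fixes f :: "'a::euclidean_space \<Rightarrow> real"
  shows "open S \<Longrightarrow> C_k_on k S f \<Longrightarrow> (\<And>x. x \<in> S \<Longrightarrow> f x \<noteq> 0) \<Longrightarrow> C_k_on k S (\<lambda>x. inverse (f x))"
proof (induction k)
  case 0
  then show ?case by (auto intro: continuous_on_inverse)
next
  case (Suc k)
  show ?case
  proof (rule C_k_on_SucI[OF Suc.prems(1)])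
    show "((\<lambda>x. inverse (f x)) has_derivative (\<lambda>v. (- 1) *\<^sub>R ((inverse (f x) * inverse (f x)) * pd v f x))) (at x)"
      if "x \<in> S" for x
      using Deriv.has_derivative_inverse[OF Suc.prems(3)[OF that] C_k_on_SucD(1)[OF Suc.prems(2) that]]
      by (simp add: mult_ac)
    show "C_k_on k S (\<lambda>x. (- 1) *\<^sub>R ((inverse (f x) * inverse (f x)) * pd v f x))" for v
      using Suc C_k_on_Suc_imp[OF Suc.prems(2)] C_k_on_SucD(2)[OF Suc.prems(2)]
      by (intro C_k_on_bounded_linear[OF bounded_linear_scaleR_right]
          C_k_on_bilinear[OF bounded_bilinear_mult]) auto
  qed
qed

definition C_inf_on :: "'a::euclidean_space set \<Rightarrow> ('a \<Rightarrow> 'b::euclidean_space) \<Rightarrow> bool" where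
  "C_inf_on S f \<longleftrightarrow> (\<forall>k. C_k_on k S f)"

lemma C_inf_on_imp_pd: "C_inf_on S f \<Longrightarrow> C_inf_on S (pd e f)"
  unfolding C_inf_on_def by (metis C_k_on_SucD(2))

lemma C_inf_on_has_derivative:
  "C_inf_on S f \<Longrightarrow> x \<in> S \<Longrightarrow> (f has_derivative (\<lambda>e. pd e f x)) (at x)"
  unfolding C_inf_on_def by (metis C_k_on_SucD(1))

lemma C_inf_on_differentiable: "C_inf_on S f \<Longrightarrow> x \<in> S \<Longrightarrow> f differentiable (at x)"
  using C_inf_on_has_derivative differentiable_def by blast

lemma C_inf_on_linear_pd: "C_inf_on S f \<Longrightarrow> x \<in> S \<Longrightarrow> linear (\<lambda>e. pd e f x)"
  using C_inf_on_has_derivative has_derivative_linear by blast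

lemma C_inf_on_continuous: "C_inf_on S f \<Longrightarrow> continuous_on S f"
  unfolding C_inf_on_def by (metis C_k_on.simps(1))

lemma C_inf_on_cong:
  "open S \<Longrightarrow> C_inf_on S f \<Longrightarrow> (\<And>y. y \<in> S \<Longrightarrow> f y = g y) \<Longrightarrow> C_inf_on S g"
  unfolding C_inf_on_def by (auto intro: C_k_on_cong)

lemma C_inf_on_subset: "C_inf_on S f \<Longrightarrow> T \<subseteq> S \<Longrightarrow> C_inf_on T f"
  unfolding C_inf_on_def using C_k_on_subset by blast

lemma C_inf_on_const [simp]: "C_inf_on S (\<lambda>x. c)"
  unfolding C_inf_on_def by (simp add: C_k_on_const)

lemma C_inf_on_bounded_linear:
  "bounded_linear l \<Longrightarrow> open S \<Longrightarrow> C_inf_on S f \<Longrightarrow> C_inf_on S (\<lambda>x. l (f x))"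
  unfolding C_inf_on_def by (simp add: C_k_on_bounded_linear)

lemma C_inf_on_ident: "open S \<Longrightarrow> C_inf_on S (\<lambda>x. x)"
  unfolding C_inf_on_def
proof
  fix k assume "open S" then show "C_k_on k S (\<lambda>x. x)"
  proof (cases k)
    case (Suc j)
    then show ?thesis using \<open>open S\<close>
      by (simp only:) (rule C_k_on_SucI[where f' = "\<lambda>x v. v"], auto intro: C_k_on_const)
  qed (auto intro: continuous_on_id)
qed

lemma C_inf_on_add:
  "open S \<Longrightarrow> C_inf_on S f \<Longrightarrow> C_inf_on S g \<Longrightarrow> C_inf_on S (\<lambda>x. f x + g x)"
  unfolding C_inf_on_def by (simp add: C_k_on_add)

lemma C_inf_on_scaleR_const: "open S \<Longrightarrow> C_inf_on S f \<Longrightarrow> C_inf_on S (\<lambda>x. a *\<^sub>R f x)"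
  by (rule C_inf_on_bounded_linear[OF bounded_linear_scaleR_right])

lemma C_inf_on_minus: "open S \<Longrightarrow> C_inf_on S f \<Longrightarrow> C_inf_on S (\<lambda>x. - f x)"
  by (rule C_inf_on_bounded_linear[OF bounded_linear_minus[OF bounded_linear_ident]])

lemma C_inf_on_diff:
  assumes "open S" "C_inf_on S f" "C_inf_on S g" shows "C_inf_on S (\<lambda>x. f x - g x)"
  using C_inf_on_add[OF assms(1,2) C_inf_on_minus[OF assms(1,3)]] by simp

lemma C_inf_on_sum:
  assumes "open S" "\<And>i. i \<in> I \<Longrightarrow> C_inf_on S (f i)"
  shows "C_inf_on S (\<lambda>x. \<Sum>i\<in>I. f i x)"
  using assms unfolding C_inf_on_def by (simp add: C_k_on_sum)

lemma C_inf_on_scaleR: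
  "open S \<Longrightarrow> C_inf_on S f \<Longrightarrow> C_inf_on S g \<Longrightarrow> C_inf_on S (\<lambda>x. f x *\<^sub>R g x)"
  unfolding C_inf_on_def by (simp add: C_k_on_bilinear[OF bounded_bilinear_scaleR])

lemma C_inf_on_mult:
  fixes f g :: "'a::euclidean_space \<Rightarrow> real"
  shows "open S \<Longrightarrow> C_inf_on S f \<Longrightarrow> C_inf_on S g \<Longrightarrow> C_inf_on S (\<lambda>x. f x * g x)"
  unfolding C_inf_on_def by (simp add: C_k_on_bilinear[OF bounded_bilinear_mult])

lemma C_inf_on_divide:
  fixes f g :: "'a::euclidean_space \<Rightarrow> real"
  shows "open S \<Longrightarrow> C_inf_on S f \<Longrightarrow> C_inf_on S g \<Longrightarrow> (\<And>x. x \<in> S \<Longrightarrow> g x \<noteq> 0) \<Longrightarrow>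
    C_inf_on S (\<lambda>x. f x / g x)"
  unfolding divide_inverse
  by (rule C_inf_on_mult) (auto simp: C_inf_on_def C_k_on_inverse)

lemma C_inf_on_compose:
  fixes f :: "'a::euclidean_space \<Rightarrow> 'b::euclidean_space" and g :: "'b \<Rightarrow> 'c::euclidean_space"
  shows "open S \<Longrightarrow> open T \<Longrightarrow> f ` S \<subseteq> T \<Longrightarrow> C_inf_on S f \<Longrightarrow> C_inf_on T g \<Longrightarrow>
    C_inf_on S (\<lambda>x. g (f x))"
  unfolding C_inf_on_def by (metis C_k_on_compose)

lemma pd_compose:
  assumes "C_inf_on S f" "x \<in> S" "g differentiable (at (f x))"
  shows "pd e (\<lambda>x. g (f x)) x = pd (pd e f x) g (f x)"
  by (rule pd_eqI) (use has_derivative_compose[OF C_inf_on_has_derivative[OF assms(1,2)]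
      has_derivative_pd[OF assms(3)]] in simp)

lemma pd_const [simp]: "pd e (\<lambda>x. c) x = 0"
  by (simp add: pd_def)

lemma pd_ident [simp]: "pd e (\<lambda>x. x) x = e"
  by (simp add: pd_def)

lemma pd_add: "f differentiable (at x) \<Longrightarrow> g differentiable (at x) \<Longrightarrow>
    pd e (\<lambda>x. f x + g x) x = pd e f x + pd e g x"
  by (rule pd_eqI) (auto intro!: has_derivative_add has_derivative_pd)

lemma pd_diff: "f differentiable (at x) \<Longrightarrow> g differentiable (at x) \<Longrightarrow>
    pd e (\<lambda>x. f x - g x) x = pd e f x - pd e g x"
  by (rule pd_eqI) (auto intro!: has_derivative_diff has_derivative_pd)

lemma pd_bounded_linear: "bounded_linear l \<Longrightarrow> f differentiable (at x) \<Longrightarrow>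
    pd e (\<lambda>x. l (f x)) x = l (pd e f x)"
  by (rule pd_eqI) (rule bounded_linear.has_derivative[OF _ has_derivative_pd])

lemma pd_scaleR_const: "f differentiable (at x) \<Longrightarrow> pd e (\<lambda>x. a *\<^sub>R f x) x = a *\<^sub>R pd e f x"
  by (rule pd_bounded_linear[OF bounded_linear_scaleR_right])

lemma pd_sum: "(\<And>i. i \<in> I \<Longrightarrow> f i differentiable (at x)) \<Longrightarrow>
    pd e (\<lambda>x. \<Sum>i\<in>I. f i x) x = (\<Sum>i\<in>I. pd e (f i) x)"
  by (rule pd_eqI) (auto intro!: has_derivative_sum has_derivative_pd)

lemma pd_scaleR: "f differentiable (at x) \<Longrightarrow> g differentiable (at x) \<Longrightarrow>
    pd e (\<lambda>x. f x *\<^sub>R g x) x = f x *\<^sub>R pd e g x + pd e f x *\<^sub>R g x"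
  by (rule pd_eqI) (auto intro!: has_derivative_scaleR has_derivative_pd)

lemma has_vector_derivative_pd:
  assumes "f differentiable (at t)"
  shows "(f has_vector_derivative pd 1 f t) (at t)"
proof -
  have "linear (\<lambda>e. pd e f t)" using has_derivative_pd[OF assms] has_derivative_linear by blast
  have "(\<lambda>e. pd e f t) = (\<lambda>x. x *\<^sub>R pd 1 f t)"
  proof
    fix x show "pd x f t = x *\<^sub>R pd 1 f t"
      using linear_scale[OF \<open>linear (\<lambda>e. pd e f t)\<close>, of x 1] by (simp only: real_scaleR_def mult_1_right)
  qed
  with has_derivative_pd[OF assms] show ?thesis unfolding has_vector_derivative_def by (simp only:)
qed

lemma smooth_onE:
  assumes "smooth_on S f" "x \<in> S"
  obtains W h where "open W" "x \<in> W" "C_inf_on W h" "\<forall>y\<in>S \<inter> W. h y = f y"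
proof -
  have "\<exists>W h. open W \<and> x \<in> W \<and> (\<forall>k. C_k_on k W h) \<and> (\<forall>y\<in>S \<inter> W. h y = f y)"
    using assms unfolding smooth_on_def by (rule bspec)
  then obtain W h where *: "open W" "x \<in> W" "\<forall>k. C_k_on k W h" "\<forall>y\<in>S \<inter> W. h y = f y"
    by (elim exE conjE)
  show ?thesis by (rule that[of W h]) (use * in \<open>auto simp: C_inf_on_def\<close>)
qed

lemma smooth_onI:
  assumes "\<And>x. x \<in> S \<Longrightarrow> \<exists>W h. open W \<and> x \<in> W \<and> C_inf_on W h \<and> (\<forall>y\<in>S \<inter> W. h y = f y)"
  shows "smooth_on S f"
  using assms unfolding smooth_on_def C_inf_on_def by simp

lemma smooth_on_cong:
  assumes "smooth_on S f" "T \<subseteq> S" "\<And>x. x \<in> T \<Longrightarrow> f x = g x"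
  shows "smooth_on T g"
proof (rule smooth_onI)
  fix x assume "x \<in> T"
  with assms(2) have "x \<in> S" by auto
  from assms(1) this obtain W h where "open W" "x \<in> W" "C_inf_on W h"
    "\<forall>y\<in>S \<inter> W. h y = f y" by (rule smooth_onE)
  then show "\<exists>W h. open W \<and> x \<in> W \<and> C_inf_on W h \<and> (\<forall>y\<in>T \<inter> W. h y = g y)"
    using assms(2,3) by (intro exI[of _ W] exI[of _ h]) auto
qed

lemma smooth_on_subset: "smooth_on S f \<Longrightarrow> T \<subseteq> S \<Longrightarrow> smooth_on T f"
  by (erule smooth_on_cong) simp_all

text \<open>On an open set the function coincides with its local extensions on a neighbourhood of each point.\<close>

lemma smooth_on_open_iff:
  assumes S: "open S"
  shows "smooth_on S f \<longleftrightarrow> C_inf_on S f"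
proof
  assume f: "smooth_on S f"
  have "C_k_on k S f" for k
  proof (rule C_k_on_local)
    fix x assume x: "x \<in> S"
    from f x obtain W h where W: "open W" "x \<in> W" "C_inf_on W h"
      "\<forall>y\<in>S \<inter> W. h y = f y" by (rule smooth_onE)
    have "C_inf_on (S \<inter> W) f"
      by (rule C_inf_on_cong[OF _ C_inf_on_subset[OF W(3)]]) (use S W in auto)
    then show "\<exists>W. open W \<and> x \<in> W \<and> C_k_on k W f"
      using S W(1,2) x by (intro exI[of _ "S \<inter> W"]) (auto simp: C_inf_on_def)
  qed
  then show "C_inf_on S f" by (simp add: C_inf_on_def)
next
  assume "C_inf_on S f"
  then show "smooth_on S f" using S by (intro smooth_onI exI[of _ S] exI[of _ f]) auto
qed

section \<open>Symmetry of second derivatives\<close>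

text \<open>The mean value theorem is applied to the difference of \<open>f\<close> along two opposite sides of the
  parallelogram, and then to the derivative that it produces.\<close>

lemma second_difference_mean_value:
  fixes f :: "'a::euclidean_space \<Rightarrow> real"
  assumes f: "C_inf_on S f" and "0 < \<tau>"
    and sub: "\<And>\<sigma> \<rho>. 0 \<le> \<sigma> \<Longrightarrow> \<sigma> \<le> \<tau> \<Longrightarrow> 0 \<le> \<rho> \<Longrightarrow> \<rho> \<le> \<tau> \<Longrightarrow> x + \<sigma> *\<^sub>R d + \<rho> *\<^sub>R e \<in> S"
  shows "\<exists>\<sigma> \<rho>. 0 \<le> \<sigma> \<and> \<sigma> \<le> \<tau> \<and> 0 \<le> \<rho> \<and> \<rho> \<le> \<tau> \<and>
    f (x + \<tau> *\<^sub>R d + \<tau> *\<^sub>R e) - f (x + \<tau> *\<^sub>R d) - f (x + \<tau> *\<^sub>R e) + f x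
      = \<tau>^2 * pd e (pd d f) (x + \<sigma> *\<^sub>R d + \<rho> *\<^sub>R e)"
proof -
  have line: "((\<lambda>\<sigma>. h (y + \<sigma> *\<^sub>R v)) has_real_derivative pd v h (y + \<sigma> *\<^sub>R v)) (at \<sigma>)"
    if "C_inf_on S h" "y + \<sigma> *\<^sub>R v \<in> S" for h :: "'a \<Rightarrow> real" and y v \<sigma>
  proof -
    have 1: "((\<lambda>\<sigma>. y + \<sigma> *\<^sub>R v) has_derivative (\<lambda>s. s *\<^sub>R v)) (at \<sigma>)"
      by (auto intro!: derivative_eq_intros)
    have l: "linear (\<lambda>e. pd e h (y + \<sigma> *\<^sub>R v))" by (rule C_inf_on_linear_pd[OF that])
    show ?thesis
      unfolding has_field_derivative_def
      by (rule has_derivative_eq_rhs[OF has_derivative_compose[OF 1 C_inf_on_has_derivative[OF that]]])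
        (simp add: linear_scale[OF l] mult.commute fun_eq_iff)
  qed
  let ?u = "\<lambda>\<sigma>. f ((x + \<tau> *\<^sub>R e) + \<sigma> *\<^sub>R d) - f (x + \<sigma> *\<^sub>R d)"
  let ?u' = "\<lambda>\<sigma>. pd d f ((x + \<tau> *\<^sub>R e) + \<sigma> *\<^sub>R d) - pd d f (x + \<sigma> *\<^sub>R d)"
  have "\<exists>\<sigma>>0. \<sigma> < \<tau> \<and> ?u \<tau> - ?u 0 = (\<tau> - 0) * ?u' \<sigma>"
  proof (rule MVT2[OF \<open>0 < \<tau>\<close>])
    fix \<sigma> assume "0 \<le> \<sigma>" "\<sigma> \<le> \<tau>"
    then have "x + \<sigma> *\<^sub>R d \<in> S" "(x + \<tau> *\<^sub>R e) + \<sigma> *\<^sub>R d \<in> S"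
      using sub[of \<sigma> 0] sub[of \<sigma> \<tau>] \<open>0 < \<tau>\<close> by (auto simp: add_ac)
    then show "(?u has_real_derivative ?u' \<sigma>) (at \<sigma>)"
      by (intro DERIV_diff line f)
  qed
  then obtain \<sigma> where \<sigma>: "0 < \<sigma>" "\<sigma> < \<tau>" "?u \<tau> - ?u 0 = \<tau> * ?u' \<sigma>" by auto
  let ?w = "\<lambda>\<rho>. pd d f ((x + \<sigma> *\<^sub>R d) + \<rho> *\<^sub>R e)"
  have "\<exists>\<rho>>0. \<rho> < \<tau> \<and> ?w \<tau> - ?w 0 = (\<tau> - 0) * pd e (pd d f) ((x + \<sigma> *\<^sub>R d) + \<rho> *\<^sub>R e)"
    using \<sigma> sub by (intro MVT2[OF \<open>0 < \<tau>\<close>] line C_inf_on_imp_pd f) auto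
  then obtain \<rho> where \<rho>: "0 < \<rho>" "\<rho> < \<tau>"
    "?w \<tau> - ?w 0 = \<tau> * pd e (pd d f) (x + \<sigma> *\<^sub>R d + \<rho> *\<^sub>R e)" by auto
  have "?u' \<sigma> = ?w \<tau> - ?w 0" by (simp add: add_ac)
  then have "?u \<tau> - ?u 0 = \<tau>^2 * pd e (pd d f) (x + \<sigma> *\<^sub>R d + \<rho> *\<^sub>R e)"
    using \<sigma>(3) \<rho>(3) by (simp add: power2_eq_square)
  moreover have "f (x + \<tau> *\<^sub>R d + \<tau> *\<^sub>R e) - f (x + \<tau> *\<^sub>R d) - f (x + \<tau> *\<^sub>R e) + f x = ?u \<tau> - ?u 0"
    by (simp add: add_ac)
  ultimately show ?thesis using \<sigma>(1,2) \<rho>(1,2)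
    by - (rule exI[of _ \<sigma>], rule exI[of _ \<rho>], simp only: less_imp_le simp_thms)
qed

text \<open>Evaluate the second difference in both orders and shrink the parallelogram.\<close>

lemma pd_commute_real:
  fixes f :: "'a::euclidean_space \<Rightarrow> real"
  assumes S: "open S" and f: "C_inf_on S f" and x: "x \<in> S"
  shows "pd e (pd d f) x = pd d (pd e f) x"
proof (rule ccontr)
  assume ne: "pd e (pd d f) x \<noteq> pd d (pd e f) x"
  define \<epsilon> where "\<epsilon> = \<bar>pd e (pd d f) x - pd d (pd e f) x\<bar> / 2"
  have "\<epsilon> > 0" using ne by (simp add: \<epsilon>_def)
  have cont: "isCont (pd e (pd d f)) x" "isCont (pd d (pd e f)) x"
    using C_inf_on_continuous[OF C_inf_on_imp_pd[OF C_inf_on_imp_pd[OF f]]] S x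
    by (auto simp: continuous_on_eq_continuous_at)
  obtain \<delta>1 where \<delta>1: "\<delta>1 > 0" "\<And>y. dist y x < \<delta>1 \<Longrightarrow> dist (pd e (pd d f) y) (pd e (pd d f) x) < \<epsilon>"
    using cont(1) \<open>\<epsilon> > 0\<close> unfolding continuous_at_eps_delta by (metis dist_norm)
  obtain \<delta>2 where \<delta>2: "\<delta>2 > 0" "\<And>y. dist y x < \<delta>2 \<Longrightarrow> dist (pd d (pd e f) y) (pd d (pd e f) x) < \<epsilon>"
    using cont(2) \<open>\<epsilon> > 0\<close> unfolding continuous_at_eps_delta by (metis dist_norm)
  obtain \<delta>3 where \<delta>3: "\<delta>3 > 0" "\<And>y. dist y x < \<delta>3 \<Longrightarrow> y \<in> S"
    using S x unfolding open_dist by blast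
  define \<delta> where "\<delta> = min \<delta>1 (min \<delta>2 \<delta>3)"
  define K where "K = norm d + norm e + 1"
  have "K > 0" by (simp add: K_def add_nonneg_pos)
  \<comment> \<open>Small enough for the parallelogram to stay in the ball of radius \<open>\<delta>\<close> around \<open>x\<close>.\<close>
  define \<tau> where "\<tau> = \<delta> / (2 * K)"
  have "\<delta> > 0" using \<delta>1 \<delta>2 \<delta>3 by (simp add: \<delta>_def)
  then have "\<tau> > 0" using \<open>K > 0\<close> by (simp add: \<tau>_def)
  have near: "dist (x + \<sigma> *\<^sub>R d + \<rho> *\<^sub>R e) x < \<delta>" if "0 \<le> \<sigma>" "\<sigma> \<le> \<tau>" "0 \<le> \<rho>" "\<rho> \<le> \<tau>" for \<sigma> \<rho>
  proof -
    have "dist (x + \<sigma> *\<^sub>R d + \<rho> *\<^sub>R e) x \<le> \<sigma> * norm d + \<rho> * norm e"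
      using norm_triangle_ineq[of "\<sigma> *\<^sub>R d" "\<rho> *\<^sub>R e"] that by (simp add: dist_norm)
    also have "\<dots> \<le> \<tau> * norm d + \<tau> * norm e" using that by (intro add_mono mult_right_mono) auto
    also have "\<dots> \<le> \<tau> * K" using \<open>\<tau> > 0\<close> by (simp add: K_def algebra_simps)
    also have "\<dots> = \<delta> / 2" using \<open>K > 0\<close> by (simp add: \<tau>_def)
    also have "\<dots> < \<delta>" using \<open>\<delta> > 0\<close> by simp
    finally show ?thesis .
  qed
  have sub: "x + \<sigma> *\<^sub>R d + \<rho> *\<^sub>R e \<in> S" if "0 \<le> \<sigma>" "\<sigma> \<le> \<tau>" "0 \<le> \<rho>" "\<rho> \<le> \<tau>" for \<sigma> \<rho>
    using near[OF that] \<delta>3 by (simp add: \<delta>_def)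
  have "\<exists>\<sigma> \<rho>. 0 \<le> \<sigma> \<and> \<sigma> \<le> \<tau> \<and> 0 \<le> \<rho> \<and> \<rho> \<le> \<tau> \<and>
    f (x + \<tau> *\<^sub>R d + \<tau> *\<^sub>R e) - f (x + \<tau> *\<^sub>R d) - f (x + \<tau> *\<^sub>R e) + f x
      = \<tau>^2 * pd e (pd d f) (x + \<sigma> *\<^sub>R d + \<rho> *\<^sub>R e)"
    by (rule second_difference_mean_value[OF f \<open>\<tau> > 0\<close> sub])
  then obtain \<sigma> \<rho> where 1: "0 \<le> \<sigma>" "\<sigma> \<le> \<tau>" "0 \<le> \<rho>" "\<rho> \<le> \<tau>"
    "f (x + \<tau> *\<^sub>R d + \<tau> *\<^sub>R e) - f (x + \<tau> *\<^sub>R d) - f (x + \<tau> *\<^sub>R e) + f x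
      = \<tau>^2 * pd e (pd d f) (x + \<sigma> *\<^sub>R d + \<rho> *\<^sub>R e)"
    by (elim exE conjE)
  have sub': "x + \<sigma> *\<^sub>R e + \<rho> *\<^sub>R d \<in> S" if "0 \<le> \<sigma>" "\<sigma> \<le> \<tau>" "0 \<le> \<rho>" "\<rho> \<le> \<tau>" for \<sigma> \<rho>
    using sub[OF that(3,4,1,2)] by (simp add: add_ac)
  have "\<exists>\<sigma> \<rho>. 0 \<le> \<sigma> \<and> \<sigma> \<le> \<tau> \<and> 0 \<le> \<rho> \<and> \<rho> \<le> \<tau> \<and>
    f (x + \<tau> *\<^sub>R e + \<tau> *\<^sub>R d) - f (x + \<tau> *\<^sub>R e) - f (x + \<tau> *\<^sub>R d) + f x
      = \<tau>^2 * pd d (pd e f) (x + \<sigma> *\<^sub>R e + \<rho> *\<^sub>R d)"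
    by (rule second_difference_mean_value[OF f \<open>\<tau> > 0\<close> sub'])
  then obtain \<sigma>' \<rho>' where 2: "0 \<le> \<sigma>'" "\<sigma>' \<le> \<tau>" "0 \<le> \<rho>'" "\<rho>' \<le> \<tau>"
    "f (x + \<tau> *\<^sub>R e + \<tau> *\<^sub>R d) - f (x + \<tau> *\<^sub>R e) - f (x + \<tau> *\<^sub>R d) + f x
      = \<tau>^2 * pd d (pd e f) (x + \<sigma>' *\<^sub>R e + \<rho>' *\<^sub>R d)"
    by (elim exE conjE)
  have swap: "x + a *\<^sub>R e + c *\<^sub>R d = x + c *\<^sub>R d + a *\<^sub>R e" for a c by (simp add: add_ac)
  have "\<tau>^2 * pd e (pd d f) (x + \<sigma> *\<^sub>R d + \<rho> *\<^sub>R e) = \<tau>^2 * pd d (pd e f) (x + \<rho>' *\<^sub>R d + \<sigma>' *\<^sub>R e)"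
    using 1(5) 2(5) unfolding swap by linarith
  then have "pd e (pd d f) (x + \<sigma> *\<^sub>R d + \<rho> *\<^sub>R e) = pd d (pd e f) (x + \<rho>' *\<^sub>R d + \<sigma>' *\<^sub>R e)"
    using \<open>\<tau> > 0\<close> by simp
  moreover have "dist (pd e (pd d f) (x + \<sigma> *\<^sub>R d + \<rho> *\<^sub>R e)) (pd e (pd d f) x) < \<epsilon>"
    using near[OF 1(1-4)] by (intro \<delta>1(2)) (simp add: \<delta>_def)
  moreover have "dist (pd d (pd e f) (x + \<rho>' *\<^sub>R d + \<sigma>' *\<^sub>R e)) (pd d (pd e f) x) < \<epsilon>"
    using near[OF 2(3,4,1,2)] by (intro \<delta>2(2)) (simp add: \<delta>_def)
  ultimately have "\<bar>pd e (pd d f) x - pd d (pd e f) x\<bar> < 2 * \<epsilon>"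
    unfolding dist_real_def by linarith
  then show False by (simp add: \<epsilon>_def)
qed

lemma pd_commute:
  fixes f :: "'a::euclidean_space \<Rightarrow> 'b::euclidean_space"
  assumes S: "open S" and f: "C_inf_on S f" and x: "x \<in> S"
  shows "pd e (pd d f) x = pd d (pd e f) x"
proof (rule euclidean_eqI)
  fix i :: 'b
  have *: "pd e (pd d (\<lambda>y. f y \<bullet> i)) x = pd e (pd d f) x \<bullet> i" for d e
  proof -
    have "pd e (pd d (\<lambda>y. f y \<bullet> i)) x = pd e (\<lambda>y. pd d f y \<bullet> i) x"
      by (rule pd_cong[OF S x]) (rule pd_bounded_linear[OF bounded_linear_inner_left C_inf_on_differentiable[OF f]])
    also have "\<dots> = pd e (pd d f) x \<bullet> i"
      by (rule pd_bounded_linear[OF bounded_linear_inner_left C_inf_on_differentiable[OF C_inf_on_imp_pd[OF f] x]])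
    finally show ?thesis .
  qed
  show "pd e (pd d f) x \<bullet> i = pd d (pd e f) x \<bullet> i"
    using pd_commute_real[OF S C_inf_on_bounded_linear[OF bounded_linear_inner_left S f] x] * by metis
qed

section \<open>Smooth families of multilinear maps\<close>

text \<open>Smoothness is only defined for maps into Euclidean spaces. A smooth family of multilinear maps is
  therefore smooth for every choice of fixed arguments, which suffices as the arguments can be
  expanded in a basis.\<close>

definition lin_fam :: "'p::euclidean_space set \<Rightarrow> ('p \<Rightarrow> 'a::euclidean_space \<Rightarrow> 'b::euclidean_space) \<Rightarrow> bool" where
  "lin_fam W L \<longleftrightarrow> (\<forall>y\<in>W. linear (L y)) \<and> (\<forall>u. C_inf_on W (\<lambda>y. L y u))"

definition bil_fam :: "'p::euclidean_space set \<Rightarrow>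
    ('p \<Rightarrow> 'a::euclidean_space \<Rightarrow> 'b::euclidean_space \<Rightarrow> 'c::euclidean_space) \<Rightarrow> bool" where
  "bil_fam W M \<longleftrightarrow> (\<forall>y\<in>W. \<forall>u. linear (M y u)) \<and> (\<forall>y\<in>W. \<forall>v. linear (\<lambda>u. M y u v)) \<and>
     (\<forall>u v. C_inf_on W (\<lambda>y. M y u v))"

definition tri_fam :: "'p::euclidean_space set \<Rightarrow>
    ('p \<Rightarrow> 'a::euclidean_space \<Rightarrow> 'a \<Rightarrow> 'a \<Rightarrow> 'c::euclidean_space) \<Rightarrow> bool" where
  "tri_fam W M \<longleftrightarrow> (\<forall>y\<in>W. \<forall>u v. linear (M y u v)) \<and> (\<forall>y\<in>W. \<forall>u w. linear (\<lambda>v. M y u v w)) \<and>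
     (\<forall>y\<in>W. \<forall>v w. linear (\<lambda>u. M y u v w)) \<and> (\<forall>u v w. C_inf_on W (\<lambda>y. M y u v w))"

text \<open>The product rule for inserting a smooth vector into a smooth family of linear maps; those for
  bilinear and trilinear families follow by inserting one argument after the other.\<close>

lemma lin_fam_app:
  assumes W: "open W" and L: "lin_fam W L" and U: "C_inf_on W U"
  shows "C_inf_on W (\<lambda>y. L y (U y))"
    and "y \<in> W \<Longrightarrow> pd e (\<lambda>y. L y (U y)) y = pd e (\<lambda>z. L z (U y)) y + L y (pd e U y)"
proof -
  have lin: "linear (L y)" if "y \<in> W" for y using L that by (simp add: lin_fam_def)
  have sm: "C_inf_on W (\<lambda>y. L y u)" for u using L by (simp add: lin_fam_def)
  have ex: "(\<Sum>i\<in>Basis. (U y \<bullet> i) *\<^sub>R L y i) = L y (U y)" if "y \<in> W" for y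
    using linear_euclidean_expand[OF lin[OF that], of "U y"] by simp
  have Ui: "C_inf_on W (\<lambda>y. U y \<bullet> i)" for i
    by (rule C_inf_on_bounded_linear[OF bounded_linear_inner_left W U])
  show "C_inf_on W (\<lambda>y. L y (U y))"
    by (rule C_inf_on_cong[OF W C_inf_on_sum[OF W C_inf_on_scaleR[OF W Ui sm]] ex])
  assume y: "y \<in> W"
  have pdU: "pd e (\<lambda>y. U y \<bullet> i) y = pd e U y \<bullet> i" for i
    by (rule pd_bounded_linear[OF bounded_linear_inner_left C_inf_on_differentiable[OF U y]])
  have "pd e (\<lambda>y. L y (U y)) y = pd e (\<lambda>y. \<Sum>i\<in>Basis. (U y \<bullet> i) *\<^sub>R L y i) y"
    by (rule pd_cong[OF W y]) (rule ex[symmetric])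
  also have "\<dots> = (\<Sum>i\<in>Basis. pd e (\<lambda>y. (U y \<bullet> i) *\<^sub>R L y i) y)"
    by (rule pd_sum, rule C_inf_on_differentiable[OF _ y], rule C_inf_on_scaleR[OF W Ui sm])
  also have "\<dots> = (\<Sum>i\<in>Basis. (U y \<bullet> i) *\<^sub>R pd e (\<lambda>z. L z i) y + (pd e U y \<bullet> i) *\<^sub>R L y i)"
    by (simp only: pd_scaleR[OF C_inf_on_differentiable[OF Ui y] C_inf_on_differentiable[OF sm y]] pdU)
  also have "\<dots> = (\<Sum>i\<in>Basis. (U y \<bullet> i) *\<^sub>R pd e (\<lambda>z. L z i) y) + L y (pd e U y)"
    using linear_euclidean_expand[OF lin[OF y], of "pd e U y"] by (simp add: sum.distrib)
  also have "(\<Sum>i\<in>Basis. (U y \<bullet> i) *\<^sub>R pd e (\<lambda>z. L z i) y) = pd e (\<lambda>z. \<Sum>i\<in>Basis. (U y \<bullet> i) *\<^sub>R L z i) y"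
    by (subst pd_sum[OF C_inf_on_differentiable[OF C_inf_on_scaleR_const[OF W sm] y]])
      (simp only: pd_scaleR_const[OF C_inf_on_differentiable[OF sm y]])
  also have "\<dots> = pd e (\<lambda>z. L z (U y)) y"
    by (rule pd_cong[OF W y]) (rule linear_euclidean_expand[OF lin, symmetric])
  finally show "pd e (\<lambda>y. L y (U y)) y = pd e (\<lambda>z. L z (U y)) y + L y (pd e U y)" .
qed

lemma bil_fam_lin1: "open W \<Longrightarrow> bil_fam W M \<Longrightarrow> lin_fam W (\<lambda>y u. M y u v)"
  by (simp add: bil_fam_def lin_fam_def)

lemma bil_fam_lin2: "open W \<Longrightarrow> bil_fam W M \<Longrightarrow> C_inf_on W U \<Longrightarrow> lin_fam W (\<lambda>y. M y (U y))"
  using lin_fam_app(1)[OF _ bil_fam_lin1, of W M U] by (simp add: bil_fam_def lin_fam_def)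

lemma bil_fam_app:
  assumes W: "open W" and M: "bil_fam W M" and U: "C_inf_on W U" and V: "C_inf_on W V"
  shows "C_inf_on W (\<lambda>y. M y (U y) (V y))"
    and "y \<in> W \<Longrightarrow> pd e (\<lambda>y. M y (U y) (V y)) y =
      pd e (\<lambda>z. M z (U y) (V y)) y + M y (pd e U y) (V y) + M y (U y) (pd e V y)"
  using lin_fam_app[OF W bil_fam_lin2[OF W M U] V] lin_fam_app(2)[OF W bil_fam_lin1[OF W M] U]
  by auto

lemma tri_fam_bil: "open W \<Longrightarrow> tri_fam W M \<Longrightarrow> C_inf_on W U \<Longrightarrow> bil_fam W (\<lambda>y. M y (U y))"
  using lin_fam_app(1)[of W "\<lambda>y u. M y u v w" U for v w]
  by (simp add: bil_fam_def lin_fam_def tri_fam_def)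

lemma tri_fam_app:
  assumes W: "open W" and M: "tri_fam W M" and U: "C_inf_on W U" and V: "C_inf_on W V"
    and Z: "C_inf_on W Z"
  shows "C_inf_on W (\<lambda>y. M y (U y) (V y) (Z y))"
    and "y \<in> W \<Longrightarrow> pd e (\<lambda>y. M y (U y) (V y) (Z y)) y =
      pd e (\<lambda>z. M z (U y) (V y) (Z y)) y + M y (pd e U y) (V y) (Z y)
      + M y (U y) (pd e V y) (Z y) + M y (U y) (V y) (pd e Z y)"
proof -
  have L: "lin_fam W (\<lambda>y u. M y u v w)" for v w using M by (simp add: lin_fam_def tri_fam_def)
  show "C_inf_on W (\<lambda>y. M y (U y) (V y) (Z y))"
    by (rule bil_fam_app[OF W tri_fam_bil[OF W M U] V Z])
  assume y: "y \<in> W"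
  show "pd e (\<lambda>y. M y (U y) (V y) (Z y)) y =
      pd e (\<lambda>z. M z (U y) (V y) (Z y)) y + M y (pd e U y) (V y) (Z y)
      + M y (U y) (pd e V y) (Z y) + M y (U y) (V y) (pd e Z y)"
    using bil_fam_app(2)[OF W tri_fam_bil[OF W M U] V Z y] lin_fam_app(2)[OF W L U y] by simp
qed

lemma bil_fam_compose:
  assumes "open W" "open \<Omega>" "h ` W \<subseteq> \<Omega>" "C_inf_on W h" "bil_fam \<Omega> M"
  shows "bil_fam W (\<lambda>y. M (h y))"
proof -
  have "C_inf_on W (\<lambda>y. M (h y) u v)" for u v
    by (rule C_inf_on_compose[OF assms(1-4)]) (use assms(5) in \<open>simp add: bil_fam_def\<close>)
  then show ?thesis using assms(3,5) by (auto simp: bil_fam_def)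
qed

lemma tri_fam_compose:
  assumes "open W" "open \<Omega>" "h ` W \<subseteq> \<Omega>" "C_inf_on W h" "tri_fam \<Omega> M"
  shows "tri_fam W (\<lambda>y. M (h y))"
proof -
  have "C_inf_on W (\<lambda>y. M (h y) u v w)" for u v w
    by (rule C_inf_on_compose[OF assms(1-4)]) (use assms(5) in \<open>simp add: tri_fam_def\<close>)
  then show ?thesis using assms(3,5) by (auto simp: tri_fam_def)
qed

section \<open>Smooth Riesz representation\<close>

text \<open>The induction on \<open>B\<close> avoids inverting a matrix: when a vector \<open>b\<close> is added to \<open>B\<close>, one step of
  orthogonalisation corrects the old solution, which needs only a division by a nowhere vanishing
  function.\<close>

lemma smooth_riesz_span:
  fixes G :: "'p::euclidean_space \<Rightarrow> 'e::euclidean_space \<Rightarrow> 'e \<Rightarrow> real"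
  assumes W: "open W" and G: "bil_fam W G"
    and pos: "\<And>y u. y \<in> W \<Longrightarrow> u \<noteq> 0 \<Longrightarrow> 0 < G y u u"
    and "finite B" "independent B"
    and "lin_fam W \<beta>"
  shows "\<exists>w. C_inf_on W w \<and> (\<forall>y\<in>W. w y \<in> span B \<and> (\<forall>b\<in>B. G y (w y) b = \<beta> y b))"
  using assms(4-)
proof (induction B arbitrary: \<beta> rule: finite_induct)
  case empty
  then show ?case by (intro exI[of _ "\<lambda>_. 0"]) auto
next
  case (insert b B)
  have ind: "independent B" and nb: "b \<notin> span B"
    using insert.prems(1) insert.hyps(2) by (simp_all add: independent_insert)
  obtain w where w: "C_inf_on W w" "\<And>y. y \<in> W \<Longrightarrow> w y \<in> span B"
    "\<And>y c. y \<in> W \<Longrightarrow> c \<in> B \<Longrightarrow> G y (w y) c = \<beta> y c"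
    using insert.IH[OF ind insert.prems(2)] by auto
  have "lin_fam W (\<lambda>y. G y b)" using G by (simp add: bil_fam_def lin_fam_def)
  then obtain p where p: "C_inf_on W p" "\<And>y. y \<in> W \<Longrightarrow> p y \<in> span B"
    "\<And>y c. y \<in> W \<Longrightarrow> c \<in> B \<Longrightarrow> G y (p y) c = G y b c"
    using insert.IH[OF ind, of "\<lambda>y. G y b"] by auto
  \<comment> \<open>\<open>e\<close> is \<open>b\<close> made orthogonal to the span of \<open>B\<close>; adding a multiple of it to \<open>w\<close> does not
    disturb the equations for the elements of \<open>B\<close>.\<close>
  define e where "e = (\<lambda>y. b - p y)"
  define k where "k = (\<lambda>y. (\<beta> y b - G y (w y) b) / G y (e y) (e y))"
  have e: "C_inf_on W e" unfolding e_def by (intro C_inf_on_diff W p(1)) simp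
  have e0: "e y \<noteq> 0" if "y \<in> W" for y using p(2)[OF that] nb by (auto simp: e_def)
  have k: "C_inf_on W k" unfolding k_def
  proof (intro C_inf_on_divide C_inf_on_diff W)
    show "C_inf_on W (\<lambda>y. \<beta> y b)" using insert.prems(2) by (simp add: lin_fam_def)
    show "C_inf_on W (\<lambda>y. G y (w y) b)" by (rule bil_fam_app(1)[OF W G w(1)]) simp
    show "C_inf_on W (\<lambda>y. G y (e y) (e y))" by (rule bil_fam_app(1)[OF W G e e])
  qed (use pos e0 in force)
  have lin1: "G y (u + v) c = G y u c + G y v c" "G y (a *\<^sub>R u) c = a * G y u c"
    "G y (u - v) c = G y u c - G y v c"
    "linear (G y u)" if "y \<in> W" for y u v c a
    using G that linear_add[of "\<lambda>u. G y u c"] linear_scale[of "\<lambda>u. G y u c"] linear_diff[of "\<lambda>u. G y u c"]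
    by (auto simp: bil_fam_def)
  have orth: "G y (e y) c = 0" if "y \<in> W" "c \<in> span B" for y c
    using that(2)
  proof (induction rule: span_induct)
    case base
    show ?case using lin1(4)[OF that(1)] by (rule linear_subspace_kernel)
  next
    case (step c)
    then show ?case using p(3)[OF that(1)] lin1(3)[OF that(1)] by (simp add: e_def)
  qed
  define w' where "w' = (\<lambda>y. w y + k y *\<^sub>R e y)"
  have "C_inf_on W w'" unfolding w'_def by (intro C_inf_on_add C_inf_on_scaleR W w(1) k e)
  moreover have "w' y \<in> span (insert b B) \<and> (\<forall>c\<in>insert b B. G y (w' y) c = \<beta> y c)" if y: "y \<in> W" for y
  proof (intro conjI ballI)
    have "w y \<in> span (insert b B)" "p y \<in> span (insert b B)" "b \<in> span (insert b B)"
      using w(2)[OF y] p(2)[OF y] span_mono[of B "insert b B"] by (auto intro: span_base)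
    then show "w' y \<in> span (insert b B)"
      unfolding w'_def e_def by (intro span_add span_scale span_diff)
    fix c assume "c \<in> insert b B"
    then consider "c = b" | "c \<in> B" by blast
    then show "G y (w' y) c = \<beta> y c"
    proof cases
      case 1
      have "G y (e y) b = G y (e y) (e y + p y)" by (simp add: e_def)
      also have "\<dots> = G y (e y) (e y)"
        using orth[OF y p(2)[OF y]] linear_add[OF lin1(4)[OF y]] by simp
      finally show ?thesis using 1 pos[OF y e0[OF y]] by (simp add: w'_def lin1[OF y] k_def)
    next
      case 2
      then show ?thesis using orth[OF y span_base[OF 2]] w(3)[OF y 2] by (simp add: w'_def lin1[OF y])
    qed
  qed
  ultimately show ?case by blast
qed

lemma smooth_riesz:
  fixes G :: "'p::euclidean_space \<Rightarrow> 'e::euclidean_space \<Rightarrow> 'e \<Rightarrow> real"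
  assumes W: "open W" and G: "bil_fam W G"
    and pos: "\<And>y u. y \<in> W \<Longrightarrow> u \<noteq> 0 \<Longrightarrow> 0 < G y u u"
    and \<beta>: "lin_fam W \<beta>"
  obtains w where "C_inf_on W w" "\<And>y b. y \<in> W \<Longrightarrow> G y (w y) b = \<beta> y b"
proof -
  obtain w where w: "C_inf_on W w" "\<forall>y\<in>W. w y \<in> span Basis \<and> (\<forall>b\<in>Basis. G y (w y) b = \<beta> y b)"
    using smooth_riesz_span[OF W G _ finite_Basis independent_Basis \<beta>] pos by auto
  have "G y (w y) b = \<beta> y b" if "y \<in> W" for y b
  proof -
    have "linear (G y (w y))" "linear (\<beta> y)" using G \<beta> that by (auto simp: bil_fam_def lin_fam_def)
    then have "G y (w y) = \<beta> y" by (rule linear_eq_stdbasis) (use w(2) that in blast)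
    then show ?thesis by simp
  qed
  with w(1) show ?thesis by (rule that)
qed

section \<open>Covariant differentiation in coordinates\<close>

text \<open>Let \<open>\<Gamma>\<close> be the Christoffel symbols of a connection in a chart and \<open>h\<close> a map from a parameter
  domain into the chart. \<open>Dv \<Gamma> h e\<close> is the covariant derivative, in the parameter direction \<open>e\<close>, of
  fields along \<open>h\<close>, and \<open>Dtri \<Gamma> h e\<close> is the one induced on fields of trilinear maps by the Leibniz
  rule. \<open>Rm\<close> is the curvature tensor and \<open>nRm\<close> its covariant derivative.\<close>

definition Dv :: "('e::euclidean_space \<Rightarrow> 'e \<Rightarrow> 'e \<Rightarrow> 'e) \<Rightarrow> ('p::euclidean_space \<Rightarrow> 'e) \<Rightarrow> 'p \<Rightarrow>
    ('p \<Rightarrow> 'e) \<Rightarrow> 'p \<Rightarrow> 'e" where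
  "Dv \<Gamma> h e u y = pd e u y + \<Gamma> (h y) (pd e h y) (u y)"

definition Dtri :: "('e::euclidean_space \<Rightarrow> 'e \<Rightarrow> 'e \<Rightarrow> 'e) \<Rightarrow> ('p::euclidean_space \<Rightarrow> 'e) \<Rightarrow> 'p \<Rightarrow>
    ('p \<Rightarrow> 'e \<Rightarrow> 'e \<Rightarrow> 'e \<Rightarrow> 'e) \<Rightarrow> 'p \<Rightarrow> 'e \<Rightarrow> 'e \<Rightarrow> 'e \<Rightarrow> 'e" where
  "Dtri \<Gamma> h e S y u v w = pd e (\<lambda>z. S z u v w) y + \<Gamma> (h y) (pd e h y) (S y u v w)
     - S y (\<Gamma> (h y) (pd e h y) u) v w - S y u (\<Gamma> (h y) (pd e h y) v) w
     - S y u v (\<Gamma> (h y) (pd e h y) w)"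

definition Rm :: "('e::euclidean_space \<Rightarrow> 'e \<Rightarrow> 'e \<Rightarrow> 'e) \<Rightarrow> 'e \<Rightarrow> 'e \<Rightarrow> 'e \<Rightarrow> 'e \<Rightarrow> 'e" where
  "Rm \<Gamma> x u v w = pd u (\<lambda>z. \<Gamma> z v w) x - pd v (\<lambda>z. \<Gamma> z u w) x
     + \<Gamma> x u (\<Gamma> x v w) - \<Gamma> x v (\<Gamma> x u w)"

definition nRm :: "('e::euclidean_space \<Rightarrow> 'e \<Rightarrow> 'e \<Rightarrow> 'e) \<Rightarrow> 'e \<Rightarrow> 'e \<Rightarrow> 'e \<Rightarrow> 'e \<Rightarrow> 'e \<Rightarrow> 'e" where
  "nRm \<Gamma> x a = Dtri \<Gamma> (\<lambda>z. z) a (Rm \<Gamma>) x"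

lemma linear_rules:
  assumes "linear L"
  shows "L (u + v) = L u + L v" "L (u - v) = L u - L v" "L (a *\<^sub>R u) = a *\<^sub>R L u" "L (- u) = - L u" "L 0 = 0"
  using assms by (auto simp: linear_add linear_diff linear_scale linear_neg linear_0)

locale coord_conn =
  fixes \<Omega> :: "'e::euclidean_space set" and \<Gamma> :: "'e \<Rightarrow> 'e \<Rightarrow> 'e \<Rightarrow> 'e"
  assumes open_\<Omega>: "open \<Omega>"
    and bil_\<Gamma>: "bil_fam \<Omega> \<Gamma>"
    and sym_\<Gamma>: "x \<in> \<Omega> \<Longrightarrow> \<Gamma> x u v = \<Gamma> x v u"
begin

lemma linear_\<Gamma>: "x \<in> \<Omega> \<Longrightarrow> linear (\<Gamma> x u)" "x \<in> \<Omega> \<Longrightarrow> linear (\<lambda>u. \<Gamma> x u v)"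
  and smooth_\<Gamma>: "C_inf_on \<Omega> (\<lambda>x. \<Gamma> x u v)"
  using bil_\<Gamma> by (simp_all add: bil_fam_def)

lemmas \<Gamma>_simps = linear_rules[OF linear_\<Gamma>(1)] linear_rules[OF linear_\<Gamma>(2)]

lemma tri_fam_Rm: "tri_fam \<Omega> (Rm \<Gamma>)"
  unfolding tri_fam_def
proof (intro conjI ballI allI)
  fix u v w
  have "C_inf_on \<Omega> (\<lambda>x. \<Gamma> x u (\<Gamma> x v w))" for u v
    by (rule bil_fam_app(1)[OF open_\<Omega> bil_\<Gamma> C_inf_on_const smooth_\<Gamma>])
  then show "C_inf_on \<Omega> (\<lambda>x. Rm \<Gamma> x u v w)"
    unfolding Rm_def
    by (intro C_inf_on_diff C_inf_on_add open_\<Omega> C_inf_on_imp_pd smooth_\<Gamma>)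
next
  fix x assume x: "x \<in> \<Omega>"
  note diff = C_inf_on_differentiable[OF smooth_\<Gamma> x]
  note lin = C_inf_on_linear_pd[OF smooth_\<Gamma> x]
  \<comment> \<open>Derivatives of \<open>\<Gamma>\<close> are linear in the inserted vectors, because \<open>\<Gamma>\<close> is so near \<open>x\<close>.\<close>
  have add2: "pd u (\<lambda>z. \<Gamma> z (v + v') w) x = pd u (\<lambda>z. \<Gamma> z v w) x + pd u (\<lambda>z. \<Gamma> z v' w) x"
    "pd u (\<lambda>z. \<Gamma> z (a *\<^sub>R v) w) x = a *\<^sub>R pd u (\<lambda>z. \<Gamma> z v w) x" for u v v' w a
    by (subst pd_add[symmetric, OF diff diff] pd_scaleR_const[symmetric, OF diff],
      rule pd_cong[OF open_\<Omega> x], simp add: \<Gamma>_simps)+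
  have add3: "pd u (\<lambda>z. \<Gamma> z v (w + w')) x = pd u (\<lambda>z. \<Gamma> z v w) x + pd u (\<lambda>z. \<Gamma> z v w') x"
    "pd u (\<lambda>z. \<Gamma> z v (a *\<^sub>R w)) x = a *\<^sub>R pd u (\<lambda>z. \<Gamma> z v w) x" for u v w w' a
    by (subst pd_add[symmetric, OF diff diff] pd_scaleR_const[symmetric, OF diff],
      rule pd_cong[OF open_\<Omega> x], simp add: \<Gamma>_simps)+
  note add1 = linear_add[OF lin] linear_scale[OF lin]
  fix u v w
  show "linear (Rm \<Gamma> x u v)" "linear (\<lambda>v. Rm \<Gamma> x u v w)" "linear (\<lambda>u. Rm \<Gamma> x u v w)"
    by (rule linearI; simp add: Rm_def add1 add2 add3 \<Gamma>_simps[OF x] algebra_simps)+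
qed

end

locale coord_map = coord_conn \<Omega> \<Gamma> for \<Omega> :: "'e::euclidean_space set" and \<Gamma> +
  fixes W :: "'p::euclidean_space set" and h :: "'p \<Rightarrow> 'e"
  assumes open_W: "open W" and smooth_h: "C_inf_on W h" and h_in: "h ` W \<subseteq> \<Omega>"
begin

abbreviation "D \<equiv> Dv \<Gamma> h"

lemma h_mem: "x \<in> W \<Longrightarrow> h x \<in> \<Omega>" using h_in by auto

lemma bil_\<Gamma>h: "bil_fam W (\<lambda>y. \<Gamma> (h y))"
  by (rule bil_fam_compose[OF open_W open_\<Omega> h_in smooth_h bil_\<Gamma>])

lemma tri_Rmh: "tri_fam W (\<lambda>y. Rm \<Gamma> (h y))"
  by (rule tri_fam_compose[OF open_W open_\<Omega> h_in smooth_h tri_fam_Rm])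

lemma smooth_pd_h: "C_inf_on W (pd e h)"
  by (rule C_inf_on_imp_pd[OF smooth_h])

lemma smooth_D: "C_inf_on W u \<Longrightarrow> C_inf_on W (D e u)"
  unfolding Dv_def[abs_def]
  by (rule C_inf_on_add[OF open_W C_inf_on_imp_pd bil_fam_app(1)[OF open_W bil_\<Gamma>h smooth_pd_h]])

lemma D_cong: "x \<in> W \<Longrightarrow> (\<And>y. y \<in> W \<Longrightarrow> u y = v y) \<Longrightarrow> D e u x = D e v x"
  using pd_cong[OF open_W, of x u v] by (simp add: Dv_def)

lemma D_add: "x \<in> W \<Longrightarrow> C_inf_on W u \<Longrightarrow> C_inf_on W v \<Longrightarrow>
    D e (\<lambda>y. u y + v y) x = D e u x + D e v x"
  by (simp add: Dv_def pd_add C_inf_on_differentiable \<Gamma>_simps h_mem)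

lemma pd_\<Gamma>h: "x \<in> W \<Longrightarrow> pd e (\<lambda>z. \<Gamma> (h z) a b) x = pd (pd e h x) (\<lambda>z. \<Gamma> z a b) (h x)"
  by (rule pd_compose[OF smooth_h _ C_inf_on_differentiable[OF smooth_\<Gamma> h_mem]])

text \<open>This is the symmetry lemma: \<open>\<Gamma>\<close> is symmetric and partial derivatives commute.\<close>

lemma D_sym: "x \<in> W \<Longrightarrow> D e (pd f h) x = D f (pd e h) x"
  by (simp add: Dv_def sym_\<Gamma>[OF h_mem, of x "pd e h x"] pd_commute[OF open_W smooth_h, of x e f])

text \<open>Second partial derivatives commute, so that only derivatives of \<open>\<Gamma>\<close> and products of two \<open>\<Gamma>\<close>
  remain, and these make up the curvature.\<close>

lemma D_commute:
  assumes u: "C_inf_on W u" and x: "x \<in> W"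
  shows "D e (D f u) x = D f (D e u) x + Rm \<Gamma> (h x) (pd e h x) (pd f h x) (u x)"
proof -
  have *: "D e (D f u) x = pd e (pd f u) x
      + (pd (pd e h x) (\<lambda>z. \<Gamma> z (pd f h x) (u x)) (h x) + \<Gamma> (h x) (pd e (pd f h) x) (u x)
         + \<Gamma> (h x) (pd f h x) (pd e u x))
      + (\<Gamma> (h x) (pd e h x) (pd f u x) + \<Gamma> (h x) (pd e h x) (\<Gamma> (h x) (pd f h x) (u x)))" for e f
  proof -
    have "pd e (D f u) x = pd e (pd f u) x + pd e (\<lambda>y. \<Gamma> (h y) (pd f h y) (u y)) x"
      unfolding Dv_def[abs_def]
      by (rule pd_add[OF C_inf_on_differentiable[OF C_inf_on_imp_pd[OF u] x]
            C_inf_on_differentiable[OF bil_fam_app(1)[OF open_W bil_\<Gamma>h smooth_pd_h u] x]])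
    moreover have "pd e (\<lambda>y. \<Gamma> (h y) (pd f h y) (u y)) x =
        pd (pd e h x) (\<lambda>z. \<Gamma> z (pd f h x) (u x)) (h x) + \<Gamma> (h x) (pd e (pd f h) x) (u x)
         + \<Gamma> (h x) (pd f h x) (pd e u x)"
      using bil_fam_app(2)[OF open_W bil_\<Gamma>h smooth_pd_h u x] pd_\<Gamma>h[OF x] by simp
    ultimately show ?thesis
      using linear_add[OF linear_\<Gamma>(1)[OF h_mem[OF x]]] by (simp add: Dv_def)
  qed
  show ?thesis
    unfolding * pd_commute[OF open_W u x, of e f] pd_commute[OF open_W smooth_h x, of e f]
    by (simp add: Rm_def)
qed

lemma Dtri_leibniz:
  assumes S: "tri_fam W S" and U: "C_inf_on W U" and V: "C_inf_on W V" and Z: "C_inf_on W Z"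
    and x: "x \<in> W"
  shows "D e (\<lambda>y. S y (U y) (V y) (Z y)) x = Dtri \<Gamma> h e S x (U x) (V x) (Z x)
    + S x (D e U x) (V x) (Z x) + S x (U x) (D e V x) (Z x) + S x (U x) (V x) (D e Z x)"
proof -
  have lin: "linear (S x u v)" "linear (\<lambda>v. S x u v w)" "linear (\<lambda>u. S x u v w)" for u v w
    using S x by (auto simp: tri_fam_def)
  show ?thesis
    unfolding Dv_def Dtri_def tri_fam_app(2)[OF open_W S U V Z x]
    by (simp add: linear_add[OF lin(1)] linear_add[OF lin(2)] linear_add[OF lin(3)])
qed

lemma tri_fam_Dtri:
  assumes S: "tri_fam W S"
  shows "tri_fam W (Dtri \<Gamma> h e S)"
  unfolding tri_fam_def
proof (intro conjI ballI allI)
  fix u v w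
  have sm: "C_inf_on W (\<lambda>y. S y u v w)" for u v w using S by (simp add: tri_fam_def)
  have \<Gamma>sm: "C_inf_on W U \<Longrightarrow> C_inf_on W (\<lambda>y. \<Gamma> (h y) (pd e h y) (U y))" for U
    by (rule bil_fam_app(1)[OF open_W bil_\<Gamma>h smooth_pd_h])
  show "C_inf_on W (\<lambda>y. Dtri \<Gamma> h e S y u v w)"
    unfolding Dtri_def
    by (intro C_inf_on_diff C_inf_on_add open_W C_inf_on_imp_pd sm tri_fam_app(1)[OF open_W S] \<Gamma>sm
        C_inf_on_const)
next
  fix x assume x: "x \<in> W"
  have sm: "C_inf_on W (\<lambda>y. S y u v w)" for u v w using S by (simp add: tri_fam_def)
  note diff = C_inf_on_differentiable[OF sm x]
  have lin: "linear (S y u v)" "linear (\<lambda>v. S y u v w)" "linear (\<lambda>u. S y u v w)" if "y \<in> W" for u v w y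
    using S that by (auto simp: tri_fam_def)
  note S_simps = linear_rules[OF lin(1)] linear_rules[OF lin(2)] linear_rules[OF lin(3)]
  have pdS: "pd e (\<lambda>z. S z (u + u') v w) x = pd e (\<lambda>z. S z u v w) x + pd e (\<lambda>z. S z u' v w) x"
    "pd e (\<lambda>z. S z (a *\<^sub>R u) v w) x = a *\<^sub>R pd e (\<lambda>z. S z u v w) x"
    "pd e (\<lambda>z. S z u (v + v') w) x = pd e (\<lambda>z. S z u v w) x + pd e (\<lambda>z. S z u v' w) x"
    "pd e (\<lambda>z. S z u (a *\<^sub>R v) w) x = a *\<^sub>R pd e (\<lambda>z. S z u v w) x"
    "pd e (\<lambda>z. S z u v (w + w')) x = pd e (\<lambda>z. S z u v w) x + pd e (\<lambda>z. S z u v w') x"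
    "pd e (\<lambda>z. S z u v (a *\<^sub>R w)) x = a *\<^sub>R pd e (\<lambda>z. S z u v w) x" for u u' v v' w w' a
    by (subst pd_add[symmetric, OF diff diff] pd_scaleR_const[symmetric, OF diff],
      rule pd_cong[OF open_W x], simp add: S_simps)+
  fix u v w
  show "linear (Dtri \<Gamma> h e S x u v)" "linear (\<lambda>v. Dtri \<Gamma> h e S x u v w)"
    "linear (\<lambda>u. Dtri \<Gamma> h e S x u v w)"
    by (rule linearI; simp add: Dtri_def pdS S_simps[OF x] \<Gamma>_simps[OF h_mem[OF x]] algebra_simps)+
qed

lemma Dtri_Rm:
  assumes x: "x \<in> W"
  shows "Dtri \<Gamma> h e (\<lambda>y. Rm \<Gamma> (h y)) x = nRm \<Gamma> (h x) (pd e h x)"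
proof -
  have "C_inf_on \<Omega> (\<lambda>z. Rm \<Gamma> z u v w)" for u v w using tri_fam_Rm by (simp add: tri_fam_def)
  from pd_compose[OF smooth_h x C_inf_on_differentiable[OF this h_mem[OF x]]]
  show ?thesis by (simp add: fun_eq_iff Dtri_def nRm_def)
qed

end

section \<open>The curvature of a metric connection\<close>

locale coord_metric = coord_conn \<Omega> \<Gamma> for \<Omega> :: "'e::euclidean_space set" and \<Gamma> +
  fixes G :: "'e \<Rightarrow> 'e \<Rightarrow> 'e \<Rightarrow> real"
  assumes bil_G: "bil_fam \<Omega> G"
    and sym_G: "x \<in> \<Omega> \<Longrightarrow> G x u v = G x v u"
    and compat_G: "x \<in> \<Omega> \<Longrightarrow> pd a (\<lambda>z. G z u v) x = G x (\<Gamma> x a u) v + G x u (\<Gamma> x a v)"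
begin

lemma linear_G: "x \<in> \<Omega> \<Longrightarrow> linear (G x u)" "x \<in> \<Omega> \<Longrightarrow> linear (\<lambda>u. G x u v)"
  and smooth_G: "C_inf_on \<Omega> (\<lambda>x. G x u v)"
  using bil_G by (simp_all add: bil_fam_def)

lemmas G_simps = linear_rules[OF linear_G(1)] linear_rules[OF linear_G(2)]

end

locale coord_metric_map = coord_metric \<Omega> \<Gamma> G + coord_map \<Omega> \<Gamma> W h
  for \<Omega> :: "'e::euclidean_space set" and \<Gamma> G and W :: "'p::euclidean_space set" and h
begin

lemma bil_Gh: "bil_fam W (\<lambda>y. G (h y))"
  by (rule bil_fam_compose[OF open_W open_\<Omega> h_in smooth_h bil_G])

lemma smooth_Gh: "C_inf_on W u \<Longrightarrow> C_inf_on W v \<Longrightarrow> C_inf_on W (\<lambda>y. G (h y) (u y) (v y))"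
  by (rule bil_fam_app(1)[OF open_W bil_Gh])

lemma G_leibniz:
  assumes u: "C_inf_on W u" and v: "C_inf_on W v" and x: "x \<in> W"
  shows "pd e (\<lambda>y. G (h y) (u y) (v y)) x = G (h x) (D e u x) (v x) + G (h x) (u x) (D e v x)"
proof -
  have "pd e (\<lambda>z. G (h z) a b) x = pd (pd e h x) (\<lambda>z. G z a b) (h x)" for a b
    by (rule pd_compose[OF smooth_h x C_inf_on_differentiable[OF smooth_G h_mem[OF x]]])
  then show ?thesis
    unfolding bil_fam_app(2)[OF open_W bil_Gh u v x]
    by (simp add: compat_G[OF h_mem[OF x]] Dv_def G_simps[OF h_mem[OF x]])
qed

end

context coord_metric begin

lemma Rm_anti12: "Rm \<Gamma> x u v w = - Rm \<Gamma> x v u w"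
  by (simp add: Rm_def)

text \<open>The remaining symmetries follow by differentiating constant fields and their inner products
  in constant directions, that is, from the rules for covariant derivatives along the identity map.\<close>

lemma coord_metric_map_ident: "coord_metric_map \<Omega> \<Gamma> G \<Omega> (\<lambda>x. x)"
  by unfold_locales (auto intro: open_\<Omega> C_inf_on_ident)

lemma Rm_bianchi:
  assumes x: "x \<in> \<Omega>"
  shows "Rm \<Gamma> x u v w + Rm \<Gamma> x v w u + Rm \<Gamma> x w u v = 0"
proof -
  interpret id: coord_metric_map \<Omega> \<Gamma> G \<Omega> "\<lambda>x. x" by (rule coord_metric_map_ident)
  have c: "D' e (D' f (\<lambda>_. c)) x = D' f (D' e (\<lambda>_. c)) x + Rm \<Gamma> x e f c"
    if "D' = Dv \<Gamma> (\<lambda>x. x)" for e f c D'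
    using id.D_commute[of "\<lambda>_. c" x e f, OF C_inf_on_const x] that by simp
  have s: "Dv \<Gamma> (\<lambda>x. x) e (Dv \<Gamma> (\<lambda>x. x) f (\<lambda>_. c)) x = Dv \<Gamma> (\<lambda>x. x) e (Dv \<Gamma> (\<lambda>x. x) c (\<lambda>_. f)) x" for e f c
    by (rule id.D_cong[OF x]) (use id.D_sym in \<open>simp add: pd_ident[abs_def]\<close>)
  from c[OF refl, of u v w] c[OF refl, of v w u] c[OF refl, of w u v] s[of u v w] s[of v w u] s[of w u v]
  show ?thesis by (simp add: algebra_simps)
qed

lemma Rm_metric_anti:
  assumes x: "x \<in> \<Omega>"
  shows "G x (Rm \<Gamma> x u v w) z = - G x (Rm \<Gamma> x u v z) w"
proof -
  interpret id: coord_metric_map \<Omega> \<Gamma> G \<Omega> "\<lambda>x. x" by (rule coord_metric_map_ident)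
  let ?D = "Dv \<Gamma> (\<lambda>x. x)"
  have diag: "G x (Rm \<Gamma> x u v w) w = 0" for w
  proof -
    have sm: "C_inf_on \<Omega> (\<lambda>y. G y w w)" by (rule smooth_G)
    have sD: "C_inf_on \<Omega> (?D e (\<lambda>_. w))" for e by (rule id.smooth_D) simp
    have 2: "pd e (pd f (\<lambda>y. G y w w)) x
        = 2 * G x (?D e (?D f (\<lambda>_. w)) x) w + 2 * G x (?D f (\<lambda>_. w) x) (?D e (\<lambda>_. w) x)" for e f
    proof -
      have "pd e (pd f (\<lambda>y. G y w w)) x = pd e (\<lambda>y. 2 *\<^sub>R G y (?D f (\<lambda>_. w) y) w) x"
        by (rule pd_cong[OF open_\<Omega> x])
          (use id.G_leibniz[OF C_inf_on_const C_inf_on_const] sym_G in simp)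
      also have "\<dots> = 2 *\<^sub>R pd e (\<lambda>y. G y (?D f (\<lambda>_. w) y) w) x"
        by (rule pd_scaleR_const[OF C_inf_on_differentiable[OF id.smooth_Gh[OF sD C_inf_on_const] x]])
      finally show ?thesis using id.G_leibniz[of "?D f (\<lambda>_. w)" "\<lambda>_. w" x e, OF sD C_inf_on_const x] by simp
    qed
    have "2 * G x (?D u (?D v (\<lambda>_. w)) x) w = 2 * G x (?D v (?D u (\<lambda>_. w)) x) w"
      using pd_commute[OF open_\<Omega> sm x, of u v] sym_G[OF x, of "?D u (\<lambda>_. w) x"] unfolding 2 by simp
    then show ?thesis
      using id.D_commute[of "\<lambda>_. w" x u v, OF C_inf_on_const x] by (simp add: G_simps[OF x])
  qed
  have lin: "Rm \<Gamma> x u v (w + z) = Rm \<Gamma> x u v w + Rm \<Gamma> x u v z"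
    using tri_fam_Rm x by (simp add: tri_fam_def linear_add)
  have "G x (Rm \<Gamma> x u v (w + z)) (w + z) = 0" by (rule diag)
  then show ?thesis using diag[of w] diag[of z] by (simp add: lin G_simps[OF x])
qed

text \<open>The pair symmetry is a linear combination of four instances of the Bianchi identity and of the two
  antisymmetries.\<close>

lemma Rm_pair:
  assumes x: "x \<in> \<Omega>"
  shows "G x (Rm \<Gamma> x u v w) z = G x (Rm \<Gamma> x w z u) v"
proof -
  let ?r = "\<lambda>u v w z. G x (Rm \<Gamma> x u v w) z"
  have a: "?r u v w z = - ?r v u w z" for u v w z
    using Rm_anti12[of x u v w] by (simp add: G_simps[OF x])
  have b: "?r u v w z = - ?r u v z w" for u v w z by (rule Rm_metric_anti[OF x])
  have c: "?r u v w z + ?r v w u z + ?r w u v z = 0" for u v w z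
    using arg_cong[OF Rm_bianchi[OF x, of u v w], of "\<lambda>a. G x a z"] by (simp add: G_simps[OF x])
  show ?thesis
    using c[of u v w z] c[of v w z u] c[of w z u v] c[of z u v w]
      a[of w u v z] b[of u w v z] a[of w z v u] b[of z w v u] a[of z v w u] b[of v z w u] a[of z u w v]
      b[of u z w v] b[of u w z v] b[of v w z u] b[of w z v u] b[of u v z w] a[of z u v w] b[of u z v w]
      b[of z u v w] b[of w u v z] b[of z v w u] a[of u w v z] b[of v z u w] a[of u w z v] b[of v w u z]
    by linarith
qed

text \<open>The form in which the symmetries enter the first variation: the variation field \<open>s\<close> leaves the
  curvature tensor, and \<open>a\<close>, the acceleration, enters it.\<close>

lemma Rm_first_variation:
  assumes x: "x \<in> \<Omega>"
  shows "G x (Rm \<Gamma> x s t t) a = G x s (Rm \<Gamma> x a t t)"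
proof -
  have "G x (Rm \<Gamma> x s t t) a = - G x (Rm \<Gamma> x a t s) t"
    using Rm_pair[OF x, of s t t a] Rm_anti12[of x t a s] by (simp add: G_simps[OF x])
  also have "\<dots> = G x (Rm \<Gamma> x a t t) s" using Rm_metric_anti[OF x, of a t s t] by simp
  finally show ?thesis using sym_G[OF x] by simp
qed

end

section \<open>The first and second variation of the integrand\<close>

text \<open>The parameter directions \<open>er\<close>, \<open>es\<close> and \<open>et\<close> are those of the two variations and of time; \<open>gr\<close> is
  the gradient of the potential \<open>Vc\<close>.\<close>

locale coord_variation = coord_metric_map \<Omega> \<Gamma> G W h
  for \<Omega> :: "'e::euclidean_space set" and \<Gamma> G and W :: "'p::euclidean_space set" and h +
  fixes Vc :: "'e \<Rightarrow> real" and gr :: "'e \<Rightarrow> 'e" and er es et :: 'p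
  assumes smooth_Vc: "C_inf_on \<Omega> Vc" and smooth_gr: "C_inf_on \<Omega> gr"
    and grad: "x \<in> \<Omega> \<Longrightarrow> pd u Vc x = G x (gr x) u"
begin

abbreviation "TT \<equiv> pd et h"
abbreviation "SS \<equiv> pd es h"
abbreviation "XX \<equiv> pd er h"
abbreviation "A1 \<equiv> D et TT"
abbreviation "A2 \<equiv> D et A1"
abbreviation "A3 \<equiv> D et A2"
abbreviation "X1 \<equiv> D et XX"
abbreviation "X2 \<equiv> D et X1"
abbreviation "X3 \<equiv> D et X2"
abbreviation "X4 \<equiv> D et X3"
abbreviation "RR y \<equiv> Rm \<Gamma> (h y)"
abbreviation "R1 \<equiv> Dtri \<Gamma> h et RR"
abbreviation "R2 \<equiv> Dtri \<Gamma> h et R1"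

definition integrand :: "'p \<Rightarrow> real" where
  "integrand y = 1/2 * G (h y) (A1 y) (A1 y) + Vc (h y)"

definition boundary :: "'p \<Rightarrow> real" where
  "boundary y = G (h y) (D et SS y) (A1 y) - G (h y) (SS y) (A2 y)"

definition euler_lagrange :: "'p \<Rightarrow> 'e" where
  "euler_lagrange y = A3 y + RR y (A1 y) (TT y) (TT y) + gr (h y)"

definition F_coord :: "'p \<Rightarrow> 'e" where
  "F_coord y = R2 y (XX y) (TT y) (TT y) + nRm \<Gamma> (h y) (XX y) (A1 y) (TT y) (TT y)
     + RR y (RR y (XX y) (TT y) (TT y)) (TT y) (TT y) + RR y (XX y) (A2 y) (TT y)
     + 2 *\<^sub>R (R1 y (X1 y) (TT y) (TT y) + R1 y (XX y) (A1 y) (TT y) + RR y (X2 y) (TT y) (TT y))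
     + 3 *\<^sub>R (R1 y (XX y) (TT y) (A1 y) + RR y (XX y) (TT y) (A2 y) + RR y (XX y) (A1 y) (A1 y))
     + 4 *\<^sub>R RR y (X1 y) (TT y) (A1 y)"

lemma smooth_gr_h: "C_inf_on W (\<lambda>y. gr (h y))"
  by (rule C_inf_on_compose[OF open_W open_\<Omega> h_in smooth_h smooth_gr])

lemma smooth_Vc_h: "C_inf_on W (\<lambda>y. Vc (h y))"
  by (rule C_inf_on_compose[OF open_W open_\<Omega> h_in smooth_h smooth_Vc])

lemmas smooth_fields = smooth_pd_h smooth_D smooth_gr_h

lemma smooth_RR: "C_inf_on W u \<Longrightarrow> C_inf_on W v \<Longrightarrow> C_inf_on W w \<Longrightarrow> C_inf_on W (\<lambda>y. RR y (u y) (v y) (w y))"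
  by (rule tri_fam_app(1)[OF open_W tri_Rmh])

lemma smooth_R1: "C_inf_on W u \<Longrightarrow> C_inf_on W v \<Longrightarrow> C_inf_on W w \<Longrightarrow> C_inf_on W (\<lambda>y. R1 y (u y) (v y) (w y))"
  by (rule tri_fam_app(1)[OF open_W tri_fam_Dtri[OF tri_Rmh]])

lemma smooth_integrand: "C_inf_on W integrand"
proof -
  have "C_inf_on W (\<lambda>y. (1/2) *\<^sub>R G (h y) (A1 y) (A1 y) + Vc (h y))"
    by (intro C_inf_on_add open_W C_inf_on_scaleR_const smooth_Gh smooth_fields smooth_Vc_h)
  then show ?thesis by (simp add: integrand_def[abs_def])
qed

lemma smooth_boundary: "C_inf_on W boundary"
  unfolding boundary_def[abs_def]
  by (intro C_inf_on_diff open_W smooth_Gh smooth_fields)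

lemma smooth_euler_lagrange: "C_inf_on W euler_lagrange"
  unfolding euler_lagrange_def[abs_def]
  by (intro C_inf_on_add open_W smooth_RR smooth_fields)

text \<open>Commuting the derivatives in the directions \<open>es\<close> and \<open>et\<close> produces a curvature term; the other
  terms are integrated by parts twice, \<open>boundary\<close> collecting the total derivatives.\<close>

lemma first_variation:
  assumes y: "y \<in> W"
  shows "pd es integrand y = pd et boundary y + G (h y) (SS y) (euler_lagrange y)"
proof -
  note sm = smooth_fields
  have hy: "h y \<in> \<Omega>" by (rule h_mem[OF y])
  have "pd es (\<lambda>y. (1/2) *\<^sub>R G (h y) (A1 y) (A1 y) + Vc (h y)) y
      = (1/2) *\<^sub>R pd es (\<lambda>y. G (h y) (A1 y) (A1 y)) y + pd es (\<lambda>y. Vc (h y)) y"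
    by (simp only: pd_add[OF C_inf_on_differentiable[OF C_inf_on_scaleR_const[OF open_W smooth_Gh] y]
          C_inf_on_differentiable[OF smooth_Vc_h y]]
        pd_scaleR_const[OF C_inf_on_differentiable[OF smooth_Gh y]] sm)
  also have "pd es (\<lambda>y. Vc (h y)) y = G (h y) (gr (h y)) (SS y)"
    using pd_compose[OF smooth_h y C_inf_on_differentiable[OF smooth_Vc hy]] grad[OF hy] by simp
  also have "pd es (\<lambda>y. G (h y) (A1 y) (A1 y)) y = 2 * G (h y) (D es A1 y) (A1 y)"
    using G_leibniz[of A1 A1 y es, OF sm(2)[OF sm(1)] sm(2)[OF sm(1)] y] sym_G[OF hy] by simp
  also have "D es A1 y = D et (D et SS) y + RR y (SS y) (TT y) (TT y)"
    using D_commute[of TT y es et, OF sm(1) y] D_cong[of y "D es TT" "D et SS" et, OF y D_sym] by simp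
  finally have 1: "pd es integrand y = G (h y) (D et (D et SS) y) (A1 y)
      + G (h y) (SS y) (RR y (A1 y) (TT y) (TT y)) + G (h y) (gr (h y)) (SS y)"
    by (simp add: integrand_def[abs_def] G_simps[OF hy] Rm_first_variation[OF hy])
  have "pd et boundary y = pd et (\<lambda>y. G (h y) (D et SS y) (A1 y)) y - pd et (\<lambda>y. G (h y) (SS y) (A2 y)) y"
    unfolding boundary_def[abs_def]
    by (intro pd_diff C_inf_on_differentiable[OF smooth_Gh y] sm)
  also have "\<dots> = G (h y) (D et (D et SS) y) (A1 y) - G (h y) (SS y) (A3 y)"
    by (simp add: G_leibniz[OF _ _ y] sm)
  finally show ?thesis
    using 1 sym_G[OF hy, of "gr (h y)"] by (simp add: euler_lagrange_def G_simps[OF hy])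
qed

text \<open>The derivative of the field \<open>SS\<close> does not contribute, since it is paired with the Euler-Lagrange
  expression.\<close>

lemma second_variation:
  assumes y: "y \<in> W" and EL: "euler_lagrange y = 0"
  shows "pd er (pd es integrand) y = pd et (pd er boundary) y + G (h y) (SS y) (D er euler_lagrange y)"
proof -
  have hy: "h y \<in> \<Omega>" by (rule h_mem[OF y])
  have "pd er (pd es integrand) y = pd er (\<lambda>y. pd et boundary y + G (h y) (SS y) (euler_lagrange y)) y"
    by (rule pd_cong[OF open_W y]) (rule first_variation)
  also have "\<dots> = pd er (pd et boundary) y + pd er (\<lambda>y. G (h y) (SS y) (euler_lagrange y)) y"
    by (intro pd_add C_inf_on_differentiable[OF C_inf_on_imp_pd[OF smooth_boundary] y]
        C_inf_on_differentiable[OF smooth_Gh[OF smooth_pd_h smooth_euler_lagrange] y])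
  also have "pd er (pd et boundary) y = pd et (pd er boundary) y"
    by (rule pd_commute[OF open_W smooth_boundary y])
  also have "pd er (\<lambda>y. G (h y) (SS y) (euler_lagrange y)) y = G (h y) (SS y) (D er euler_lagrange y)"
    using G_leibniz[OF smooth_pd_h smooth_euler_lagrange y] EL by (simp add: G_simps[OF hy])
  finally show ?thesis .
qed

lemma D_er_TT: "y \<in> W \<Longrightarrow> D er TT y = X1 y"
  by (rule D_sym)

lemma D_er_A1:
  assumes y: "y \<in> W"
  shows "D er A1 y = X2 y + RR y (XX y) (TT y) (TT y)"
  using D_commute[of TT y er et, OF smooth_pd_h y] D_cong[of y "D er TT" X1 et, OF y D_er_TT] by simp

lemmas RR_leibniz = Dtri_leibniz[OF tri_Rmh]
lemmas R1_leibniz = Dtri_leibniz[OF tri_fam_Dtri[OF tri_Rmh]]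

text \<open>Commuting \<open>D er\<close> with the outer \<open>D et\<close> gives one curvature term, differentiating the formula for
  \<open>D er A1\<close> in the direction \<open>et\<close> gives the others.\<close>

lemma D_er_A2:
  assumes y: "y \<in> W"
  shows "D er A2 y = X3 y + R1 y (XX y) (TT y) (TT y) + RR y (X1 y) (TT y) (TT y)
    + RR y (XX y) (A1 y) (TT y) + RR y (XX y) (TT y) (A1 y) + RR y (XX y) (TT y) (A1 y)"
proof -
  note sm = smooth_fields
  have "D er A2 y = D et (D er A1) y + RR y (XX y) (TT y) (A1 y)"
    by (rule D_commute[OF sm(2)[OF sm(1)] y])
  also have "D et (D er A1) y = D et (\<lambda>y. X2 y + RR y (XX y) (TT y) (TT y)) y"
    by (rule D_cong[OF y D_er_A1])
  also have "\<dots> = X3 y + D et (\<lambda>y. RR y (XX y) (TT y) (TT y)) y"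
    by (intro D_add y sm smooth_RR)
  also have "D et (\<lambda>y. RR y (XX y) (TT y) (TT y)) y = R1 y (XX y) (TT y) (TT y)
      + RR y (X1 y) (TT y) (TT y) + RR y (XX y) (A1 y) (TT y) + RR y (XX y) (TT y) (A1 y)"
    by (intro RR_leibniz y sm)
  finally show ?thesis by (simp add: algebra_simps)
qed

text \<open>The coefficient of the last term of \<open>F\<close> comes out through the Bianchi identity.\<close>

lemma D_er_euler_lagrange:
  assumes y: "y \<in> W"
  shows "D er euler_lagrange y = X4 y + F_coord y + (pd (XX y) gr (h y) + \<Gamma> (h y) (XX y) (gr (h y)))"
proof -
  note sm = smooth_fields
  have hy: "h y \<in> \<Omega>" by (rule h_mem[OF y])
  have "D er euler_lagrange y = D er A3 y + D er (\<lambda>y. RR y (A1 y) (TT y) (TT y)) y + D er (\<lambda>y. gr (h y)) y"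
    unfolding euler_lagrange_def[abs_def]
    by (subst D_add[OF y], intro C_inf_on_add open_W smooth_RR sm, intro sm)
      (subst D_add[OF y], intro sm, intro smooth_RR sm, rule refl)
  moreover have "D er (\<lambda>y. gr (h y)) y = pd (XX y) gr (h y) + \<Gamma> (h y) (XX y) (gr (h y))"
    unfolding Dv_def by (simp only: pd_compose[OF smooth_h y C_inf_on_differentiable[OF smooth_gr hy]])
  moreover have "D er (\<lambda>y. RR y (A1 y) (TT y) (TT y)) y = nRm \<Gamma> (h y) (XX y) (A1 y) (TT y) (TT y)
      + (RR y (X2 y) (TT y) (TT y) + RR y (RR y (XX y) (TT y) (TT y)) (TT y) (TT y))
      + RR y (A1 y) (X1 y) (TT y) + RR y (A1 y) (TT y) (X1 y)"
  proof -
    have "linear (\<lambda>u. RR y u (TT y) (TT y))" using tri_Rmh y by (simp add: tri_fam_def)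
    from linear_add[OF this] show ?thesis
      by (subst RR_leibniz[OF _ _ _ y]) (simp_all add: sm D_er_TT[OF y] D_er_A1[OF y] Dtri_Rm[OF y])
  qed
  moreover have "D er A3 y = D et (D er A2) y + RR y (XX y) (TT y) (A2 y)"
    by (rule D_commute[OF sm(2)[OF sm(2)[OF sm(1)]] y])
  moreover have "D et (D er A2) y = X4 y
      + (R2 y (XX y) (TT y) (TT y) + R1 y (X1 y) (TT y) (TT y) + R1 y (XX y) (A1 y) (TT y) + R1 y (XX y) (TT y) (A1 y))
      + (R1 y (X1 y) (TT y) (TT y) + RR y (X2 y) (TT y) (TT y) + RR y (X1 y) (A1 y) (TT y) + RR y (X1 y) (TT y) (A1 y))
      + (R1 y (XX y) (A1 y) (TT y) + RR y (X1 y) (A1 y) (TT y) + RR y (XX y) (A2 y) (TT y) + RR y (XX y) (A1 y) (A1 y))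
      + (R1 y (XX y) (TT y) (A1 y) + RR y (X1 y) (TT y) (A1 y) + RR y (XX y) (A1 y) (A1 y) + RR y (XX y) (TT y) (A2 y))
      + (R1 y (XX y) (TT y) (A1 y) + RR y (X1 y) (TT y) (A1 y) + RR y (XX y) (A1 y) (A1 y) + RR y (XX y) (TT y) (A2 y))"
  proof -
    have "D et (D er A2) y = D et (\<lambda>y. X3 y + R1 y (XX y) (TT y) (TT y) + RR y (X1 y) (TT y) (TT y)
        + RR y (XX y) (A1 y) (TT y) + RR y (XX y) (TT y) (A1 y) + RR y (XX y) (TT y) (A1 y)) y"
      by (rule D_cong[OF y D_er_A2])
    also have "\<dots> = X4 y + D et (\<lambda>y. R1 y (XX y) (TT y) (TT y)) y + D et (\<lambda>y. RR y (X1 y) (TT y) (TT y)) y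
        + D et (\<lambda>y. RR y (XX y) (A1 y) (TT y)) y + D et (\<lambda>y. RR y (XX y) (TT y) (A1 y)) y
        + D et (\<lambda>y. RR y (XX y) (TT y) (A1 y)) y"
      by (simp only: D_add[OF y] C_inf_on_add[OF open_W] smooth_RR smooth_R1 sm)
    finally show ?thesis
      by (simp only: RR_leibniz[OF _ _ _ y] R1_leibniz[OF _ _ _ y] sm)
  qed
  moreover have "RR y (A1 y) (X1 y) (TT y) = - RR y (X1 y) (A1 y) (TT y)" by (rule Rm_anti12)
  moreover have "RR y (A1 y) (TT y) (X1 y) = RR y (X1 y) (TT y) (A1 y) - RR y (X1 y) (A1 y) (TT y)"
    using Rm_bianchi[OF hy, of "A1 y" "TT y" "X1 y"] Rm_anti12[of "h y" "TT y" "X1 y" "A1 y"]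
    by (simp add: algebra_simps eq_neg_iff_add_eq_0)
  ultimately show ?thesis
    unfolding F_coord_def by (simp add: algebra_simps scaleR_2 scaleR_left_distrib[of 2 1 for x :: 'e, simplified]
      scaleR_left_distrib[of 3 1, simplified])
qed

end

section \<open>Charts and tangent vectors\<close>

lemma charts_at_iff: "c \<in> charts_at A p \<longleftrightarrow> c \<in> A \<and> p \<in> fst c"
  by (simp add: charts_at_def)

abbreviation transition :: "('q, 'e) chart \<Rightarrow> ('q, 'e) chart \<Rightarrow> 'e \<Rightarrow> 'e" where
  "transition c d \<equiv> snd d \<circ> chart_inv c"

abbreviation chart_range :: "('q, 'e) chart \<Rightarrow> 'e set" where
  "chart_range c \<equiv> snd c ` fst c"

lemma sum_fun_apply: "(\<Sum>i\<in>I. f i) x = (\<Sum>i\<in>I. f i x)"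
  by (induction I rule: infinite_finite_induct) (auto simp: plus_fun_def zero_fun_def)

lemma fun_vector_simps:
  "(u + v) c = u c + v c" "(0 :: 'a \<Rightarrow> 'b::real_vector) c = 0" "(a *\<^sub>R w) c = a *\<^sub>R w c"
  for u v :: "'a \<Rightarrow> 'b::real_vector" and w :: "'a \<Rightarrow> 'b"
  by (auto simp: plus_fun_def zero_fun_def scaleR_fun_def)

context smooth_manifold begin

lemma ex_chart: "\<exists>c. c \<in> charts_at A p"
  using charts_cover[of p] by (simp only: ex_in_conv not_False_eq_True)

lemma chart_inv_left [simp]: "c \<in> A \<Longrightarrow> p \<in> fst c \<Longrightarrow> chart_inv c (snd c p) = p"
  using chart_homeomorphism[of c] by (simp add: homeomorphism_def)

lemma chart_inv_right: "c \<in> A \<Longrightarrow> x \<in> chart_range c \<Longrightarrow> snd c (chart_inv c x) = x"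
  by auto

lemma chart_inv_mem: "c \<in> A \<Longrightarrow> x \<in> chart_range c \<Longrightarrow> chart_inv c x \<in> fst c"
  by auto

lemma open_image_chart:
  assumes "c \<in> A" "open U"
  shows "open (snd c ` (fst c \<inter> U))"
proof -
  have "snd c ` (fst c \<inter> U) = chart_range c \<inter> chart_inv c -` U"
    using assms(1) by auto
  moreover have "continuous_on (chart_range c) (chart_inv c)"
    using chart_homeomorphism[OF assms(1)] by (simp add: homeomorphism_def)
  ultimately show ?thesis
    using continuous_open_preimage[OF _ open_range[OF assms(1)] assms(2)] by simp
qed

lemma open_image_overlap: "c \<in> A \<Longrightarrow> d \<in> A \<Longrightarrow> open (snd c ` (fst c \<inter> fst d))"
  by (rule open_image_chart) (auto intro: open_domain)

lemma smooth_transition': "c \<in> A \<Longrightarrow> d \<in> A \<Longrightarrow> C_inf_on (snd c ` (fst c \<inter> fst d)) (transition c d)"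
  using smooth_transition smooth_on_open_iff[OF open_image_overlap] by blast

lemma transition_differentiable:
  "c \<in> charts_at A p \<Longrightarrow> d \<in> charts_at A p \<Longrightarrow> transition c d differentiable (at (snd c p))"
  by (rule C_inf_on_differentiable[OF smooth_transition']) (auto simp: charts_at_iff)

lemma linear_pd_transition:
  "c \<in> charts_at A p \<Longrightarrow> d \<in> charts_at A p \<Longrightarrow> linear (\<lambda>a. pd a (transition c d) (snd c p))"
  by (rule C_inf_on_linear_pd[OF smooth_transition']) (auto simp: charts_at_iff)

lemma pd_transition_self: "c \<in> charts_at A p \<Longrightarrow> pd a (transition c c) (snd c p) = a"
  by (rule trans[OF pd_cong[OF open_range] pd_ident]) (auto simp: charts_at_iff)

text \<open>The chain rule, valid on the common domain of the three charts.\<close>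

lemma pd_transition_chain:
  assumes c: "c \<in> charts_at A p" and d: "d \<in> charts_at A p" and d': "d' \<in> charts_at A p"
  shows "pd (pd a (transition c d) (snd c p)) (transition d d') (snd d p) = pd a (transition c d') (snd c p)"
proof -
  let ?S = "snd c ` (fst c \<inter> (fst d \<inter> fst d'))"
  have S: "open ?S" using c d d' by (intro open_image_chart open_Int open_domain) (auto simp: charts_at_iff)
  have x: "snd c p \<in> ?S" using c d d' by (auto simp: charts_at_iff)
  have "pd a (transition c d') (snd c p) = pd a (\<lambda>x. transition d d' (transition c d x)) (snd c p)"
    by (rule pd_cong[OF S x]) (use c d d' in \<open>auto simp: charts_at_iff\<close>)
  also have "\<dots> = pd (pd a (transition c d) (snd c p)) (transition d d') (transition c d (snd c p))"
  proof (rule pd_compose)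
    show "C_inf_on (snd c ` (fst c \<inter> fst d)) (transition c d)" "snd c p \<in> snd c ` (fst c \<inter> fst d)"
      using smooth_transition' c d by (auto simp: charts_at_iff)
    show "transition d d' differentiable at (transition c d (snd c p))"
      using transition_differentiable[OF d d'] c by (simp add: charts_at_iff)
  qed
  finally show ?thesis using c by (simp add: charts_at_iff)
qed

lemma tangent_spaceD:
  assumes "v \<in> tangent_space A p"
  shows "c \<notin> charts_at A p \<Longrightarrow> v c = 0"
    and "c \<in> charts_at A p \<Longrightarrow> d \<in> charts_at A p \<Longrightarrow> v d = pd (v c) (transition c d) (snd c p)"
proof -
  note B = assms[unfolded tangent_space_def mem_Collect_eq]
  note * = conjunct1[OF B] conjunct2[OF B]
  show "c \<notin> charts_at A p \<Longrightarrow> v c = 0" by (rule *(1)[rule_format])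
  show "c \<in> charts_at A p \<Longrightarrow> d \<in> charts_at A p \<Longrightarrow> v d = pd (v c) (transition c d) (snd c p)"
    unfolding pd_def by (rule *(2)[rule_format])
qed

lemma tangent_space_memI:
  assumes "\<And>c. c \<notin> charts_at A p \<Longrightarrow> v c = 0"
    and "\<And>c d. c \<in> charts_at A p \<Longrightarrow> d \<in> charts_at A p \<Longrightarrow> v d = pd (v c) (transition c d) (snd c p)"
  shows "v \<in> tangent_space A p"
  unfolding tangent_space_def mem_Collect_eq
  by (intro conjI ballI allI impI) (rule assms(1) assms(2)[unfolded pd_def]; assumption)+

text \<open>The transformation law computes all coordinates of a tangent vector from those in one chart.\<close>

lemma tangent_space_eqI:
  assumes "u \<in> tangent_space A p" "v \<in> tangent_space A p" "c \<in> charts_at A p" "u c = v c"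
  shows "u = v"
proof
  fix d show "u d = v d"
  proof (cases "d \<in> charts_at A p")
    case True
    show ?thesis
      unfolding tangent_spaceD(2)[OF assms(1,3) True] tangent_spaceD(2)[OF assms(2,3) True] assms(4) by (rule refl)
  next
    case False
    then show ?thesis using tangent_spaceD(1)[OF assms(1) False] tangent_spaceD(1)[OF assms(2) False] by simp
  qed
qed

text \<open>By the chain rule, the transformation law between two charts follows from those which relate both of
  them to the chart \<open>c\<close>.\<close>

lemma tangent_spaceI:
  assumes c: "c \<in> charts_at A p" and "\<And>d. d \<notin> charts_at A p \<Longrightarrow> v d = 0"
    and "\<And>d. d \<in> charts_at A p \<Longrightarrow> v d = pd (v c) (transition c d) (snd c p)"
  shows "v \<in> tangent_space A p"
proof -
  have "v d' = pd (v d) (transition d d') (snd d p)" if "d \<in> charts_at A p" "d' \<in> charts_at A p" for d d'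
    by (simp only: trans[OF assms(3)[OF that(2)] pd_transition_chain[OF c that, symmetric]]
        assms(3)[OF that(1), symmetric])
  with assms(2) show ?thesis by (rule tangent_space_memI)
qed

lemma tangent_space_zero: "0 \<in> tangent_space A p"
proof -
  have "pd 0 (transition c d) (snd c p) = 0" if "c \<in> charts_at A p" "d \<in> charts_at A p" for c d
    using linear_0[OF linear_pd_transition[OF that]] .
  then show ?thesis by (intro tangent_space_memI) (simp_all add: zero_fun_def)
qed

lemma tangent_space_add:
  assumes "u \<in> tangent_space A p" "v \<in> tangent_space A p"
  shows "u + v \<in> tangent_space A p"
proof -
  have "(u + v) d = pd ((u + v) c) (transition c d) (snd c p)"
    if "c \<in> charts_at A p" "d \<in> charts_at A p" for c d
    using linear_add[OF linear_pd_transition[OF that], of "u c" "v c"]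
      tangent_spaceD(2)[OF assms(1) that, symmetric] tangent_spaceD(2)[OF assms(2) that, symmetric]
    by (simp add: fun_vector_simps)
  moreover have "(u + v) c = 0" if "c \<notin> charts_at A p" for c
    using tangent_spaceD(1)[OF assms(1) that] tangent_spaceD(1)[OF assms(2) that] by (simp add: fun_vector_simps)
  ultimately show ?thesis by (intro tangent_space_memI)
qed

lemma tangent_space_scaleR:
  assumes "u \<in> tangent_space A p"
  shows "a *\<^sub>R u \<in> tangent_space A p"
proof -
  have "(a *\<^sub>R u) d = pd ((a *\<^sub>R u) c) (transition c d) (snd c p)"
    if "c \<in> charts_at A p" "d \<in> charts_at A p" for c d
    using linear_scale[OF linear_pd_transition[OF that], of a "u c"]
      tangent_spaceD(2)[OF assms that, symmetric]
    by (simp add: fun_vector_simps)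
  moreover have "(a *\<^sub>R u) c = 0" if "c \<notin> charts_at A p" for c
    using tangent_spaceD(1)[OF assms that] by (simp add: fun_vector_simps)
  ultimately show ?thesis by (intro tangent_space_memI)
qed

lemma tangent_space_minus: "u \<in> tangent_space A p \<Longrightarrow> - u \<in> tangent_space A p"
  using tangent_space_scaleR[of u p "-1"] by simp

lemma tangent_space_diff:
  assumes "u \<in> tangent_space A p" "v \<in> tangent_space A p"
  shows "u - v \<in> tangent_space A p"
  using tangent_space_add[OF assms(1) tangent_space_minus[OF assms(2)]] by simp

lemma tangent_space_sum:
  assumes "\<And>i. i \<in> I \<Longrightarrow> f i \<in> tangent_space A p"
  shows "(\<Sum>i\<in>I. f i) \<in> tangent_space A p"
  using assms
proof (induction I rule: infinite_finite_induct)
  case (insert i I)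
  have "f i + (\<Sum>i\<in>I. f i) \<in> tangent_space A p"
    using insert by (intro tangent_space_add) simp_all
  then show ?case by (simp only: sum.insert[OF insert.hyps])
qed (simp_all only: sum.infinite sum.empty tangent_space_zero not_False_eq_True)

lemma coord_field_eq:
  "c \<in> charts_at A p \<Longrightarrow> d \<in> charts_at A p \<Longrightarrow> coord_field A c a p d = pd a (transition c d) (snd c p)"
  by (simp add: coord_field_def pd_def)

lemma coord_field_self: "c \<in> charts_at A p \<Longrightarrow> coord_field A c a p c = a"
  by (simp add: coord_field_eq pd_transition_self)

lemma coord_field_tangent: "c \<in> charts_at A p \<Longrightarrow> coord_field A c a p \<in> tangent_space A p"
  by (rule tangent_spaceI) (auto simp: coord_field_eq pd_transition_self, simp add: coord_field_def)

lemma coord_field_tangent_vector: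
  "v \<in> tangent_space A p \<Longrightarrow> c \<in> charts_at A p \<Longrightarrow> coord_field A c (v c) p = v"
  by (rule tangent_space_eqI[OF coord_field_tangent]) (auto simp: coord_field_self)

section \<open>Smooth functions and vector fields in a chart\<close>

lemma smooth_fun_onD:
  "smooth_fun_on A U f \<Longrightarrow> open U \<Longrightarrow> c \<in> A \<Longrightarrow> C_inf_on (snd c ` (fst c \<inter> U)) (f \<circ> chart_inv c)"
  by (simp add: smooth_fun_on_def smooth_on_open_iff[OF open_image_chart])

text \<open>Smoothness need only be checked in one chart containing the set, because transition maps are
  smooth; likewise for vector fields below.\<close>

lemma smooth_fun_onI_chart:
  assumes c: "c \<in> A" and U: "open U" "U \<subseteq> fst c" and f: "C_inf_on (snd c ` U) (\<lambda>x. f (chart_inv c x))"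
  shows "smooth_fun_on A U f"
  unfolding smooth_fun_on_def
proof
  fix d assume d: "d \<in> A"
  let ?S = "snd d ` (fst d \<inter> U)"
  have S: "open ?S" by (rule open_image_chart[OF d U(1)])
  have cU: "open (snd c ` U)" using open_image_chart[OF c U(1)] U(2) by (simp add: Int_absorb1)
  have "C_inf_on ?S (\<lambda>x. f (chart_inv c (transition d c x)))"
  proof (rule C_inf_on_compose[OF S cU _ _ f])
    show "transition d c ` ?S \<subseteq> snd c ` U" using d by auto
    show "C_inf_on ?S (transition d c)"
      by (rule C_inf_on_subset[OF smooth_transition'[OF d c]]) (use U(2) in auto)
  qed
  then have "C_inf_on ?S (f \<circ> chart_inv d)"
    by (rule C_inf_on_cong[OF S]) (use c d U(2) in \<open>auto simp: subset_iff\<close>)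
  then show "smooth_on ?S (f \<circ> chart_inv d)" by (simp add: smooth_on_open_iff[OF S])
qed

lemma vector_field_onD:
  assumes "vector_field_on A U X"
  shows "p \<in> U \<Longrightarrow> X p \<in> tangent_space A p"
    and "open U \<Longrightarrow> c \<in> A \<Longrightarrow> C_inf_on (snd c ` (fst c \<inter> U)) (\<lambda>x. X (chart_inv c x) c)"
  using assms by (simp_all add: vector_field_on_def smooth_on_open_iff[OF open_image_chart])

lemma vector_field_on_subset:
  "vector_field_on A U X \<Longrightarrow> U' \<subseteq> U \<Longrightarrow> vector_field_on A U' X"
  unfolding vector_field_on_def by (auto intro: smooth_on_subset)

lemma lin_fam_pd_transition:
  assumes "c \<in> A" "d \<in> A"
  shows "lin_fam (snd c ` (fst c \<inter> fst d)) (\<lambda>y a. pd a (transition c d) y)"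
  using assms C_inf_on_imp_pd[OF smooth_transition'[OF assms]] C_inf_on_linear_pd[OF smooth_transition'[OF assms]]
  by (simp add: lin_fam_def)

text \<open>In the chart \<open>d\<close> the coordinates of a field \<open>Z\<close> along a map arise from those in the chart \<open>c\<close>
  by applying the derivative of the transition map.\<close>

lemma smooth_coordinate_change:
  assumes c: "c \<in> A" and d: "d \<in> A" and W: "open W" and h: "C_inf_on W h"
    and hW: "h ` W \<subseteq> snd c ` (fst c \<inter> fst d)" and u: "C_inf_on W u"
  shows "C_inf_on W (\<lambda>x. pd (u x) (transition c d) (h x))"
proof -
  have "C_inf_on W (\<lambda>x. pd a (transition c d) (h x))" for a
    by (rule C_inf_on_compose[OF W open_image_overlap[OF c d] hW h C_inf_on_imp_pd[OF smooth_transition'[OF c d]]])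
  then have "lin_fam W (\<lambda>x a. pd a (transition c d) (h x))"
    using lin_fam_pd_transition[OF c d] hW by (auto simp: lin_fam_def)
  then show ?thesis by (rule lin_fam_app(1)[OF W _ u])
qed

lemma vector_field_onI_chart:
  assumes c: "c \<in> A" and U: "open U" "U \<subseteq> fst c" and X: "\<And>p. p \<in> U \<Longrightarrow> X p \<in> tangent_space A p"
    and sm: "C_inf_on (snd c ` U) (\<lambda>x. X (chart_inv c x) c)"
  shows "vector_field_on A U X"
  unfolding vector_field_on_def
proof (intro conjI ballI)
  fix d assume d: "d \<in> A"
  let ?S = "snd d ` (fst d \<inter> U)"
  have S: "open ?S" by (rule open_image_chart[OF d U(1)])
  have cU: "open (snd c ` U)" using open_image_chart[OF c U(1)] U(2) by (simp add: Int_absorb1)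
  have tr: "C_inf_on ?S (transition d c)"
    by (rule C_inf_on_subset[OF smooth_transition'[OF d c]]) (use U(2) in auto)
  have "C_inf_on ?S (\<lambda>x. X (chart_inv c (transition d c x)) c)"
    by (rule C_inf_on_compose[OF S cU _ tr sm]) (use d in auto)
  then have "C_inf_on ?S (\<lambda>x. pd (X (chart_inv c (transition d c x)) c) (transition c d) (transition d c x))"
    by (rule smooth_coordinate_change[OF c d S tr, rotated]) (use d U(2) in auto)
  then have "C_inf_on ?S (\<lambda>x. X (chart_inv d x) d)"
  proof (rule C_inf_on_cong[OF S])
    fix y assume "y \<in> ?S"
    then obtain p where p: "p \<in> fst d" "p \<in> U" "y = snd d p" by auto
    then have "p \<in> fst c" using U(2) by auto
    then have "X p d = pd (X p c) (transition c d) (snd c p)"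
      using p c d by (intro tangent_spaceD(2)[OF X]) (auto simp: charts_at_iff)
    then show "pd (X (chart_inv c (transition d c y)) c) (transition c d) (transition d c y) = X (chart_inv d y) d"
      using p c d \<open>p \<in> fst c\<close> by simp
  qed
  then show "smooth_on ?S (\<lambda>x. X (chart_inv d x) d)" by (simp add: smooth_on_open_iff[OF S])
qed (use X in auto)

lemma vector_field_on_coord_field: "c \<in> A \<Longrightarrow> vector_field_on A (fst c) (coord_field A c a)"
proof (rule vector_field_onI_chart)
  assume c: "c \<in> A"
  show "C_inf_on (chart_range c) (\<lambda>x. coord_field A c a (chart_inv c x) c)"
    by (rule C_inf_on_cong[OF open_range[OF c] C_inf_on_const[of _ a]])
      (use c in \<open>auto simp: coord_field_self charts_at_iff\<close>)
qed (auto intro: coord_field_tangent open_domain simp: charts_at_iff)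

text \<open>By the chain rule the chart picked in the definition of \<open>dir_deriv\<close> may be replaced by any other.\<close>

lemma dir_deriv_chart:
  assumes c: "c \<in> charts_at A p" and u: "u \<in> tangent_space A p"
    and f: "f \<circ> chart_inv c differentiable (at (snd c p))"
  shows "dir_deriv A p u f = pd (u c) (f \<circ> chart_inv c) (snd c p)"
proof -
  define d where "d = (SOME d. d \<in> charts_at A p)"
  have d: "d \<in> charts_at A p" unfolding d_def by (rule someI[of _ c]) (rule c)
  let ?S = "snd d ` (fst d \<inter> fst c)"
  have S: "open ?S" "snd d p \<in> ?S" using c d open_image_overlap by (auto simp: charts_at_iff)
  have "dir_deriv A p u f = pd (u d) (f \<circ> chart_inv d) (snd d p)"
    by (simp add: dir_deriv_def d_def pd_def Let_def)
  also have "\<dots> = pd (u d) (\<lambda>x. (f \<circ> chart_inv c) (transition d c x)) (snd d p)"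
    by (rule pd_cong[OF S]) (use c d in \<open>auto simp: charts_at_iff\<close>)
  also have "\<dots> = pd (pd (u d) (transition d c) (snd d p)) (f \<circ> chart_inv c) (transition d c (snd d p))"
    by (rule pd_compose[OF smooth_transition']) (use c d f in \<open>auto simp: charts_at_iff o_def\<close>)
  also have "\<dots> = pd (u c) (f \<circ> chart_inv c) (snd c p)"
    using tangent_spaceD(2)[OF u d c] d by (simp add: charts_at_iff)
  finally show ?thesis .
qed

end

section \<open>Christoffel symbols\<close>

definition christoffel :: "('q, 'e::euclidean_space) chart set \<Rightarrow> ('q, 'e) conn \<Rightarrow> ('q, 'e) chart \<Rightarrow>
    'e \<Rightarrow> 'e \<Rightarrow> 'e \<Rightarrow> 'e" where
  "christoffel A nabla c x a b =
     nabla (chart_inv c x) (coord_field A c a (chart_inv c x)) (coord_field A c b) c"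

context affine_connection begin

text \<open>Two fields which agree on an open set become equal when multiplied by its indicator function. By the
  Leibniz rule this does not change their covariant derivatives at points of the set, where the
  indicator function is smooth with derivative \<open>0\<close>.\<close>

lemma nabla_local:
  assumes U: "open U" "p \<in> U" and Y: "vector_field_on A U Y" and Z: "vector_field_on A U Z"
    and eq: "\<And>x. x \<in> U \<Longrightarrow> Y x = Z x" and u: "u \<in> tangent_space A p"
  shows "nabla p u Y = nabla p u Z"
proof -
  define f :: "'q \<Rightarrow> real" where "f = (\<lambda>x. if x \<in> U then 1 else 0)"
  have one: "C_inf_on (snd c ` (fst c \<inter> U)) (f \<circ> chart_inv c)" if "c \<in> A" for c
    by (rule C_inf_on_cong[OF open_image_chart[OF that U(1)] C_inf_on_const[of _ 1]])
      (use that in \<open>auto simp: f_def\<close>)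
  have f: "smooth_fun_on A U f"
    using one by (simp add: smooth_fun_on_def smooth_on_open_iff[OF open_image_chart[OF _ U(1)]])
  obtain c where c: "c \<in> charts_at A p" using ex_chart by (rule exE)
  then have x: "snd c p \<in> snd c ` (fst c \<inter> U)" using U by (auto simp: charts_at_iff)
  have cA: "c \<in> A" using c by (simp add: charts_at_iff)
  have "pd (u c) (f \<circ> chart_inv c) (snd c p) = pd (u c) (\<lambda>_. 1) (snd c p)"
    by (rule pd_cong[OF open_image_chart[OF cA U(1)] x]) (use cA in \<open>auto simp: f_def\<close>)
  then have d0: "dir_deriv A p u f = 0"
    using dir_deriv_chart[OF c u C_inf_on_differentiable[OF one[OF cA] x]] by simp
  have "nabla p u (\<lambda>x. f x *\<^sub>R Y x) = nabla p u Y" "nabla p u (\<lambda>x. f x *\<^sub>R Z x) = nabla p u Z"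
    using nabla_leibniz[OF U f _ u] Y Z d0 U(2) by (simp_all add: f_def)
  moreover have "(\<lambda>x. f x *\<^sub>R Y x) = (\<lambda>x. f x *\<^sub>R Z x)" using eq by (auto simp: f_def)
  ultimately show ?thesis by simp
qed

text \<open>Extend \<open>u\<close> to a field with constant coordinates and use that the connection maps fields to fields.\<close>

lemma nabla_tangent:
  assumes U: "open U" "p \<in> U" and Z: "vector_field_on A U Z" and u: "u \<in> tangent_space A p"
  shows "nabla p u Z \<in> tangent_space A p"
proof -
  obtain c where c: "c \<in> charts_at A p" using ex_chart by (rule exE)
  let ?U = "U \<inter> fst c"
  have "open ?U" "p \<in> ?U" using U c open_domain[of c] by (auto simp: charts_at_iff)
  moreover have "vector_field_on A ?U (coord_field A c (u c))"
    by (rule vector_field_on_subset[OF vector_field_on_coord_field]) (use c in \<open>auto simp: charts_at_iff\<close>)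
  moreover have "vector_field_on A ?U Z" by (rule vector_field_on_subset[OF Z]) simp
  ultimately have "vector_field_on A ?U (\<lambda>p. nabla p (coord_field A c (u c) p) Z)"
    by (intro nabla_smooth)
  from vector_field_onD(1)[OF this \<open>p \<in> ?U\<close>] show ?thesis
    using coord_field_tangent_vector[OF u c] by simp
qed

lemma nabla_sum:
  assumes U: "open U" "p \<in> U" and u: "u \<in> tangent_space A p" and "finite I"
    and z: "\<And>i. smooth_fun_on A U (z i)" and E: "\<And>i. vector_field_on A U (E i)"
    and vf: "\<And>J. vector_field_on A U (\<lambda>x. \<Sum>i\<in>J. z i x *\<^sub>R E i x)"
    and vf1: "\<And>i. vector_field_on A U (\<lambda>x. z i x *\<^sub>R E i x)"
  shows "nabla p u (\<lambda>x. \<Sum>i\<in>I. z i x *\<^sub>R E i x) =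
    (\<Sum>i\<in>I. dir_deriv A p u (z i) *\<^sub>R E i p + z i p *\<^sub>R nabla p u (E i))"
  using \<open>finite I\<close>
proof (induction I rule: finite_induct)
  case empty
  obtain c where c: "c \<in> charts_at A p" using ex_chart by (rule exE)
  have Z: "vector_field_on A U (\<lambda>x. 0)" using vf[of "{}"] by (simp only: sum.empty)
  have "nabla p u (\<lambda>x. 0 *\<^sub>R 0) = dir_deriv A p u (\<lambda>_. 0) *\<^sub>R 0 + 0 *\<^sub>R nabla p u (\<lambda>x. 0)"
    by (rule nabla_leibniz[OF U _ Z u])
      (simp add: smooth_fun_on_def smooth_on_open_iff[OF open_image_chart[OF _ U(1)]] o_def)
  then have "nabla p u (\<lambda>x. 0) = 0" by (simp only: scaleR_zero_right scaleR_zero_left add_0)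
  then show ?case by (simp only: sum.empty)
next
  case (insert i I)
  have "nabla p u (\<lambda>x. \<Sum>i\<in>insert i I. z i x *\<^sub>R E i x)
      = nabla p u (\<lambda>x. z i x *\<^sub>R E i x + (\<Sum>i\<in>I. z i x *\<^sub>R E i x))"
    by (simp only: sum.insert[OF insert.hyps])
  also have "\<dots> = nabla p u (\<lambda>x. z i x *\<^sub>R E i x) + nabla p u (\<lambda>x. \<Sum>i\<in>I. z i x *\<^sub>R E i x)"
    by (rule nabla_add[OF U vf1 vf u])
  also have "nabla p u (\<lambda>x. z i x *\<^sub>R E i x) = dir_deriv A p u (z i) *\<^sub>R E i p + z i p *\<^sub>R nabla p u (E i)"
    by (rule nabla_leibniz[OF U z E u])
  also have "nabla p u (\<lambda>x. \<Sum>i\<in>I. z i x *\<^sub>R E i x)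
      = (\<Sum>i\<in>I. dir_deriv A p u (z i) *\<^sub>R E i p + z i p *\<^sub>R nabla p u (E i))"
    by (rule insert.IH)
  finally show ?case by (simp only: sum.insert[OF insert.hyps])
qed

lemma nabla_coord_field:
  assumes "c \<in> charts_at A p" "u \<in> tangent_space A p"
  shows "nabla p u (coord_field A c b) c = christoffel A nabla c (snd c p) (u c) b"
  using assms coord_field_tangent_vector[OF assms(2,1)]
  by (simp add: christoffel_def charts_at_iff)

lemma christoffel_smooth:
  assumes c: "c \<in> A"
  shows "C_inf_on (chart_range c) (\<lambda>x. christoffel A nabla c x a b)"
proof -
  have "vector_field_on A (fst c) (\<lambda>p. nabla p (coord_field A c a p) (coord_field A c b))"
    by (intro nabla_smooth open_domain c vector_field_on_coord_field)
  from vector_field_onD(2)[OF this open_domain[OF c] c] show ?thesis by (simp add: christoffel_def)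
qed

lemma christoffel_linear1:
  assumes c: "c \<in> A" and x: "x \<in> chart_range c"
  shows "linear (\<lambda>a. christoffel A nabla c x a b)"
proof -
  let ?p = "chart_inv c x"
  have p: "?p \<in> fst c" and cp: "c \<in> charts_at A ?p" using c x by (auto simp: charts_at_iff)
  note t = coord_field_tangent[OF cp]
  have "coord_field A c (a + a') ?p = coord_field A c a ?p + coord_field A c a' ?p" for a a'
    by (rule tangent_space_eqI[OF t tangent_space_add[OF t t] cp])
      (simp add: fun_vector_simps coord_field_self[OF cp])
  moreover have "coord_field A c (r *\<^sub>R a) ?p = r *\<^sub>R coord_field A c a ?p" for r a
    by (rule tangent_space_eqI[OF t tangent_space_scaleR[OF t] cp])
      (simp add: fun_vector_simps coord_field_self[OF cp])
  ultimately show ?thesis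
    using nabla_add_dir[OF open_domain[OF c] p vector_field_on_coord_field[OF c] t t]
      nabla_scale_dir[OF open_domain[OF c] p vector_field_on_coord_field[OF c] t]
    by (intro linearI) (simp_all add: christoffel_def fun_vector_simps)
qed

text \<open>In a chart \<open>Z\<close> is a combination of the coordinate fields with smooth coefficients; by locality the
  connection may be applied to this combination instead.\<close>

lemma nabla_expand:
  assumes U: "open U" "p \<in> U" and Z: "vector_field_on A U Z" and u: "u \<in> tangent_space A p"
    and c: "c \<in> charts_at A p"
  shows "nabla p u Z c = pd (u c) (\<lambda>x. Z (chart_inv c x) c) (snd c p)
    + (\<Sum>i\<in>Basis. (Z p c \<bullet> i) *\<^sub>R christoffel A nabla c (snd c p) (u c) i)"
proof -
  have cA: "c \<in> A" and pc: "p \<in> fst c" using c by (auto simp: charts_at_iff)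
  let ?U = "fst c \<inter> U"
  have U': "open ?U" "p \<in> ?U" using U pc open_domain[OF cA] by auto
  let ?z = "\<lambda>i x. Z x c \<bullet> i"
  have Zc: "C_inf_on (snd c ` ?U) (\<lambda>x. Z (chart_inv c x) c)"
    by (rule vector_field_onD(2)[OF Z U(1) cA])
  have cU: "open (snd c ` ?U)" by (rule open_image_chart[OF cA U(1)])
  have x: "snd c p \<in> snd c ` ?U" using U' by auto
  have zs: "C_inf_on (snd c ` ?U) (\<lambda>x. ?z i (chart_inv c x))" for i
    by (rule C_inf_on_bounded_linear[OF bounded_linear_inner_left cU Zc])
  have z: "smooth_fun_on A ?U (?z i)" for i
    by (rule smooth_fun_onI_chart[OF cA U'(1) _ zs]) simp
  have E: "vector_field_on A ?U (coord_field A c i)" for i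
    by (rule vector_field_on_subset[OF vector_field_on_coord_field[OF cA]]) simp
  have ch: "c \<in> charts_at A x" if "x \<in> ?U" for x using that cA by (simp add: charts_at_iff)
  have sum_c: "(\<Sum>i\<in>J. ?z i x *\<^sub>R coord_field A c i x) c = (\<Sum>i\<in>J. ?z i x *\<^sub>R i)" if "x \<in> ?U" for x J
    using coord_field_self[OF ch[OF that]] by (simp add: sum_fun_apply fun_vector_simps)
  have sum_t: "(\<Sum>i\<in>J. ?z i x *\<^sub>R coord_field A c i x) \<in> tangent_space A x" if "x \<in> ?U" for x J
    by (rule tangent_space_sum) (intro tangent_space_scaleR coord_field_tangent ch that)
  have vf: "vector_field_on A ?U (\<lambda>x. \<Sum>i\<in>J. ?z i x *\<^sub>R coord_field A c i x)" for J
  proof (rule vector_field_onI_chart[OF cA U'(1) _ sum_t])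
    have "C_inf_on (snd c ` ?U) (\<lambda>x. \<Sum>i\<in>J. ?z i (chart_inv c x) *\<^sub>R i)"
      by (rule C_inf_on_sum[OF cU C_inf_on_scaleR[OF cU zs C_inf_on_const]])
    then show "C_inf_on (snd c ` ?U) (\<lambda>x. (\<Sum>i\<in>J. ?z i (chart_inv c x) *\<^sub>R coord_field A c i (chart_inv c x)) c)"
      by (rule C_inf_on_cong[OF cU]) (use sum_c cA in auto)
  qed auto
  have vf1: "vector_field_on A ?U (\<lambda>x. ?z i x *\<^sub>R coord_field A c i x)" for i
    using vf[of "{i}"] by simp
  have "nabla p u Z = nabla p u (\<lambda>x. \<Sum>i\<in>Basis. ?z i x *\<^sub>R coord_field A c i x)"
  proof (rule nabla_local[OF U' _ vf _ u])
    show "vector_field_on A ?U Z" by (rule vector_field_on_subset[OF Z]) simp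
    fix x assume "x \<in> ?U"
    then show "Z x = (\<Sum>i\<in>Basis. ?z i x *\<^sub>R coord_field A c i x)"
      using vector_field_onD(1)[OF Z] sum_t
      by (intro tangent_space_eqI[OF _ _ ch]) (auto simp: sum_c euclidean_representation)
  qed
  also have "\<dots> = (\<Sum>i\<in>Basis. dir_deriv A p u (?z i) *\<^sub>R coord_field A c i p
      + ?z i p *\<^sub>R nabla p u (coord_field A c i))"
    by (rule nabla_sum[OF U' u finite_Basis z E vf vf1])
  finally have "nabla p u Z c = (\<Sum>i\<in>Basis. dir_deriv A p u (?z i) *\<^sub>R i
      + ?z i p *\<^sub>R christoffel A nabla c (snd c p) (u c) i)"
    by (simp add: sum_fun_apply fun_vector_simps coord_field_self[OF c] nabla_coord_field[OF c u])
  moreover have "dir_deriv A p u (?z i) = pd (u c) (\<lambda>x. Z (chart_inv c x) c) (snd c p) \<bullet> i" for i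
  proof -
    have "dir_deriv A p u (?z i) = pd (u c) (\<lambda>x. ?z i (chart_inv c x)) (snd c p)"
      using dir_deriv_chart[OF c u, of "?z i"] C_inf_on_differentiable[OF zs x] by (simp add: o_def)
    then show ?thesis
      using pd_bounded_linear[OF bounded_linear_inner_left C_inf_on_differentiable[OF Zc x]] by simp
  qed
  ultimately show ?thesis by (simp add: sum.distrib euclidean_representation)
qed

text \<open>Apply the expansion to a field with constant coordinates, whose derivative vanishes.\<close>

lemma christoffel_linear2:
  assumes c: "c \<in> A" and x: "x \<in> chart_range c"
  shows "linear (christoffel A nabla c x a)"
proof -
  let ?p = "chart_inv c x"
  have p: "?p \<in> fst c" and cp: "c \<in> charts_at A ?p" and xp: "snd c ?p = x"
    using c x by (auto simp: charts_at_iff)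
  have "christoffel A nabla c x a b = (\<Sum>i\<in>Basis. (b \<bullet> i) *\<^sub>R christoffel A nabla c x a i)" for b
  proof -
    have "pd a (\<lambda>x. coord_field A c b (chart_inv c x) c) x = pd a (\<lambda>x. b) x"
      by (rule pd_cong[OF open_range[OF c] x]) (use c in \<open>auto simp: coord_field_self charts_at_iff\<close>)
    then show ?thesis
      using nabla_expand[OF open_domain[OF c] p vector_field_on_coord_field[OF c] coord_field_tangent[OF cp] cp, of a b]
        nabla_coord_field[OF cp coord_field_tangent[OF cp], of a b]
      by (simp add: coord_field_self[OF cp] xp)
  qed
  note ex = this
  show ?thesis
  proof (rule linearI)
    fix b b' show "christoffel A nabla c x a (b + b') = christoffel A nabla c x a b + christoffel A nabla c x a b'"
      by (simp only: ex[of "b + b'"] ex[of b] ex[of b'] inner_add_left scaleR_add_left sum.distrib)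
  next
    fix r b show "christoffel A nabla c x a (r *\<^sub>R b) = r *\<^sub>R christoffel A nabla c x a b"
      by (simp only: ex[of "r *\<^sub>R b"] ex[of b] inner_scaleR_left scaleR_scaleR scaleR_sum_right)
  qed
qed

lemma bil_fam_christoffel: "c \<in> A \<Longrightarrow> bil_fam (chart_range c) (christoffel A nabla c)"
  by (simp add: bil_fam_def christoffel_linear1 christoffel_linear2 christoffel_smooth)

lemma nabla_chart:
  assumes U: "open U" "p \<in> U" and Z: "vector_field_on A U Z" and u: "u \<in> tangent_space A p"
    and c: "c \<in> charts_at A p"
  shows "nabla p u Z c = Dv (christoffel A nabla c) (\<lambda>x. x) (u c) (\<lambda>x. Z (chart_inv c x) c) (snd c p)"
proof -
  have "linear (christoffel A nabla c (snd c p) (u c))"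
    using c by (intro christoffel_linear2) (auto simp: charts_at_iff)
  from linear_euclidean_expand[OF this, of "Z p c"] show ?thesis
    using nabla_expand[OF assms] c by (simp add: Dv_def charts_at_iff)
qed

end

section \<open>The Levi-Civita connection in a chart\<close>

definition metric_coord :: "('q, 'e::euclidean_space) chart set \<Rightarrow>
    ('q \<Rightarrow> ('q, 'e) tvec \<Rightarrow> ('q, 'e) tvec \<Rightarrow> real) \<Rightarrow> ('q, 'e) chart \<Rightarrow> 'e \<Rightarrow> 'e \<Rightarrow> 'e \<Rightarrow> real" where
  "metric_coord A g c x a b =
     g (chart_inv c x) (coord_field A c a (chart_inv c x)) (coord_field A c b (chart_inv c x))"

context smooth_manifold begin

lemma coord_field_add:
  assumes "c \<in> charts_at A p"
  shows "coord_field A c (a + b) p = coord_field A c a p + coord_field A c b p"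
  by (rule tangent_space_eqI[OF coord_field_tangent tangent_space_add[OF coord_field_tangent coord_field_tangent]])
    (use assms in \<open>auto simp: coord_field_self\<close>)

lemma coord_field_scaleR:
  assumes "c \<in> charts_at A p"
  shows "coord_field A c (r *\<^sub>R a) p = r *\<^sub>R coord_field A c a p"
  by (rule tangent_space_eqI[OF coord_field_tangent tangent_space_scaleR[OF coord_field_tangent]])
    (use assms in \<open>auto simp: coord_field_self fun_vector_simps\<close>)

end

context riemannian_manifold begin

lemma metric_chart:
  assumes "u \<in> tangent_space A p" "v \<in> tangent_space A p" "c \<in> charts_at A p"
  shows "g p u v = metric_coord A g c (snd c p) (u c) (v c)"
  using coord_field_tangent_vector[OF assms(1,3)] coord_field_tangent_vector[OF assms(2,3)] assms(3)
  by (simp add: metric_coord_def charts_at_iff)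

lemma charts_at_chart_inv: "c \<in> A \<Longrightarrow> x \<in> chart_range c \<Longrightarrow> c \<in> charts_at A (chart_inv c x)"
  by (auto simp: charts_at_iff)

lemma metric_coord_sym:
  "c \<in> A \<Longrightarrow> x \<in> chart_range c \<Longrightarrow> metric_coord A g c x a b = metric_coord A g c x b a"
  unfolding metric_coord_def
  by (intro metric_sym coord_field_tangent charts_at_chart_inv)

lemma linear_metric_coord1:
  assumes "c \<in> A" "x \<in> chart_range c"
  shows "linear (\<lambda>a. metric_coord A g c x a b)"
proof -
  note c = charts_at_chart_inv[OF assms]
  note t = coord_field_tangent[OF c]
  show ?thesis
    by (rule linearI) (simp_all only: metric_coord_def coord_field_add[OF c] coord_field_scaleR[OF c]
        metric_add[OF t t t] metric_scale[OF t t] real_scaleR_def)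
qed

lemma bil_fam_metric_coord:
  assumes c: "c \<in> A"
  shows "bil_fam (chart_range c) (metric_coord A g c)"
proof -
  have "linear (metric_coord A g c x a)" if x: "x \<in> chart_range c" for x a
  proof -
    have "metric_coord A g c x a = (\<lambda>b. metric_coord A g c x b a)"
      by (rule ext) (rule metric_coord_sym[OF c x])
    then show ?thesis using linear_metric_coord1[OF c x] by simp
  qed
  moreover have "C_inf_on (chart_range c) (\<lambda>x. metric_coord A g c x a b)" for a b
    using smooth_fun_onD[OF metric_smooth[OF open_domain[OF c] vector_field_on_coord_field[OF c]
          vector_field_on_coord_field[OF c]] open_domain[OF c] c, of a b]
    by (simp add: metric_coord_def o_def)
  ultimately show ?thesis using linear_metric_coord1[OF c] by (simp add: bil_fam_def)
qed

lemma metric_coord_pos: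
  assumes "c \<in> A" "x \<in> chart_range c" "a \<noteq> 0"
  shows "0 < metric_coord A g c x a a"
proof -
  note c = charts_at_chart_inv[OF assms(1,2)]
  have "coord_field A c a (chart_inv c x) \<noteq> 0"
    using coord_field_self[OF c, of a] assms(3) by (metis zero_fun_apply)
  then show ?thesis unfolding metric_coord_def by (intro metric_pos coord_field_tangent c)
qed

lemma tangent_vector_eqI:
  assumes u: "u \<in> tangent_space A p" and v: "v \<in> tangent_space A p"
    and eq: "\<And>w. w \<in> tangent_space A p \<Longrightarrow> g p u w = g p v w"
  shows "u = v"
proof (rule ccontr)
  assume "u \<noteq> v"
  have t: "u - v \<in> tangent_space A p" "- v \<in> tangent_space A p"
    using tangent_space_diff[OF u v] tangent_space_minus[OF v] .
  have "0 < g p (u - v) (u - v)" using \<open>u \<noteq> v\<close> by (intro metric_pos t) (simp only: right_minus_eq not_False_eq_True)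
  also have "g p (u - v) (u - v) = g p u (u - v) + g p (- v) (u - v)"
    using metric_add[OF u t(2) t(1)] by (simp only: diff_conv_add_uminus)
  also have "g p (- v) (u - v) = - g p v (u - v)"
    using metric_scale[OF v t(1), of "-1"] by (simp only: scaleR_minus1_left mult_minus1)
  finally show False using eq[OF t(1)] by linarith
qed

end

section \<open>The gradient\<close>

context riemannian_manifold begin

text \<open>The coordinates of the gradient solve a linear system whose matrix is the metric; smoothness of the
  solution is the smooth Riesz representation.\<close>

lemma gradient_coord:
  assumes V: "smooth_fun_on A UNIV V" and c: "c \<in> A"
  shows "\<exists>w. C_inf_on (chart_range c) w
    \<and> (\<forall>p\<in>fst c. gradient A g V p = coord_field A c (w (snd c p)) p)
    \<and> (\<forall>x\<in>chart_range c. \<forall>b. metric_coord A g c x (w x) b = pd b (V \<circ> chart_inv c) x)"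
proof -
  have Vc: "C_inf_on (chart_range c) (V \<circ> chart_inv c)"
    using smooth_fun_onD[OF V open_UNIV c] by simp
  have "lin_fam (chart_range c) (\<lambda>x b. pd b (V \<circ> chart_inv c) x)"
    unfolding lin_fam_def using C_inf_on_imp_pd[OF Vc] C_inf_on_linear_pd[OF Vc] by blast
  then obtain w where w: "C_inf_on (chart_range c) w"
    "\<And>x b. x \<in> chart_range c \<Longrightarrow> metric_coord A g c x (w x) b = pd b (V \<circ> chart_inv c) x"
    using smooth_riesz[OF open_range[OF c] bil_fam_metric_coord[OF c] metric_coord_pos[OF c]] by blast
  have "gradient A g V p = coord_field A c (w (snd c p)) p" if p: "p \<in> fst c" for p
  proof -
    have cp: "c \<in> charts_at A p" using c p by (simp add: charts_at_iff)
    have x: "snd c p \<in> chart_range c" using p by simp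
    let ?w = "coord_field A c (w (snd c p)) p"
    have wt: "?w \<in> tangent_space A p" by (rule coord_field_tangent[OF cp])
    have gw: "g p ?w u = dir_deriv A p u V" if u: "u \<in> tangent_space A p" for u
      using metric_chart[OF wt u cp] w(2)[OF x] dir_deriv_chart[OF cp u C_inf_on_differentiable[OF Vc x]]
      by (simp add: coord_field_self[OF cp])
    show ?thesis
      unfolding gradient_def
      by (rule the_equality) (use wt gw in \<open>auto intro: tangent_vector_eqI\<close>)
  qed
  with w show ?thesis by (intro exI[of _ w]) simp
qed

lemma gradient_tangent:
  assumes "smooth_fun_on A UNIV V"
  shows "gradient A g V p \<in> tangent_space A p"
proof -
  obtain c where c: "c \<in> charts_at A p" using ex_chart by (rule exE)
  then have "c \<in> A" "p \<in> fst c" by (auto simp: charts_at_iff)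
  from gradient_coord[OF assms \<open>c \<in> A\<close>] obtain w where
    "\<forall>p\<in>fst c. gradient A g V p = coord_field A c (w (snd c p)) p"
    by (elim exE conjE)
  with \<open>p \<in> fst c\<close> show ?thesis using coord_field_tangent[OF c] by simp
qed

lemma gradient_smooth:
  assumes V: "smooth_fun_on A UNIV V" and c: "c \<in> A"
  shows "C_inf_on (chart_range c) (\<lambda>x. gradient A g V (chart_inv c x) c)"
    and "x \<in> chart_range c \<Longrightarrow>
      pd b (V \<circ> chart_inv c) x = metric_coord A g c x (gradient A g V (chart_inv c x) c) b"
proof -
  from gradient_coord[OF V c] obtain w where w: "C_inf_on (chart_range c) w"
    "\<forall>p\<in>fst c. gradient A g V p = coord_field A c (w (snd c p)) p"
    "\<forall>x\<in>chart_range c. \<forall>b. metric_coord A g c x (w x) b = pd b (V \<circ> chart_inv c) x"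
    by (elim exE conjE)
  have eq: "w x = gradient A g V (chart_inv c x) c" if x: "x \<in> chart_range c" for x
    using bspec[OF w(2) chart_inv_mem[OF c x]] coord_field_self[OF charts_at_chart_inv[OF c x]]
      chart_inv_right[OF c x] by simp
  show "C_inf_on (chart_range c) (\<lambda>x. gradient A g V (chart_inv c x) c)"
    by (rule C_inf_on_cong[OF open_range[OF c] w(1) eq])
  show "pd b (V \<circ> chart_inv c) x = metric_coord A g c x (gradient A g V (chart_inv c x) c) b"
    if x: "x \<in> chart_range c"
    using bspec[OF w(3) x] by (simp only: eq[OF x])
qed

lemma vector_field_on_gradient:
  assumes V: "smooth_fun_on A UNIV V"
  shows "vector_field_on A UNIV (gradient A g V)"
  using gradient_tangent[OF V] gradient_smooth(1)[OF V]
  by (simp add: vector_field_on_def smooth_on_open_iff[OF open_range])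

end

context levi_civita begin

lemma lie_bracket_chart:
  "c \<in> charts_at A p \<Longrightarrow> lie_bracket A X Y p c =
     pd (X p c) (\<lambda>x. Y (chart_inv c x) c) (snd c p) - pd (Y p c) (\<lambda>x. X (chart_inv c x) c) (snd c p)"
  by (simp add: lie_bracket_def pd_def)

text \<open>Coordinate fields commute.\<close>

lemma christoffel_sym:
  assumes c: "c \<in> A" and x: "x \<in> chart_range c"
  shows "christoffel A nabla c x a b = christoffel A nabla c x b a"
proof -
  let ?p = "chart_inv c x"
  have p: "?p \<in> fst c" and xp: "snd c ?p = x" and cp: "c \<in> charts_at A ?p"
    using c x by (auto simp: charts_at_iff)
  have const: "pd d (\<lambda>x. coord_field A c b (chart_inv c x) c) x = 0" for b d
    by (rule trans[OF pd_cong[OF open_range[OF c] x] pd_const])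
      (rule coord_field_self[OF charts_at_chart_inv[OF c]])
  have "lie_bracket A (coord_field A c a) (coord_field A c b) ?p c = 0"
    unfolding lie_bracket_chart[OF cp] xp by (simp add: const)
  then have "(nabla ?p (coord_field A c a ?p) (coord_field A c b)
      - nabla ?p (coord_field A c b ?p) (coord_field A c a)) c = 0"
    by (simp only: torsion_free[OF open_domain[OF c] p vector_field_on_coord_field[OF c]
          vector_field_on_coord_field[OF c]])
  then show ?thesis by (simp add: christoffel_def)
qed

text \<open>Metric compatibility, applied to coordinate fields.\<close>

lemma metric_coord_compatible:
  assumes c: "c \<in> A" and x: "x \<in> chart_range c"
  shows "pd d (\<lambda>z. metric_coord A g c z a b) x =
    metric_coord A g c x (christoffel A nabla c x d a) b + metric_coord A g c x a (christoffel A nabla c x d b)"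
proof -
  let ?p = "chart_inv c x"
  have p: "?p \<in> fst c" and xp: "snd c ?p = x" and cp: "c \<in> charts_at A ?p"
    using c x by (auto simp: charts_at_iff)
  note U = open_domain[OF c] p
  note E = vector_field_on_coord_field[OF c]
  note t = coord_field_tangent[OF cp]
  let ?f = "\<lambda>q. g q (coord_field A c a q) (coord_field A c b q)"
  have "C_inf_on (chart_range c) (?f \<circ> chart_inv c)"
    using smooth_fun_onD[OF metric_smooth[OF U(1) E E] U(1) c] by simp
  from C_inf_on_differentiable[OF this x]
  have "dir_deriv A ?p (coord_field A c d ?p) ?f = pd d (?f \<circ> chart_inv c) x"
    using dir_deriv_chart[OF cp t, of ?f d] by (simp add: xp coord_field_self[OF cp])
  moreover have "?f \<circ> chart_inv c = (\<lambda>z. metric_coord A g c z a b)"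
    by (simp add: metric_coord_def fun_eq_iff)
  moreover have "g ?p (nabla ?p (coord_field A c d ?p) (coord_field A c a)) (coord_field A c b ?p)
      = metric_coord A g c x (christoffel A nabla c x d a) b" for a b
    using metric_chart[of "nabla ?p (coord_field A c d ?p) (coord_field A c a)" ?p "coord_field A c b ?p" c,
        OF nabla_tangent[OF U E t] t cp]
    by (simp add: xp christoffel_def coord_field_self[OF cp])
  moreover have "g ?p (coord_field A c a ?p) (nabla ?p (coord_field A c d ?p) (coord_field A c b))
      = metric_coord A g c x a (christoffel A nabla c x d b)"
    using metric_chart[of "coord_field A c a ?p" ?p "nabla ?p (coord_field A c d ?p) (coord_field A c b)" c,
        OF t nabla_tangent[OF U E t] cp]
    by (simp add: xp christoffel_def coord_field_self[OF cp])
  ultimately show ?thesis using metric_compatible[of "fst c" ?p "coord_field A c a" "coord_field A c b" "coord_field A c d ?p", OF U E E t] by simp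
qed

lemma coord_metric: "c \<in> A \<Longrightarrow> coord_metric (chart_range c) (christoffel A nabla c) (metric_coord A g c)"
  by unfold_locales (intro open_range bil_fam_christoffel christoffel_sym bil_fam_metric_coord
      metric_coord_sym metric_coord_compatible; assumption)+

lemma coord_metric_map:
  assumes "c \<in> A" "open W" "C_inf_on W h" "h ` W \<subseteq> chart_range c"
  shows "coord_metric_map (chart_range c) (christoffel A nabla c) (metric_coord A g c) W h"
proof -
  interpret coord_metric "chart_range c" "christoffel A nabla c" "metric_coord A g c"
    by (rule coord_metric[OF assms(1)])
  show ?thesis by unfold_locales (rule assms)+
qed

lemma coord_variation:
  assumes V: "smooth_fun_on A UNIV V"
    and "c \<in> A" "open W" "C_inf_on W h" "h ` W \<subseteq> chart_range c"
  shows "coord_variation (chart_range c) (christoffel A nabla c) (metric_coord A g c) W h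
    (V \<circ> chart_inv c) (\<lambda>x. gradient A g V (chart_inv c x) c)"
proof -
  interpret coord_metric_map "chart_range c" "christoffel A nabla c" "metric_coord A g c" W h
    by (rule coord_metric_map[OF assms(2-)])
  have Vc: "C_inf_on (chart_range c) (V \<circ> chart_inv c)"
    using smooth_fun_onD[OF V open_UNIV assms(2)] by simp
  show ?thesis
    by unfold_locales (rule Vc, rule gradient_smooth(1)[OF V assms(2)], rule gradient_smooth(2)[OF V assms(2)])
qed

section \<open>The curvature tensor in a chart\<close>

text \<open>In coordinates \<open>\<nabla>\<^sub>X \<nabla>\<^sub>Y Z\<close> is a second covariant derivative in the directions \<open>X p\<close> and
  \<open>Y p\<close> plus the derivative of \<open>Z\<close> in the direction of the derivative of \<open>Y\<close>. The latter terms
  cancel against the bracket, the former give the curvature by commuting derivatives.\<close>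

lemma curvature_field_chart:
  assumes U: "open U" "p \<in> U" and X: "vector_field_on A U X" and Y: "vector_field_on A U Y"
    and Z: "vector_field_on A U Z"
  shows "curvature_field A nabla X Y Z p \<in> tangent_space A p"
    and "c \<in> charts_at A p \<Longrightarrow> curvature_field A nabla X Y Z p c =
      Rm (christoffel A nabla c) (snd c p) (X p c) (Y p c) (Z p c)"
proof -
  have t: "X p \<in> tangent_space A p" "Y p \<in> tangent_space A p"
    using vector_field_onD(1)[OF X U(2)] vector_field_onD(1)[OF Y U(2)] .
  have YZ: "vector_field_on A U (\<lambda>x. nabla x (Y x) Z)" if "vector_field_on A U Y" for Y
    by (rule nabla_smooth[OF U(1) that Z])
  have bt: "lie_bracket A X Y p \<in> tangent_space A p"
    using torsion_free[OF U X Y] nabla_tangent[OF U Y t(1)] nabla_tangent[OF U X t(2)]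
      tangent_space_diff by metis
  show "curvature_field A nabla X Y Z p \<in> tangent_space A p"
    unfolding curvature_field_def
    by (intro tangent_space_diff nabla_tangent[OF U YZ] nabla_tangent[OF U Z] X Y t bt)
  assume cp: "c \<in> charts_at A p"
  then have c: "c \<in> A" and p: "p \<in> fst c" by (auto simp: charts_at_iff)
  let ?W = "snd c ` (fst c \<inter> U)" and ?\<Gamma> = "christoffel A nabla c"
  let ?x = "snd c p"
  have W: "open ?W" and x: "?x \<in> ?W" using open_image_chart[OF c U(1)] p U(2) by auto
  interpret coord_metric_map "chart_range c" "christoffel A nabla c" "metric_coord A g c" ?W "\<lambda>x. x"
    by (rule coord_metric_map[OF c W C_inf_on_ident[OF W]]) auto
  let ?\<xi> = "\<lambda>x. X (chart_inv c x) c" and ?\<eta> = "\<lambda>x. Y (chart_inv c x) c" and ?\<zeta> = "\<lambda>x. Z (chart_inv c x) c"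
  have sm: "C_inf_on ?W ?\<xi>" "C_inf_on ?W ?\<eta>" "C_inf_on ?W ?\<zeta>"
    using vector_field_onD(2)[OF _ U(1) c] X Y Z by auto
  let ?L = "\<lambda>y b. D b ?\<zeta> y"
  have lin: "linear (?L y)" if "y \<in> ?W" for y
  proof -
    note l1 = C_inf_on_linear_pd[OF sm(3) that]
    note l2 = linear_\<Gamma>(2)[OF h_mem[OF that]]
    show ?thesis unfolding Dv_def
      by (rule linearI) (simp_all add: linear_add[OF l1] linear_scale[OF l1] linear_add[OF l2] linear_scale[OF l2] scaleR_add_right)
  qed
  have L: "lin_fam ?W ?L" using lin smooth_D[OF sm(3)] by (simp add: lin_fam_def)
  have 2: "nabla p u (\<lambda>x. nabla x (Y x) Z) c
      = D (u c) (D (Y p c) ?\<zeta>) ?x + D (pd (u c) (\<lambda>x. Y (chart_inv c x) c) ?x) ?\<zeta> ?x"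
    if Y: "vector_field_on A U Y" and u: "u \<in> tangent_space A p" for Y u
  proof -
    let ?\<eta> = "\<lambda>x. Y (chart_inv c x) c"
    have sm\<eta>: "C_inf_on ?W ?\<eta>" by (rule vector_field_onD(2)[OF Y U(1) c])
    have "nabla p u (\<lambda>x. nabla x (Y x) Z) c
        = D (u c) (\<lambda>x. nabla (chart_inv c x) (Y (chart_inv c x)) Z c) ?x"
      by (rule nabla_chart[OF U YZ[OF Y] u cp])
    also have "\<dots> = D (u c) (\<lambda>y. ?L y (?\<eta> y)) ?x"
    proof (rule D_cong[OF x])
      fix y assume "y \<in> ?W"
      then obtain r where r: "r \<in> fst c" "r \<in> U" "y = snd c r" by auto
      then have "c \<in> charts_at A r" using c by (simp add: charts_at_iff)
      from nabla_chart[OF U(1) r(2) Z vector_field_onD(1)[OF Y r(2)] this]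
      show "nabla (chart_inv c y) (Y (chart_inv c y)) Z c = ?L y (?\<eta> y)"
        using r c by simp
    qed
    also have "\<dots> = pd (u c) (\<lambda>z. ?L z (?\<eta> ?x)) ?x + ?L ?x (pd (u c) ?\<eta> ?x) + ?\<Gamma> ?x (u c) (?L ?x (?\<eta> ?x))"
      by (simp only: Dv_def[of _ _ _ "\<lambda>y. ?L y (?\<eta> y)"] lin_fam_app(2)[OF W L sm\<eta> x] pd_ident)
    also have "?\<eta> ?x = Y p c" using c p by simp
    finally show ?thesis by (simp add: Dv_def[of _ _ _ "D (Y p c) ?\<zeta>"])
  qed
  have "curvature_field A nabla X Y Z p c
      = D (X p c) (D (Y p c) ?\<zeta>) ?x + ?L ?x (pd (X p c) ?\<eta> ?x)
        - (D (Y p c) (D (X p c) ?\<zeta>) ?x + ?L ?x (pd (Y p c) ?\<xi> ?x))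
        - ?L ?x (pd (X p c) ?\<eta> ?x - pd (Y p c) ?\<xi> ?x)"
    using nabla_chart[OF U Z bt cp]
    by (simp add: curvature_field_def 2[OF Y t(1)] 2[OF X t(2)] lie_bracket_chart[OF cp])
  also have "\<dots> = D (X p c) (D (Y p c) ?\<zeta>) ?x - D (Y p c) (D (X p c) ?\<zeta>) ?x"
    by (simp add: linear_diff[OF lin[OF x]])
  also have "\<dots> = Rm ?\<Gamma> ?x (X p c) (Y p c) (?\<zeta> ?x)"
    using D_commute[OF sm(3) x, of "X p c" "Y p c"] by simp
  finally show "curvature_field A nabla X Y Z p c = Rm ?\<Gamma> ?x (X p c) (Y p c) (Z p c)"
    using c p by simp
qed

text \<open>If the value of \<open>K\<close> at \<open>p\<close> depends, in one chart, only on the values of its arguments at \<open>p\<close>,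
  then the definite description in the definition of \<open>tensor_value\<close> denotes.\<close>

lemma tensor_value_chart:
  assumes c: "c \<in> charts_at A p"
    and K: "\<And>U X Y Z. open U \<Longrightarrow> p \<in> U \<Longrightarrow> vector_field_on A U X \<Longrightarrow> vector_field_on A U Y \<Longrightarrow>
      vector_field_on A U Z \<Longrightarrow> K X Y Z \<in> tangent_space A p \<and> K X Y Z c = k (X p c) (Y p c) (Z p c)"
    and uvw: "u \<in> tangent_space A p" "v \<in> tangent_space A p" "w \<in> tangent_space A p"
  shows "tensor_value A p K u v w \<in> tangent_space A p"
    and "tensor_value A p K u v w c = k (u c) (v c) (w c)"
proof -
  have cA: "c \<in> A" and p: "p \<in> fst c" using c by (auto simp: charts_at_iff)
  let ?E = "\<lambda>u. coord_field A c (u c)"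
  let ?r = "K (?E u) (?E v) (?E w)"
  have E: "vector_field_on A (fst c) (?E u)" for u by (rule vector_field_on_coord_field[OF cA])
  have Ep: "?E u p = u" if "u \<in> tangent_space A p" for u by (rule coord_field_tangent_vector[OF that c])
  have r: "?r \<in> tangent_space A p" "?r c = k (u c) (v c) (w c)"
    using K[OF open_domain[OF cA] p E E E, of u v w] Ep uvw by auto
  have "tensor_value A p K u v w = ?r"
    unfolding tensor_value_def
  proof (rule the_equality)
    show "\<forall>U X Y Z. open U \<and> p \<in> U \<and> vector_field_on A U X \<and> vector_field_on A U Y \<and> vector_field_on A U Z \<and>
      X p = u \<and> Y p = v \<and> Z p = w \<longrightarrow> ?r = K X Y Z"
    proof (intro allI impI, elim conjE)
      fix U X Y Z
      assume "open U" "p \<in> U" "vector_field_on A U X" "vector_field_on A U Y" "vector_field_on A U Z"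
        and eq: "X p = u" "Y p = v" "Z p = w"
      from K[OF this(1-5)] show "?r = K X Y Z"
        using r by (intro tangent_space_eqI[OF r(1) _ c]) (simp_all add: eq)
    qed
  next
    fix s
    assume s: "\<forall>U X Y Z. open U \<and> p \<in> U \<and> vector_field_on A U X \<and> vector_field_on A U Y \<and> vector_field_on A U Z \<and>
      X p = u \<and> Y p = v \<and> Z p = w \<longrightarrow> s = K X Y Z"
    show "s = ?r"
      by (rule s[rule_format, of "fst c"]) (use E Ep uvw open_domain[OF cA] p in auto)
  qed
  with r show "tensor_value A p K u v w \<in> tangent_space A p"
    "tensor_value A p K u v w c = k (u c) (v c) (w c)" by simp_all
qed

lemma curvature_chart:
  assumes "u \<in> tangent_space A p" "v \<in> tangent_space A p" "w \<in> tangent_space A p"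
  shows "curvature A nabla p u v w \<in> tangent_space A p"
    and "c \<in> charts_at A p \<Longrightarrow>
      curvature A nabla p u v w c = Rm (christoffel A nabla c) (snd c p) (u c) (v c) (w c)"
proof -
  have *: "curvature A nabla p u v w \<in> tangent_space A p \<and>
      curvature A nabla p u v w c = Rm (christoffel A nabla c) (snd c p) (u c) (v c) (w c)"
    if c: "c \<in> charts_at A p" for c
    unfolding curvature_def
    by (intro conjI tensor_value_chart[OF c _ assms]) (simp_all add: curvature_field_chart c)
  then show "c \<in> charts_at A p \<Longrightarrow>
      curvature A nabla p u v w c = Rm (christoffel A nabla c) (snd c p) (u c) (v c) (w c)" by simp
  obtain c where "c \<in> charts_at A p" using ex_chart by (rule exE)
  with * show "curvature A nabla p u v w \<in> tangent_space A p" by simp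
qed

lemma vector_field_on_curvature:
  assumes U: "open U" and X: "vector_field_on A U X" and Y: "vector_field_on A U Y" and Z: "vector_field_on A U Z"
  shows "vector_field_on A U (\<lambda>x. curvature A nabla x (X x) (Y x) (Z x))"
  unfolding vector_field_on_def
proof (intro conjI ballI)
  note t = vector_field_onD(1)[OF X] vector_field_onD(1)[OF Y] vector_field_onD(1)[OF Z]
  show "curvature A nabla x (X x) (Y x) (Z x) \<in> tangent_space A x" if "x \<in> U" for x
    by (intro curvature_chart t that)
  fix d assume d: "d \<in> A"
  let ?W = "snd d ` (fst d \<inter> U)"
  have W: "open ?W" by (rule open_image_chart[OF d U])
  interpret coord_metric_map "chart_range d" "christoffel A nabla d" "metric_coord A g d" ?W "\<lambda>x. x"
    by (rule coord_metric_map[OF d W C_inf_on_ident[OF W]]) auto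
  have "C_inf_on ?W (\<lambda>x. Rm (christoffel A nabla d) x (X (chart_inv d x) d) (Y (chart_inv d x) d) (Z (chart_inv d x) d))"
    by (rule tri_fam_app(1)[OF W tri_Rmh]) (rule vector_field_onD(2)[OF _ U d], rule X Y Z)+
  then have "C_inf_on ?W (\<lambda>x. curvature A nabla (chart_inv d x) (X (chart_inv d x)) (Y (chart_inv d x)) (Z (chart_inv d x)) d)"
  proof (rule C_inf_on_cong[OF W])
    fix y assume "y \<in> ?W"
    then obtain r where r: "r \<in> fst d" "r \<in> U" "y = snd d r" by auto
    then have "d \<in> charts_at A r" using d by (simp add: charts_at_iff)
    from curvature_chart(2)[OF t[OF r(2)] this]
    show "Rm (christoffel A nabla d) y (X (chart_inv d y) d) (Y (chart_inv d y) d) (Z (chart_inv d y) d)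
      = curvature A nabla (chart_inv d y) (X (chart_inv d y)) (Y (chart_inv d y)) (Z (chart_inv d y)) d"
      using r d by simp
  qed
  then show "smooth_on ?W (\<lambda>x. curvature A nabla (chart_inv d x) (X (chart_inv d x)) (Y (chart_inv d x)) (Z (chart_inv d x)) d)"
    by (simp add: smooth_on_open_iff[OF W])
qed

text \<open>By the Leibniz rule all derivatives of the extensions \<open>X\<close>, \<open>Y\<close>, \<open>Z\<close> cancel.\<close>

lemma nabla_curvature_chart:
  assumes a: "a \<in> tangent_space A p"
    and uvw: "u \<in> tangent_space A p" "v \<in> tangent_space A p" "w \<in> tangent_space A p"
    and cp: "c \<in> charts_at A p"
  shows "nabla_curvature A nabla p a u v w \<in> tangent_space A p"
    and "nabla_curvature A nabla p a u v w c = nRm (christoffel A nabla c) (snd c p) (a c) (u c) (v c) (w c)"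
proof -
  have c: "c \<in> A" and p: "p \<in> fst c" using cp by (auto simp: charts_at_iff)
  let ?K = "\<lambda>X Y Z. nabla p a (\<lambda>x. curvature A nabla x (X x) (Y x) (Z x))
     - curvature A nabla p (nabla p a X) (Y p) (Z p)
     - curvature A nabla p (X p) (nabla p a Y) (Z p)
     - curvature A nabla p (X p) (Y p) (nabla p a Z)"
  let ?x = "snd c p"
  have K: "?K X Y Z \<in> tangent_space A p \<and>
      ?K X Y Z c = nRm (christoffel A nabla c) ?x (a c) (X p c) (Y p c) (Z p c)"
    if U: "open U" "p \<in> U" and X: "vector_field_on A U X" and Y: "vector_field_on A U Y"
      and Z: "vector_field_on A U Z" for U X Y Z
  proof
    note t = vector_field_onD(1)[OF X] vector_field_onD(1)[OF Y] vector_field_onD(1)[OF Z]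
    note n = nabla_tangent[OF U _ a]
    note R = vector_field_on_curvature[OF U(1) X Y Z]
    show "?K X Y Z \<in> tangent_space A p"
      by (intro tangent_space_diff curvature_chart(1) n[OF R] n[OF X] n[OF Y] n[OF Z] t U(2))
    let ?W = "snd c ` (fst c \<inter> U)"
    have W: "open ?W" and x: "?x \<in> ?W" using open_image_chart[OF c U(1)] p U(2) by auto
    interpret coord_metric_map "chart_range c" "christoffel A nabla c" "metric_coord A g c" ?W "\<lambda>x. x"
      by (rule coord_metric_map[OF c W C_inf_on_ident[OF W]]) auto
    have ch: "nabla p a Z c = D (a c) (\<lambda>x. Z (chart_inv c x) c) ?x" if "vector_field_on A U Z" for Z
      by (rule nabla_chart[OF U that a cp])
    have "nabla p a (\<lambda>x. curvature A nabla x (X x) (Y x) (Z x)) c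
      = D (a c) (\<lambda>y. Rm (christoffel A nabla c) y (X (chart_inv c y) c) (Y (chart_inv c y) c) (Z (chart_inv c y) c)) ?x"
      unfolding ch[OF R]
    proof (rule D_cong[OF x])
      fix y assume "y \<in> ?W"
      then obtain r where r: "r \<in> fst c" "r \<in> U" "y = snd c r" by auto
      then have "c \<in> charts_at A r" using c by (simp add: charts_at_iff)
      from curvature_chart(2)[OF t[OF r(2)] this]
      show "curvature A nabla (chart_inv c y) (X (chart_inv c y)) (Y (chart_inv c y)) (Z (chart_inv c y)) c
        = Rm (christoffel A nabla c) y (X (chart_inv c y) c) (Y (chart_inv c y) c) (Z (chart_inv c y) c)"
        using r c by simp
    qed
    moreover note Dtri_leibniz[OF tri_Rmh vector_field_onD(2)[OF X U(1) c] vector_field_onD(2)[OF Y U(1) c]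
        vector_field_onD(2)[OF Z U(1) c] x, of "a c"]
    ultimately show "?K X Y Z c = nRm (christoffel A nabla c) ?x (a c) (X p c) (Y p c) (Z p c)"
      using c p by (simp add: curvature_chart(2)[OF _ _ _ cp] n[OF X] n[OF Y] n[OF Z] t[OF U(2)]
          ch[OF X] ch[OF Y] ch[OF Z] Dtri_Rm[OF x])
  qed
  show "nabla_curvature A nabla p a u v w \<in> tangent_space A p"
    "nabla_curvature A nabla p a u v w c = nRm (christoffel A nabla c) ?x (a c) (u c) (v c) (w c)"
    unfolding nabla_curvature_def
    by (rule tensor_value_chart[where K = ?K and k = "nRm (christoffel A nabla c) ?x (a c)", OF cp _ uvw],
        rule K, assumption+)+
qed

lemma nabla_gradient_chart:
  assumes V: "smooth_fun_on A UNIV V" and u: "u \<in> tangent_space A p" and c: "c \<in> charts_at A p"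
  shows "nabla p u (gradient A g V) \<in> tangent_space A p"
    and "nabla p u (gradient A g V) c = pd (u c) (\<lambda>x. gradient A g V (chart_inv c x) c) (snd c p)
      + christoffel A nabla c (snd c p) (u c) (gradient A g V p c)"
  using nabla_chart[OF open_UNIV UNIV_I vector_field_on_gradient[OF V] u c]
    nabla_tangent[OF open_UNIV UNIV_I vector_field_on_gradient[OF V] u] c
  by (simp_all add: Dv_def charts_at_iff)

end

section \<open>Maps into the manifold and fields along them in a chart\<close>

text \<open>On a neighbourhood \<open>W\<close> of a point of \<open>S\<close>, which need not be an interior point, a smooth map
  \<open>\<alpha>\<close> on \<open>S\<close> is described by a smooth map \<open>h\<close> into the range of a chart, and similarly for
  fields of vectors and of trilinear maps along \<open>\<alpha>\<close>. All one-sided derivatives can then be computed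
  from \<open>h\<close>.\<close>

definition chart_rep :: "('q, 'e::euclidean_space) chart set \<Rightarrow> ('q, 'e) chart \<Rightarrow> 'p::euclidean_space set \<Rightarrow>
    'p set \<Rightarrow> ('p \<Rightarrow> 'q) \<Rightarrow> ('p \<Rightarrow> 'e) \<Rightarrow> bool" where
  "chart_rep A c S W \<alpha> h \<longleftrightarrow> c \<in> A \<and> open W \<and> C_inf_on W h \<and> h ` W \<subseteq> chart_range c \<and>
     (\<forall>x\<in>S \<inter> W. \<alpha> x \<in> fst c \<and> snd c (\<alpha> x) = h x)"

definition field_rep :: "('q, 'e::euclidean_space) chart set \<Rightarrow> ('q, 'e) chart \<Rightarrow> 'p::euclidean_space set \<Rightarrow>
    'p set \<Rightarrow> ('p \<Rightarrow> 'q) \<Rightarrow> ('p \<Rightarrow> ('q, 'e) tvec) \<Rightarrow> ('p \<Rightarrow> 'e) \<Rightarrow> bool" where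
  "field_rep A c S W \<alpha> U u \<longleftrightarrow> C_inf_on W u \<and>
     (\<forall>x\<in>S \<inter> W. U x \<in> tangent_space A (\<alpha> x) \<and> U x c = u x)"

definition tensor_rep :: "('q, 'e::euclidean_space) chart set \<Rightarrow> ('q, 'e) chart \<Rightarrow> 'p::euclidean_space set \<Rightarrow>
    'p set \<Rightarrow> ('p \<Rightarrow> 'q) \<Rightarrow> ('p \<Rightarrow> ('q, 'e) tvec \<Rightarrow> ('q, 'e) tvec \<Rightarrow> ('q, 'e) tvec \<Rightarrow> ('q, 'e) tvec) \<Rightarrow>
    ('p \<Rightarrow> 'e \<Rightarrow> 'e \<Rightarrow> 'e \<Rightarrow> 'e) \<Rightarrow> bool" where
  "tensor_rep A c S W \<alpha> K k \<longleftrightarrow> tri_fam W k \<and>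
     (\<forall>x\<in>S \<inter> W. \<forall>u\<in>tangent_space A (\<alpha> x). \<forall>v\<in>tangent_space A (\<alpha> x). \<forall>w\<in>tangent_space A (\<alpha> x).
        K x u v w \<in> tangent_space A (\<alpha> x) \<and> K x u v w c = k x (u c) (v c) (w c))"

lemma chart_repD:
  assumes "chart_rep A c S W \<alpha> h"
  shows "c \<in> A" "open W" "C_inf_on W h" "h ` W \<subseteq> chart_range c"
    and "x \<in> S \<Longrightarrow> x \<in> W \<Longrightarrow> c \<in> charts_at A (\<alpha> x)" "x \<in> S \<Longrightarrow> x \<in> W \<Longrightarrow> snd c (\<alpha> x) = h x"
    "x \<in> S \<Longrightarrow> x \<in> W \<Longrightarrow> \<alpha> x \<in> fst c"
  using assms by (simp_all add: chart_rep_def charts_at_iff)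

lemma field_repD:
  assumes "field_rep A c S W \<alpha> U u"
  shows "C_inf_on W u" "x \<in> S \<Longrightarrow> x \<in> W \<Longrightarrow> U x \<in> tangent_space A (\<alpha> x)" "x \<in> S \<Longrightarrow> x \<in> W \<Longrightarrow> U x c = u x"
  using assms by (simp_all add: field_rep_def)

lemma tensor_repD:
  assumes "tensor_rep A c S W \<alpha> K k"
  shows "tri_fam W k"
    and "x \<in> S \<Longrightarrow> x \<in> W \<Longrightarrow> u \<in> tangent_space A (\<alpha> x) \<Longrightarrow> v \<in> tangent_space A (\<alpha> x) \<Longrightarrow>
      w \<in> tangent_space A (\<alpha> x) \<Longrightarrow> K x u v w \<in> tangent_space A (\<alpha> x)"
    and "x \<in> S \<Longrightarrow> x \<in> W \<Longrightarrow> u \<in> tangent_space A (\<alpha> x) \<Longrightarrow> v \<in> tangent_space A (\<alpha> x) \<Longrightarrow>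
      w \<in> tangent_space A (\<alpha> x) \<Longrightarrow> K x u v w c = k x (u c) (v c) (w c)"
  using assms by (simp_all add: tensor_rep_def)

lemma chart_rep_subset:
  assumes "chart_rep A c S W \<alpha> h" "open W'" "W' \<subseteq> W" "S' \<subseteq> S"
  shows "chart_rep A c S' W' \<alpha> h"
  using assms C_inf_on_subset[of W h W'] unfolding chart_rep_def by (auto simp: subset_iff)

lemma field_rep_subset:
  assumes "field_rep A c S W \<alpha> U u" "W' \<subseteq> W" "S' \<subseteq> S"
  shows "field_rep A c S' W' \<alpha> U u"
  using assms C_inf_on_subset[of W u W'] unfolding field_rep_def by (auto simp: subset_iff)

lemma tri_fam_subset: "tri_fam W k \<Longrightarrow> W' \<subseteq> W \<Longrightarrow> tri_fam W' k"
  unfolding tri_fam_def by (auto intro: C_inf_on_subset[of W])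

lemma tensor_rep_field:
  assumes "tensor_rep A c S W \<alpha> K k" "open W"
    "field_rep A c S W \<alpha> X \<xi>" "field_rep A c S W \<alpha> Y \<eta>" "field_rep A c S W \<alpha> Z \<zeta>"
  shows "field_rep A c S W \<alpha> (\<lambda>x. K x (X x) (Y x) (Z x)) (\<lambda>x. k x (\<xi> x) (\<eta> x) (\<zeta> x))"
  using assms tri_fam_app(1)[OF assms(2) tensor_repD(1)[OF assms(1)] field_repD(1)[OF assms(3)]
      field_repD(1)[OF assms(4)] field_repD(1)[OF assms(5)]]
  by (simp add: field_rep_def tensor_rep_def)

context smooth_manifold begin

text \<open>The extension that witnesses smoothness is restricted to a neighbourhood on which it takes values in
  the range of the chart and on which \<open>f\<close> stays in the domain of the chart.\<close>

lemma chart_rep_exists: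
  assumes f: "smooth_map_on A S f" and x: "x \<in> S" and c: "c \<in> charts_at A (f x)"
  shows "\<exists>W h. x \<in> W \<and> chart_rep A c S W f h"
proof -
  have cA: "c \<in> A" and fx: "f x \<in> fst c" using c by (auto simp: charts_at_iff)
  have "smooth_on {x \<in> S. f x \<in> fst c} (snd c \<circ> f)" and cont: "continuous_on S f"
    using f cA by (auto simp: smooth_map_on_def)
  from this(1) obtain W h where W: "open W" "x \<in> W" "C_inf_on W h"
    "\<forall>y\<in>{x \<in> S. f x \<in> fst c} \<inter> W. h y = (snd c \<circ> f) y"
    by (rule smooth_onE) (use x fx in simp)
  obtain V where V: "open V" "V \<inter> S = f -` fst c \<inter> S"
    using cont open_domain[OF cA] unfolding continuous_on_open_invariant by blast
  have hx: "h x = snd c (f x)" using W(2,4) x fx by simp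
  let ?W = "(W \<inter> h -` chart_range c) \<inter> V"
  have "open ?W"
    by (intro open_Int V(1) continuous_open_preimage[OF C_inf_on_continuous[OF W(3)] W(1) open_range[OF cA]])
  moreover have "x \<in> ?W" using W(2) hx fx V(2) x by auto
  moreover have "y \<in> fst c \<and> snd c y = h z" if "y = f z" "z \<in> S" "z \<in> ?W" for y z
  proof -
    have "f z \<in> fst c" using that(2,3) V(2) by blast
    then show ?thesis using that W(4) by simp
  qed
  ultimately have "x \<in> ?W \<and> chart_rep A c S ?W f h"
    using cA C_inf_on_subset[OF W(3), of ?W] by (auto simp: chart_rep_def)
  then show ?thesis by (intro exI)
qed

lemma field_rep_exists:
  assumes rep: "chart_rep A c I N \<gamma> \<kappa>" and W: "open W" and t: "t \<in> I" "t \<in> N" "t \<in> W"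
    and X: "smooth_field_along A (I \<inter> W) \<gamma> X"
  shows "\<exists>M \<xi>. open M \<and> t \<in> M \<and> M \<subseteq> N \<and> field_rep A c I M \<gamma> X \<xi>"
proof -
  have sX: "smooth_on {s \<in> I \<inter> W. \<gamma> s \<in> fst c} (\<lambda>t. X t c)" and tan: "\<forall>s\<in>I \<inter> W. X s \<in> tangent_space A (\<gamma> s)"
    using X chart_repD(1)[OF rep] by (auto simp: smooth_field_along_def)
  have tm: "t \<in> {s \<in> I \<inter> W. \<gamma> s \<in> fst c}" using t chart_repD(7)[OF rep t(1,2)] by simp
  from sX tm obtain M \<xi> where M: "open M" "t \<in> M" "C_inf_on M \<xi>"
    "\<forall>y\<in>{s \<in> I \<inter> W. \<gamma> s \<in> fst c} \<inter> M. \<xi> y = X y c"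
    by (rule smooth_onE)
  let ?M = "M \<inter> W \<inter> N"
  have "open ?M" "t \<in> ?M" "?M \<subseteq> N" using M W t chart_repD(2)[OF rep] by auto
  moreover have "field_rep A c I ?M \<gamma> X \<xi>"
    unfolding field_rep_def
    using C_inf_on_subset[OF M(3), of ?M] M(4) tan chart_repD(7)[OF rep] by auto
  ultimately show ?thesis by (intro exI conjI)
qed

end

lemma vector_derivative_rep:
  assumes N: "open N" and t: "t \<in> I" "t \<in> N" and u: "u differentiable (at t)"
    and eq: "\<And>s. s \<in> I \<Longrightarrow> s \<in> N \<Longrightarrow> f s = u s" and nt: "at t within I \<noteq> bot"
  shows "vector_derivative f (at t within I) = pd 1 u t"
proof -
  have "vector_derivative f (at t within I) = vector_derivative u (at t within I)"
  proof (rule vector_derivative_cong_eq)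
    show "\<forall>\<^sub>F s in nhds t. s \<in> I \<longrightarrow> f s = u s"
      using eventually_nhds_in_open[OF N t(2)] by eventually_elim (use eq in auto)
  qed (use t in auto)
  also have "\<dots> = pd 1 u t"
    by (rule vector_derivative_within[OF nt has_vector_derivative_at_within[OF has_vector_derivative_pd[OF u]]])
  finally show ?thesis .
qed

context smooth_manifold begin

text \<open>The hypothesis that \<open>t\<close> is not isolated in \<open>I\<close> makes one-sided derivatives unique.\<close>

lemma velocity_rep:
  assumes rep: "chart_rep A c I N \<gamma> \<kappa>" and t: "t \<in> I" "t \<in> N" and nt: "at t within I \<noteq> bot"
  shows "velocity A I \<gamma> t c = pd 1 \<kappa> t" and "velocity A I \<gamma> t \<in> tangent_space A (\<gamma> t)"
proof -
  note r = chart_repD[OF rep]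
  have ct: "c \<in> charts_at A (\<gamma> t)" by (rule r(5)[OF t])
  show vc: "velocity A I \<gamma> t c = pd 1 \<kappa> t"
    using vector_derivative_rep[OF r(2) t C_inf_on_differentiable[OF r(3) t(2)] r(6) nt] ct
    by (simp add: velocity_def)
  show "velocity A I \<gamma> t \<in> tangent_space A (\<gamma> t)"
  proof (rule tangent_spaceI[OF ct])
    fix d assume d: "d \<in> charts_at A (\<gamma> t)"
    then have dA: "d \<in> A" by (simp add: charts_at_iff)
    let ?S = "snd c ` (fst c \<inter> fst d)"
    let ?N = "N \<inter> \<kappa> -` ?S"
    have S: "open ?S" by (rule open_image_overlap[OF r(1) dA])
    have N: "open ?N" by (rule continuous_open_preimage[OF C_inf_on_continuous[OF r(3)] r(2) S])
    have tS: "\<kappa> t \<in> ?S"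
      using imageI[of "\<gamma> t" "fst c \<inter> fst d" "snd c"] r(6)[OF t] ct d by (simp add: charts_at_iff)
    have diff: "transition c d differentiable (at (\<kappa> t))"
      by (rule C_inf_on_differentiable[OF smooth_transition'[OF r(1) dA] tS])
    have "vector_derivative (\<lambda>s. snd d (\<gamma> s)) (at t within I) = pd 1 (\<lambda>s. transition c d (\<kappa> s)) t"
    proof (rule vector_derivative_rep[OF N t(1) _ _ _ nt])
      show "t \<in> ?N" using t tS by simp
      show "(\<lambda>s. transition c d (\<kappa> s)) differentiable at t"
        by (rule differentiable_compose[OF diff C_inf_on_differentiable[OF r(3) t(2)]])
      show "snd d (\<gamma> s) = transition c d (\<kappa> s)" if "s \<in> I" "s \<in> ?N" for s
        using that r(1) r(6)[of s, symmetric] r(7)[of s] by auto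
    qed
    also have "\<dots> = pd (pd 1 \<kappa> t) (transition c d) (\<kappa> t)" by (rule pd_compose[OF r(3) t(2) diff])
    finally show "velocity A I \<gamma> t d = pd (velocity A I \<gamma> t c) (transition c d) (snd c (\<gamma> t))"
      using d vc r(6)[OF t] by (simp add: velocity_def)
  qed (simp add: velocity_def)
qed

end

context affine_connection begin

text \<open>That the covariant derivative is a tangent vector, i.e. transforms correctly: the second
  derivatives of the transition map which appear in the derivative of the transformed coordinates
  cancel against those in the transformation law of the Christoffel symbols.\<close>

lemma cov_deriv_rep:
  assumes rep: "chart_rep A c I N \<gamma> \<kappa>" and X: "field_rep A c I N \<gamma> X \<xi>"
    and t: "t \<in> I" "t \<in> N" and nt: "at t within I \<noteq> bot"
  shows "cov_deriv A nabla I \<gamma> X t c = Dv (christoffel A nabla c) \<kappa> 1 \<xi> t"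
    and "cov_deriv A nabla I \<gamma> X t \<in> tangent_space A (\<gamma> t)"
proof -
  note r = chart_repD[OF rep] and f = field_repD[OF X]
  let ?p = "\<gamma> t" and ?v = "velocity A I \<gamma> t"
  have cp: "c \<in> charts_at A ?p" by (rule r(5)[OF t])
  note vt = velocity_rep(2)[OF rep t nt] and vc = velocity_rep(1)[OF rep t nt]
  have Xc: "vector_derivative (\<lambda>s. X s c) (at t within I) = pd 1 \<xi> t"
    by (rule vector_derivative_rep[OF r(2) t C_inf_on_differentiable[OF f(1) t(2)] f(3) nt])
  let ?E = "coord_field A c (X t c)"
  have covc: "cov_deriv A nabla I \<gamma> X t c = pd 1 \<xi> t + nabla ?p ?v ?E c"
    using cp by (simp add: cov_deriv_def Xc)
  then show "cov_deriv A nabla I \<gamma> X t c = Dv (christoffel A nabla c) \<kappa> 1 \<xi> t"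
    by (simp add: nabla_coord_field[OF cp vt] Dv_def vc r(6)[OF t] f(3)[OF t])
  show "cov_deriv A nabla I \<gamma> X t \<in> tangent_space A ?p"
  proof (rule tangent_spaceI[OF cp])
    fix d assume d: "d \<in> charts_at A ?p"
    then have dA: "d \<in> A" and pd: "?p \<in> fst d" by (auto simp: charts_at_iff)
    have pc: "?p \<in> fst c" by (rule r(7)[OF t])
    let ?S = "snd c ` (fst c \<inter> fst d)"
    let ?N = "N \<inter> \<kappa> -` ?S"
    let ?\<phi> = "transition c d"
    let ?w = "X t c"
    have S: "open ?S" by (rule open_image_overlap[OF r(1) dA])
    have N: "open ?N" by (rule continuous_open_preimage[OF C_inf_on_continuous[OF r(3)] r(2) S])
    have tS: "\<kappa> t \<in> ?S"
      using imageI[of "\<gamma> t" "fst c \<inter> fst d" "snd c"] r(6)[OF t] pc pd by simp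
    have tN: "t \<in> ?N" using t tS by simp
    have \<kappa>N: "C_inf_on ?N \<kappa>" and \<xi>N: "C_inf_on ?N \<xi>"
      using C_inf_on_subset[OF r(3)] C_inf_on_subset[OF f(1)] by auto
    note \<phi>w = C_inf_on_imp_pd[OF smooth_transition'[OF r(1) dA], of ?w]
    have L: "lin_fam ?N (\<lambda>s a. pd a ?\<phi> (\<kappa> s))"
      using lin_fam_pd_transition[OF r(1) dA]
        C_inf_on_compose[OF N S _ \<kappa>N C_inf_on_imp_pd[OF smooth_transition'[OF r(1) dA]]]
      by (auto simp: lin_fam_def)
    have "vector_derivative (\<lambda>s. X s d) (at t within I) = pd 1 (\<lambda>s. pd (\<xi> s) ?\<phi> (\<kappa> s)) t"
    proof (rule vector_derivative_rep[OF N t(1) tN _ _ nt])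
      show "(\<lambda>s. pd (\<xi> s) ?\<phi> (\<kappa> s)) differentiable at t"
        by (rule C_inf_on_differentiable[OF lin_fam_app(1)[OF N L \<xi>N] tN])
      show "X s d = pd (\<xi> s) ?\<phi> (\<kappa> s)" if s: "s \<in> I" "s \<in> ?N" for s
      proof -
        have sN: "s \<in> N" using s by simp
        have "\<gamma> s \<in> fst d"
        proof -
          from s obtain z where "z \<in> fst c" "z \<in> fst d" "\<kappa> s = snd c z" by auto
          then have "\<gamma> s = z" using r(6)[OF s(1) sN] r(7)[OF s(1) sN] r(1) by (metis chart_inv_left)
          then show ?thesis using \<open>z \<in> fst d\<close> by simp
        qed
        then have "d \<in> charts_at A (\<gamma> s)" using dA by (simp add: charts_at_iff)
        from tangent_spaceD(2)[OF f(2)[OF s(1) sN] r(5)[OF s(1) sN] this]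
        show ?thesis by (simp add: f(3)[OF s(1) sN] r(6)[OF s(1) sN])
      qed
    qed
    also have "\<dots> = pd 1 (\<lambda>s. pd ?w ?\<phi> (\<kappa> s)) t + pd (pd 1 \<xi> t) ?\<phi> (\<kappa> t)"
      using lin_fam_app(2)[OF N L \<xi>N tN, of 1] f(3)[OF t] by simp
    also have "pd 1 (\<lambda>s. pd ?w ?\<phi> (\<kappa> s)) t = pd (?v c) (pd ?w ?\<phi>) (\<kappa> t)"
      unfolding vc by (rule pd_compose[OF r(3) t(2) C_inf_on_differentiable[OF \<phi>w tS]])
    finally have 1: "vector_derivative (\<lambda>s. X s d) (at t within I)
      = pd (?v c) (pd ?w ?\<phi>) (\<kappa> t) + pd (pd 1 \<xi> t) ?\<phi> (\<kappa> t)" .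
    let ?S' = "snd d ` (fst d \<inter> fst c)"
    have S': "open ?S'" "snd d ?p \<in> ?S'" using open_image_overlap[OF dA r(1)] pc pd by auto
    have "pd (?v d) (\<lambda>y. ?E (chart_inv d y) d) (snd d ?p) = pd (?v d) (\<lambda>y. pd ?w ?\<phi> (transition d c y)) (snd d ?p)"
    proof (rule pd_cong[OF S'])
      fix y assume "y \<in> ?S'"
      then obtain z where z: "z \<in> fst d" "z \<in> fst c" "y = snd d z" by auto
      then have "c \<in> charts_at A z" "d \<in> charts_at A z" using r(1) dA by (auto simp: charts_at_iff)
      from coord_field_eq[OF this] show "?E (chart_inv d y) d = pd ?w ?\<phi> (transition d c y)"
        using z dA by simp
    qed
    also have "\<dots> = pd (pd (?v d) (transition d c) (snd d ?p)) (pd ?w ?\<phi>) (transition d c (snd d ?p))"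
      using C_inf_on_differentiable[OF \<phi>w tS] r(6)[OF t] dA pd
      by (intro pd_compose[OF smooth_transition'[OF dA r(1)] S'(2)]) simp
    also have "\<dots> = pd (?v c) (pd ?w ?\<phi>) (\<kappa> t)"
      using tangent_spaceD(2)[OF vt d cp] r(6)[OF t] dA pd by simp
    finally have 2: "pd (?v d) (\<lambda>y. ?E (chart_inv d y) d) (snd d ?p) = pd (?v c) (pd ?w ?\<phi>) (\<kappa> t)" .
    note nt' = nabla_tangent[OF open_domain[OF r(1)] pc vector_field_on_coord_field[OF r(1)] vt]
    have Ep: "?E ?p = X t" by (rule coord_field_tangent_vector[OF f(2)[OF t] cp])
    have "nabla ?p ?v ?E d = pd (?v d) (\<lambda>y. ?E (chart_inv d y) d) (snd d ?p)
        + christoffel A nabla d (snd d ?p) (?v d) (X t d)"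
      using nabla_chart[OF open_domain[OF r(1)] pc vector_field_on_coord_field[OF r(1)] vt d, of ?w] dA pd
      by (simp add: Dv_def Ep)
    then have 3: "nabla ?p ?v (coord_field A d (X t d)) d = nabla ?p ?v ?E d - pd (?v c) (pd ?w ?\<phi>) (\<kappa> t)"
      by (simp add: 2 nabla_coord_field[OF d vt])
    have "cov_deriv A nabla I \<gamma> X t d = pd (pd 1 \<xi> t) ?\<phi> (\<kappa> t) + nabla ?p ?v ?E d"
      using d by (simp add: cov_deriv_def 1 3)
    also have "nabla ?p ?v ?E d = pd (nabla ?p ?v ?E c) ?\<phi> (\<kappa> t)"
      using tangent_spaceD(2)[OF nt' cp d] r(6)[OF t] by simp
    also have "pd (pd 1 \<xi> t) ?\<phi> (\<kappa> t) + pd (nabla ?p ?v ?E c) ?\<phi> (\<kappa> t)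
        = pd (cov_deriv A nabla I \<gamma> X t c) ?\<phi> (\<kappa> t)"
      unfolding covc
      by (rule linear_add[OF C_inf_on_linear_pd[OF smooth_transition'[OF r(1) dA] tS], symmetric])
    finally show "cov_deriv A nabla I \<gamma> X t d = pd (cov_deriv A nabla I \<gamma> X t c) ?\<phi> (snd c ?p)"
      using r(6)[OF t] by simp
  qed (simp add: cov_deriv_def)
qed

end

context levi_civita begin

lemma coord_map_rep:
  "chart_rep A c S W \<alpha> h \<Longrightarrow> coord_metric_map (chart_range c) (christoffel A nabla c) (metric_coord A g c) W h"
  by (rule coord_metric_map) (rule chart_repD; assumption)+

lemma field_rep_cov_deriv:
  assumes rep: "chart_rep A c I N \<gamma> \<kappa>" and X: "field_rep A c I N \<gamma> X \<xi>"
    and nt: "\<And>t. t \<in> I \<Longrightarrow> at t within I \<noteq> bot"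
  shows "field_rep A c I N \<gamma> (cov_deriv A nabla I \<gamma> X) (Dv (christoffel A nabla c) \<kappa> 1 \<xi>)"
proof -
  interpret coord_metric_map "chart_range c" "christoffel A nabla c" "metric_coord A g c" N \<kappa>
    by (rule coord_map_rep[OF rep])
  show ?thesis
    unfolding field_rep_def
    using smooth_D[OF field_repD(1)[OF X]] cov_deriv_rep[OF rep X _ _ nt] by simp
qed

lemma field_rep_velocity:
  assumes rep: "chart_rep A c I N \<gamma> \<kappa>" and nt: "\<And>t. t \<in> I \<Longrightarrow> at t within I \<noteq> bot"
  shows "field_rep A c I N \<gamma> (velocity A I \<gamma>) (pd 1 \<kappa>)"
  unfolding field_rep_def
  using C_inf_on_imp_pd[OF chart_repD(3)[OF rep]] velocity_rep[OF rep _ _ nt] by simp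

lemma tensor_rep_curvature:
  assumes rep: "chart_rep A c S W \<alpha> h"
  shows "tensor_rep A c S W \<alpha> (\<lambda>x. curvature A nabla (\<alpha> x)) (\<lambda>x. Rm (christoffel A nabla c) (h x))"
proof -
  interpret coord_metric_map "chart_range c" "christoffel A nabla c" "metric_coord A g c" W h
    by (rule coord_map_rep[OF rep])
  show ?thesis
    unfolding tensor_rep_def
    using tri_Rmh curvature_chart chart_repD(5,6)[OF rep] by simp
qed

text \<open>These fields are the extensions of tangent vectors that the definition of \<open>cov_deriv_tensor\<close>
  asks for.\<close>

lemma smooth_field_along_coord_field:
  assumes rep: "chart_rep A c I N \<gamma> \<kappa>"
  shows "smooth_field_along A (I \<inter> N) \<gamma> (\<lambda>s. coord_field A c a (\<gamma> s))"
  unfolding smooth_field_along_def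
proof (intro conjI ballI)
  note r = chart_repD[OF rep]
  show "coord_field A c a (\<gamma> s) \<in> tangent_space A (\<gamma> s)" if "s \<in> I \<inter> N" for s
    using that r(5) coord_field_tangent by simp
  fix d assume d: "d \<in> A"
  let ?S = "snd c ` (fst c \<inter> fst d)"
  let ?N = "N \<inter> \<kappa> -` ?S"
  have S: "open ?S" by (rule open_image_overlap[OF r(1) d])
  have N: "open ?N" by (rule continuous_open_preimage[OF C_inf_on_continuous[OF r(3)] r(2) S])
  have sm: "C_inf_on ?N (\<lambda>s. pd a (transition c d) (\<kappa> s))"
    by (rule smooth_coordinate_change[OF r(1) d N])
      (auto intro: C_inf_on_subset[OF r(3)])
  show "smooth_on {t \<in> I \<inter> N. \<gamma> t \<in> fst d} (\<lambda>t. coord_field A c a (\<gamma> t) d)"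
  proof (rule smooth_onI, intro exI conjI)
    fix t assume "t \<in> {t \<in> I \<inter> N. \<gamma> t \<in> fst d}"
    then show "t \<in> ?N"
      using imageI[of "\<gamma> t" "fst c \<inter> fst d" "snd c"] r(6)[of t] r(7)[of t] by simp
    show "\<forall>y\<in>{t \<in> I \<inter> N. \<gamma> t \<in> fst d} \<inter> ?N. pd a (transition c d) (\<kappa> y) = coord_field A c a (\<gamma> y) d"
    proof
      fix y assume y: "y \<in> {t \<in> I \<inter> N. \<gamma> t \<in> fst d} \<inter> ?N"
      then have "d \<in> charts_at A (\<gamma> y)" using d by (simp add: charts_at_iff)
      then show "pd a (transition c d) (\<kappa> y) = coord_field A c a (\<gamma> y) d"
        using y coord_field_eq[of c "\<gamma> y" d a] r(5)[of y] r(6)[of y] by simp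
    qed
  qed (rule N sm)+
qed

text \<open>The defining expression is computed by the Leibniz rule for arbitrary extensions of the three
  vectors; the result depends on their values at \<open>t\<close> only. Extensions with constant coordinates
  show that the definite description denotes.\<close>

lemma tensor_rep_cov_deriv:
  assumes rep: "chart_rep A c I N \<gamma> \<kappa>" and K: "tensor_rep A c I N \<gamma> K k"
    and nt: "\<And>t. t \<in> I \<Longrightarrow> at t within I \<noteq> bot"
  shows "tensor_rep A c I N \<gamma> (cov_deriv_tensor A nabla I \<gamma> K) (Dtri (christoffel A nabla c) \<kappa> 1 k)"
proof -
  note r = chart_repD[OF rep]
  let ?\<Gamma> = "christoffel A nabla c"
  interpret N: coord_metric_map "chart_range c" ?\<Gamma> "metric_coord A g c" N \<kappa>
    by (rule coord_map_rep[OF rep])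
  let ?D = "cov_deriv A nabla I \<gamma>"
  have main: "cov_deriv_tensor A nabla I \<gamma> K t u v w \<in> tangent_space A (\<gamma> t) \<and>
      cov_deriv_tensor A nabla I \<gamma> K t u v w c = Dtri ?\<Gamma> \<kappa> 1 k t (u c) (v c) (w c)"
    if t: "t \<in> I" "t \<in> N" and uvw: "u \<in> tangent_space A (\<gamma> t)" "v \<in> tangent_space A (\<gamma> t)"
      "w \<in> tangent_space A (\<gamma> t)" for t u v w
  proof -
    have ct: "c \<in> charts_at A (\<gamma> t)" by (rule r(5)[OF t])
    let ?K = "\<lambda>X Y Z. ?D (\<lambda>s. K s (X s) (Y s) (Z s)) t
            - K t (?D X t) v w - K t u (?D Y t) w - K t u v (?D Z t)"
    have val: "?K X Y Z \<in> tangent_space A (\<gamma> t) \<and> ?K X Y Z c = Dtri ?\<Gamma> \<kappa> 1 k t (u c) (v c) (w c)"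
      if W: "open W" "t \<in> W" and X: "smooth_field_along A (I \<inter> W) \<gamma> X"
        and Y: "smooth_field_along A (I \<inter> W) \<gamma> Y" and Z: "smooth_field_along A (I \<inter> W) \<gamma> Z"
        and eq: "X t = u" "Y t = v" "Z t = w" for W X Y Z
    proof -
      obtain M1 \<xi> where M1: "open M1" "t \<in> M1" "M1 \<subseteq> N" "field_rep A c I M1 \<gamma> X \<xi>"
        using field_rep_exists[OF rep W(1) t W(2) X] by (elim exE conjE)
      obtain M2 \<eta> where M2: "open M2" "t \<in> M2" "M2 \<subseteq> N" "field_rep A c I M2 \<gamma> Y \<eta>"
        using field_rep_exists[OF rep W(1) t W(2) Y] by (elim exE conjE)
      obtain M3 \<zeta> where M3: "open M3" "t \<in> M3" "M3 \<subseteq> N" "field_rep A c I M3 \<gamma> Z \<zeta>"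
        using field_rep_exists[OF rep W(1) t W(2) Z] by (elim exE conjE)
      let ?M = "M1 \<inter> M2 \<inter> M3"
      have M: "open ?M" "t \<in> ?M" "?M \<subseteq> N" using M1 M2 M3 by auto
      have repM: "chart_rep A c I ?M \<gamma> \<kappa>" by (rule chart_rep_subset[OF rep M(1,3)]) simp
      have fX: "field_rep A c I ?M \<gamma> X \<xi>" by (rule field_rep_subset[OF M1(4)]) auto
      have fY: "field_rep A c I ?M \<gamma> Y \<eta>" by (rule field_rep_subset[OF M2(4)]) auto
      have fZ: "field_rep A c I ?M \<gamma> Z \<zeta>" by (rule field_rep_subset[OF M3(4)]) auto
      have KM: "tensor_rep A c I ?M \<gamma> K k"
        using K tri_fam_subset[OF tensor_repD(1)[OF K] M(3)] M(3) unfolding tensor_rep_def by auto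
      interpret M: coord_metric_map "chart_range c" ?\<Gamma> "metric_coord A g c" ?M \<kappa>
        by (rule coord_map_rep[OF repM])
      note fK = tensor_rep_field[OF KM M(1) fX fY fZ]
      note cX = cov_deriv_rep[OF repM fX t(1) M(2) nt[OF t(1)]]
      note cY = cov_deriv_rep[OF repM fY t(1) M(2) nt[OF t(1)]]
      note cZ = cov_deriv_rep[OF repM fZ t(1) M(2) nt[OF t(1)]]
      note cK = cov_deriv_rep[OF repM fK t(1) M(2) nt[OF t(1)]]
      note KT = tensor_repD(2,3)[OF K t]
      have e: "\<xi> t = u c" "\<eta> t = v c" "\<zeta> t = w c"
        using field_repD(3)[OF fX t(1) M(2)] field_repD(3)[OF fY t(1) M(2)] field_repD(3)[OF fZ t(1) M(2)] eq
        by simp_all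
      have "?K X Y Z \<in> tangent_space A (\<gamma> t)"
        by (intro tangent_space_diff cK(2) KT(1) cX(2) cY(2) cZ(2) uvw)
      moreover have "?K X Y Z c = Dtri ?\<Gamma> \<kappa> 1 k t (u c) (v c) (w c)"
        using M.Dtri_leibniz[OF tensor_repD(1)[OF KM] field_repD(1)[OF fX] field_repD(1)[OF fY]
            field_repD(1)[OF fZ] M(2), of 1]
        by (simp add: cK(1) KT(2) cX cY cZ uvw e)
      ultimately show ?thesis ..
    qed
    let ?E = "\<lambda>u s. coord_field A c (u c) (\<gamma> s)"
    have E: "smooth_field_along A (I \<inter> N) \<gamma> (\<lambda>s. coord_field A c a (\<gamma> s))" for a
      by (rule smooth_field_along_coord_field[OF rep])
    have Et: "?E u t = u" if "u \<in> tangent_space A (\<gamma> t)" for u by (rule coord_field_tangent_vector[OF that ct])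
    let ?r = "?K (?E u) (?E v) (?E w)"
    have rv: "?r \<in> tangent_space A (\<gamma> t) \<and> ?r c = Dtri ?\<Gamma> \<kappa> 1 k t (u c) (v c) (w c)"
      by (rule val[of N "?E u" "?E v" "?E w", OF r(2) t(2) E E E]) (simp_all only: Et uvw)
    have "cov_deriv_tensor A nabla I \<gamma> K t u v w = ?r"
      unfolding cov_deriv_tensor_def Let_def
    proof (rule the_equality)
      show "\<forall>W X Y Z. open W \<and> t \<in> W \<and> smooth_field_along A (I \<inter> W) \<gamma> X \<and>
        smooth_field_along A (I \<inter> W) \<gamma> Y \<and> smooth_field_along A (I \<inter> W) \<gamma> Z \<and>
        X t = u \<and> Y t = v \<and> Z t = w \<longrightarrow> ?r = ?K X Y Z"
      proof (intro allI impI, elim conjE)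
        fix W X Y Z
        assume "open W" "t \<in> W" "smooth_field_along A (I \<inter> W) \<gamma> X" "smooth_field_along A (I \<inter> W) \<gamma> Y"
          "smooth_field_along A (I \<inter> W) \<gamma> Z" "X t = u" "Y t = v" "Z t = w"
        from val[OF this] rv show "?r = ?K X Y Z" by (intro tangent_space_eqI[OF _ _ ct]) simp_all
      qed
    next
      fix s
      assume s: "\<forall>W X Y Z. open W \<and> t \<in> W \<and> smooth_field_along A (I \<inter> W) \<gamma> X \<and>
        smooth_field_along A (I \<inter> W) \<gamma> Y \<and> smooth_field_along A (I \<inter> W) \<gamma> Z \<and>
        X t = u \<and> Y t = v \<and> Z t = w \<longrightarrow> s = ?K X Y Z"
      show "s = ?r"
        by (rule s[rule_format, of N]) (intro conjI r(2) t(2) E Et uvw)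
    qed
    with rv show ?thesis by (simp only:)
  qed
  then show ?thesis
    unfolding tensor_rep_def using N.tri_fam_Dtri[OF tensor_repD(1)[OF K]] by simp
qed

end

section \<open>Restriction to coordinate lines\<close>

text \<open>Along the lines \<open>\<tau> \<mapsto> z + \<tau> e\<close> in the parameter space, a family of curves becomes a single
  curve, and its ordinary derivatives are partial derivatives of the family.\<close>

lemma C_inf_on_line: "C_inf_on N (\<lambda>\<tau>. z + \<tau> *\<^sub>R e)" if "open N"
  by (intro C_inf_on_add C_inf_on_scaleR that C_inf_on_const C_inf_on_ident)

lemma pd_line: "pd 1 (\<lambda>\<tau>. z + \<tau> *\<^sub>R e) \<tau> = e"
proof -
  have "((\<lambda>\<tau>. z + \<tau> *\<^sub>R e) has_derivative (\<lambda>s. s *\<^sub>R e)) (at \<tau>)"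
    by (auto intro!: derivative_eq_intros)
  from pd_eqI[OF this] show ?thesis by simp
qed

lemma open_line_vimage:
  fixes z :: "'a::euclidean_space"
  shows "open W \<Longrightarrow> open ((\<lambda>\<tau>::real. z + \<tau> *\<^sub>R e) -` W)"
  by (rule open_vimage) (auto intro!: continuous_intros)

lemma C_inf_on_compose_line:
  "open W \<Longrightarrow> C_inf_on W F \<Longrightarrow> C_inf_on ((\<lambda>\<tau>. z + \<tau> *\<^sub>R e) -` W) (\<lambda>\<tau>. F (z + \<tau> *\<^sub>R e))"
  by (rule C_inf_on_compose[OF open_line_vimage _ _ C_inf_on_line[OF open_line_vimage]]) auto

lemma pd_compose_line:
  fixes F :: "'a::euclidean_space \<Rightarrow> 'b::euclidean_space"
  shows "F differentiable (at (z + \<tau> *\<^sub>R e)) \<Longrightarrow> pd 1 (\<lambda>\<tau>. F (z + \<tau> *\<^sub>R e)) \<tau> = pd e F (z + \<tau> *\<^sub>R e)"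
  using pd_compose[OF C_inf_on_line[OF open_UNIV], of \<tau> F z e 1] by (simp add: pd_line)

lemma Dv_compose_line:
  "C_inf_on W h \<Longrightarrow> C_inf_on W u \<Longrightarrow> z + \<tau> *\<^sub>R e \<in> W \<Longrightarrow>
    Dv \<Gamma> (\<lambda>\<tau>. h (z + \<tau> *\<^sub>R e)) 1 (\<lambda>\<tau>. u (z + \<tau> *\<^sub>R e)) \<tau> = Dv \<Gamma> h e u (z + \<tau> *\<^sub>R e)"
  unfolding Dv_def by (simp only: pd_compose_line[OF C_inf_on_differentiable])

lemma Dtri_compose_line:
  "C_inf_on W h \<Longrightarrow> (\<And>u v w. C_inf_on W (\<lambda>y. S y u v w)) \<Longrightarrow> z + \<tau> *\<^sub>R e \<in> W \<Longrightarrow>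
    Dtri \<Gamma> (\<lambda>\<tau>. h (z + \<tau> *\<^sub>R e)) 1 (\<lambda>\<tau>. S (z + \<tau> *\<^sub>R e)) \<tau> = Dtri \<Gamma> h e S (z + \<tau> *\<^sub>R e)"
  unfolding Dtri_def
  by (intro ext) (subst pd_compose_line[OF C_inf_on_differentiable[where S = W]];
      simp add: pd_compose_line[OF C_inf_on_differentiable[of W h]])

text \<open>Here \<open>F\<close> agrees with a smooth function \<open>h\<close> on the relevant part of the line only.\<close>

lemma has_real_derivative_line:
  fixes h :: "'a::euclidean_space \<Rightarrow> real"
  assumes W: "open W" and h: "C_inf_on W h" and J: "open J" "\<rho> \<in> J" and \<rho>: "z + \<rho> *\<^sub>R e \<in> W"
    and eq: "\<And>\<sigma>. \<sigma> \<in> J \<Longrightarrow> z + \<sigma> *\<^sub>R e \<in> W \<Longrightarrow> h (z + \<sigma> *\<^sub>R e) = F (z + \<sigma> *\<^sub>R e)"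
  shows "((\<lambda>\<sigma>. F (z + \<sigma> *\<^sub>R e)) has_real_derivative pd e h (z + \<rho> *\<^sub>R e)) (at \<rho>)"
proof -
  let ?N = "((\<lambda>\<sigma>. z + \<sigma> *\<^sub>R e) -` W) \<inter> J"
  have "(\<lambda>\<sigma>. h (z + \<sigma> *\<^sub>R e)) differentiable at \<rho>"
    by (rule C_inf_on_differentiable[OF C_inf_on_compose_line[OF W h]]) (use \<rho> in simp)
  from has_vector_derivative_pd[OF this]
  have "((\<lambda>\<sigma>. h (z + \<sigma> *\<^sub>R e)) has_vector_derivative pd e h (z + \<rho> *\<^sub>R e)) (at \<rho>)"
    by (simp only: pd_compose_line[OF C_inf_on_differentiable[OF h \<rho>]])
  then have "((\<lambda>\<sigma>. F (z + \<sigma> *\<^sub>R e)) has_vector_derivative pd e h (z + \<rho> *\<^sub>R e)) (at \<rho>)"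
  proof (rule has_vector_derivative_transform_within_open)
    show "open ?N" by (intro open_Int open_line_vimage W J)
  qed (use \<rho> J eq in auto)
  then show ?thesis by (simp only: has_real_derivative_iff_has_vector_derivative)
qed

lemma pd_line_cong:
  assumes W: "open W" and J: "open J" "\<rho> \<in> J" and \<rho>: "z + \<rho> *\<^sub>R e \<in> W"
    and F: "C_inf_on W F" "C_inf_on W F'"
    and eq: "\<And>\<sigma>. \<sigma> \<in> J \<Longrightarrow> z + \<sigma> *\<^sub>R e \<in> W \<Longrightarrow> F (z + \<sigma> *\<^sub>R e) = F' (z + \<sigma> *\<^sub>R e)"
  shows "pd e F (z + \<rho> *\<^sub>R e) = pd e F' (z + \<rho> *\<^sub>R e)"
proof -
  have "pd 1 (\<lambda>\<sigma>. F (z + \<sigma> *\<^sub>R e)) \<rho> = pd 1 (\<lambda>\<sigma>. F' (z + \<sigma> *\<^sub>R e)) \<rho>"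
    by (rule pd_cong[OF open_Int[OF open_line_vimage[OF W] J(1)]]) (use \<rho> J(2) eq in auto)
  then show ?thesis
    by (simp only: pd_compose_line[OF C_inf_on_differentiable[OF F(1) \<rho>]]
        pd_compose_line[OF C_inf_on_differentiable[OF F(2) \<rho>]])
qed

lemma chart_rep_line:
  assumes "chart_rep A c S W \<alpha> h" "\<And>\<tau>. \<tau> \<in> I \<Longrightarrow> z + \<tau> *\<^sub>R e \<in> S"
  shows "chart_rep A c I ((\<lambda>\<tau>. z + \<tau> *\<^sub>R e) -` W) (\<lambda>\<tau>. \<alpha> (z + \<tau> *\<^sub>R e)) (\<lambda>\<tau>. h (z + \<tau> *\<^sub>R e))"
  unfolding chart_rep_def
  using chart_repD[OF assms(1)] assms(2)
  by (auto intro: open_line_vimage C_inf_on_compose_line)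

lemma field_rep_line:
  assumes "field_rep A c S W \<alpha> U u" "open W" "\<And>\<tau>. \<tau> \<in> I \<Longrightarrow> z + \<tau> *\<^sub>R e \<in> S"
  shows "field_rep A c I ((\<lambda>\<tau>. z + \<tau> *\<^sub>R e) -` W) (\<lambda>\<tau>. \<alpha> (z + \<tau> *\<^sub>R e)) (\<lambda>\<tau>. U (z + \<tau> *\<^sub>R e)) (\<lambda>\<tau>. u (z + \<tau> *\<^sub>R e))"
  unfolding field_rep_def
  using field_repD[OF assms(1)] assms(3)
  by (auto intro: C_inf_on_compose_line[OF assms(2)])

lemma at_within_Icc_ne_bot: "a < b \<Longrightarrow> t \<in> {a..b} \<Longrightarrow> at t within {a..b} \<noteq> bot" for t :: real
  using islimpt_Icc[of a b t] by (simp only: trivial_limit_within not_not)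

lemma at_within_Ioo_ne_bot: "t \<in> {a<..<b} \<Longrightarrow> at t within {a<..<b} \<noteq> bot" for t :: real
  by (simp only: at_within_open[OF _ open_greaterThanLessThan] trivial_limit_at not_False_eq_True)

lemma smooth_on_continuous:
  assumes "smooth_on S f"
  shows "continuous_on S f"
  unfolding continuous_on_eq_continuous_within
proof
  fix x assume x: "x \<in> S"
  from assms x obtain W h where W: "open W" "x \<in> W" "C_inf_on W h" "\<forall>y\<in>S \<inter> W. h y = f y"
    by (rule smooth_onE)
  have "continuous (at x) h"
    using C_inf_on_continuous[OF W(3)] W(1,2) by (simp add: continuous_on_eq_continuous_at)
  then have "continuous (at x within S) h" by (rule continuous_at_imp_continuous_within)
  moreover have "\<forall>\<^sub>F y in at x within S. h y = f y"
    using W(1,2,4) by (auto simp: eventually_at_filter intro: eventually_mono[OF eventually_nhds_in_open[of W x]])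
  ultimately show "continuous (at x within S) f"
    using W(2,4) x by (simp add: continuous_within Lim_transform_eventually)
qed

context levi_civita begin

lemma line_velocity:
  assumes rep: "chart_rep A c S W \<alpha> h" and I: "\<And>\<tau>. \<tau> \<in> I \<Longrightarrow> z + \<tau> *\<^sub>R e \<in> S"
    and t: "t \<in> I" "z + t *\<^sub>R e \<in> W" and nt: "at t within I \<noteq> bot"
  shows "velocity A I (\<lambda>\<tau>. \<alpha> (z + \<tau> *\<^sub>R e)) t \<in> tangent_space A (\<alpha> (z + t *\<^sub>R e)) \<and>
    velocity A I (\<lambda>\<tau>. \<alpha> (z + \<tau> *\<^sub>R e)) t c = pd e h (z + t *\<^sub>R e)"
  using velocity_rep[OF chart_rep_line[OF rep I] t(1) _ nt] t(2)
    pd_compose_line[OF C_inf_on_differentiable[OF chart_repD(3)[OF rep] t(2)]]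
  by simp

lemma line_cov_deriv:
  assumes rep: "chart_rep A c S W \<alpha> h" and U: "field_rep A c S W \<alpha> U u"
    and I: "\<And>\<tau>. \<tau> \<in> I \<Longrightarrow> z + \<tau> *\<^sub>R e \<in> S"
    and t: "t \<in> I" "z + t *\<^sub>R e \<in> W" and nt: "at t within I \<noteq> bot"
  shows "cov_deriv A nabla I (\<lambda>\<tau>. \<alpha> (z + \<tau> *\<^sub>R e)) (\<lambda>\<tau>. U (z + \<tau> *\<^sub>R e)) t \<in> tangent_space A (\<alpha> (z + t *\<^sub>R e)) \<and>
    cov_deriv A nabla I (\<lambda>\<tau>. \<alpha> (z + \<tau> *\<^sub>R e)) (\<lambda>\<tau>. U (z + \<tau> *\<^sub>R e)) t c
      = Dv (christoffel A nabla c) h e u (z + t *\<^sub>R e)"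
  using cov_deriv_rep[OF chart_rep_line[OF rep I] field_rep_line[OF U chart_repD(2)[OF rep] I] t(1) _ nt] t(2)
    Dv_compose_line[OF chart_repD(3)[OF rep] field_repD(1)[OF U] t(2)]
  by simp

end

section \<open>One smooth strip of a two-parameter variation\<close>

type_synonym param = "real \<times> real \<times> real"

abbreviation dr :: param where "dr \<equiv> (1, 0, 0)"
abbreviation ds :: param where "ds \<equiv> (0, 1, 0)"
abbreviation dt :: param where "dt \<equiv> (0, 0, 1)"

text \<open>All derivatives in the direction of time are taken within \<open>{a..b}\<close>, so at the ends of the strip they
  are one-sided and see this strip only.\<close>

locale variation_strip = levi_civita A g nabla
  for A :: "('q::{t2_space, second_countable_topology}, 'e::euclidean_space) chart set"
    and g :: "'q \<Rightarrow> ('q, 'e) tvec \<Rightarrow> ('q, 'e) tvec \<Rightarrow> real"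
    and nabla :: "('q, 'e) conn" +
  fixes V :: "'q \<Rightarrow> real" and er es :: real and \<alpha> :: "real \<Rightarrow> real \<Rightarrow> real \<Rightarrow> 'q" and a b :: real
  assumes V: "smooth_fun_on A UNIV V" and er: "0 < er" and es: "0 < es" and ab: "a < b"
    and strip: "smooth_strip A er es {a..b} \<alpha>"
begin

definition \<Sigma> :: "param set" where "\<Sigma> = {-er<..<er} \<times> {-es<..<es} \<times> {a..b}"

definition pos :: "param \<Rightarrow> 'q" where "pos = (\<lambda>(r, s, t). \<alpha> r s t)"

text \<open>The three velocities of the variation, which are fields along \<open>pos\<close>; \<open>vel_r\<close> and \<open>vel_s\<close> restrict
  to \<open>X\<close> and \<open>Y\<close>.\<close>

definition vel_t :: "param \<Rightarrow> ('q, 'e) tvec" where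
  "vel_t = (\<lambda>(r, s, t). velocity A {a..b} (\<alpha> r s) t)"

definition vel_s :: "param \<Rightarrow> ('q, 'e) tvec" where
  "vel_s = (\<lambda>(r, s, t). velocity A {-es<..<es} (\<lambda>s. \<alpha> r s t) s)"

definition vel_r :: "param \<Rightarrow> ('q, 'e) tvec" where
  "vel_r = (\<lambda>(r, s, t). velocity A {-er<..<er} (\<lambda>r. \<alpha> r s t) r)"

definition cov_t :: "(param \<Rightarrow> ('q, 'e) tvec) \<Rightarrow> param \<Rightarrow> ('q, 'e) tvec" where
  "cov_t U = (\<lambda>(r, s, t). cov_deriv A nabla {a..b} (\<alpha> r s) (\<lambda>t. U (r, s, t)) t)"

abbreviation "rep c W h \<equiv> chart_rep A c \<Sigma> W pos h"
abbreviation "frep c W U u \<equiv> field_rep A c \<Sigma> W pos U u"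

lemma rep_exists: "x \<in> \<Sigma> \<Longrightarrow> c \<in> charts_at A (pos x) \<Longrightarrow> \<exists>W h. x \<in> W \<and> rep c W h"
  by (rule chart_rep_exists) (use strip in \<open>simp_all add: smooth_strip_def \<Sigma>_def pos_def\<close>)

lemma frep_vel_t: assumes rep: "rep c W h" shows "frep c W vel_t (pd dt h)"
  unfolding field_rep_def
proof (intro conjI ballI)
  fix x assume "x \<in> \<Sigma> \<inter> W"
  then obtain r s t where x: "x = (r, s, t)" "(r, s, t) \<in> \<Sigma>" "(r, s, t) \<in> W" by (cases x) auto
  have "velocity A {a..b} (\<lambda>\<tau>. pos ((r, s, 0) + \<tau> *\<^sub>R dt)) t \<in> tangent_space A (pos ((r, s, 0) + t *\<^sub>R dt)) \<and>
    velocity A {a..b} (\<lambda>\<tau>. pos ((r, s, 0) + \<tau> *\<^sub>R dt)) t c = pd dt h ((r, s, 0) + t *\<^sub>R dt)"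
    by (rule line_velocity[OF rep]) (use x at_within_Icc_ne_bot[OF ab] in \<open>auto simp: \<Sigma>_def\<close>)
  then show "vel_t x \<in> tangent_space A (pos x)" "vel_t x c = pd dt h x" by (simp_all add: x vel_t_def pos_def)
qed (rule C_inf_on_imp_pd[OF chart_repD(3)[OF rep]])

lemma frep_vel_s: assumes rep: "rep c W h" shows "frep c W vel_s (pd ds h)"
  unfolding field_rep_def
proof (intro conjI ballI)
  fix x assume "x \<in> \<Sigma> \<inter> W"
  then obtain r s t where x: "x = (r, s, t)" "(r, s, t) \<in> \<Sigma>" "(r, s, t) \<in> W" by (cases x) auto
  have "velocity A {-es<..<es} (\<lambda>\<tau>. pos ((r, 0, t) + \<tau> *\<^sub>R ds)) s \<in> tangent_space A (pos ((r, 0, t) + s *\<^sub>R ds)) \<and>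
    velocity A {-es<..<es} (\<lambda>\<tau>. pos ((r, 0, t) + \<tau> *\<^sub>R ds)) s c = pd ds h ((r, 0, t) + s *\<^sub>R ds)"
    by (rule line_velocity[OF rep]) (use x at_within_Ioo_ne_bot in \<open>auto simp: \<Sigma>_def\<close>)
  then show "vel_s x \<in> tangent_space A (pos x)" "vel_s x c = pd ds h x" by (simp_all add: x vel_s_def pos_def)
qed (rule C_inf_on_imp_pd[OF chart_repD(3)[OF rep]])

lemma frep_vel_r: assumes rep: "rep c W h" shows "frep c W vel_r (pd dr h)"
  unfolding field_rep_def
proof (intro conjI ballI)
  fix x assume "x \<in> \<Sigma> \<inter> W"
  then obtain r s t where x: "x = (r, s, t)" "(r, s, t) \<in> \<Sigma>" "(r, s, t) \<in> W" by (cases x) auto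
  have "velocity A {-er<..<er} (\<lambda>\<tau>. pos ((0, s, t) + \<tau> *\<^sub>R dr)) r \<in> tangent_space A (pos ((0, s, t) + r *\<^sub>R dr)) \<and>
    velocity A {-er<..<er} (\<lambda>\<tau>. pos ((0, s, t) + \<tau> *\<^sub>R dr)) r c = pd dr h ((0, s, t) + r *\<^sub>R dr)"
    by (rule line_velocity[OF rep]) (use x at_within_Ioo_ne_bot in \<open>auto simp: \<Sigma>_def\<close>)
  then show "vel_r x \<in> tangent_space A (pos x)" "vel_r x c = pd dr h x" by (simp_all add: x vel_r_def pos_def)
qed (rule C_inf_on_imp_pd[OF chart_repD(3)[OF rep]])

lemma frep_cov_t:
  assumes rep: "rep c W h" and U: "frep c W U u"
  shows "frep c W (cov_t U) (Dv (christoffel A nabla c) h dt u)"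
  unfolding field_rep_def
proof (intro conjI ballI)
  interpret cm: coord_metric_map "chart_range c" "christoffel A nabla c" "metric_coord A g c" W h
    by (rule coord_map_rep[OF rep])
  show "C_inf_on W (Dv (christoffel A nabla c) h dt u)" by (rule cm.smooth_D[OF field_repD(1)[OF U]])
  fix x assume "x \<in> \<Sigma> \<inter> W"
  then obtain r s t where x: "x = (r, s, t)" "(r, s, t) \<in> \<Sigma>" "(r, s, t) \<in> W" by (cases x) auto
  have "cov_deriv A nabla {a..b} (\<lambda>\<tau>. pos ((r, s, 0) + \<tau> *\<^sub>R dt)) (\<lambda>\<tau>. U ((r, s, 0) + \<tau> *\<^sub>R dt)) t \<in> tangent_space A (pos ((r, s, 0) + t *\<^sub>R dt)) \<and>
    cov_deriv A nabla {a..b} (\<lambda>\<tau>. pos ((r, s, 0) + \<tau> *\<^sub>R dt)) (\<lambda>\<tau>. U ((r, s, 0) + \<tau> *\<^sub>R dt)) t c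
      = Dv (christoffel A nabla c) h dt u ((r, s, 0) + t *\<^sub>R dt)"
    by (rule line_cov_deriv[OF rep U]) (use x at_within_Icc_ne_bot[OF ab] in \<open>auto simp: \<Sigma>_def\<close>)
  then show "cov_t U x \<in> tangent_space A (pos x)" "cov_t U x c = Dv (christoffel A nabla c) h dt u x"
    by (simp_all add: x cov_t_def pos_def)
qed

text \<open>The integrand of the functional and the boundary terms arising from the integration by parts,
  on the closed strip, with one-sided derivatives at its ends.\<close>

definition strip_integrand :: "param \<Rightarrow> real" where
  "strip_integrand x = 1/2 * g (pos x) (cov_t vel_t x) (cov_t vel_t x) + V (pos x)"

definition strip_boundary :: "param \<Rightarrow> real" where
  "strip_boundary x = g (pos x) (cov_t vel_s x) (cov_t vel_t x) - g (pos x) (vel_s x) (cov_t (cov_t vel_t) x)"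

abbreviation "cIntegrand c h \<equiv> coord_variation.integrand (christoffel A nabla c) (metric_coord A g c) h (V \<circ> chart_inv c) dt"
abbreviation "cBoundary c h \<equiv> coord_variation.boundary (christoffel A nabla c) (metric_coord A g c) h ds dt"

lemma coord_variation_rep:
  "rep c W h \<Longrightarrow> coord_variation (chart_range c) (christoffel A nabla c) (metric_coord A g c) W h
    (V \<circ> chart_inv c) (\<lambda>x. gradient A g V (chart_inv c x) c)"
  by (rule coord_variation[OF V]) (rule chart_repD; assumption)+

lemma integrand_rep:
  assumes rep: "rep c W h" and x: "x \<in> \<Sigma>" "x \<in> W"
  shows "cIntegrand c h x = strip_integrand x" "cBoundary c h x = strip_boundary x"
proof -
  interpret cv: coord_variation "chart_range c" "christoffel A nabla c" "metric_coord A g c" W h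
    "V \<circ> chart_inv c" "\<lambda>x. gradient A g V (chart_inv c x) c" dr ds dt
    by (rule coord_variation_rep[OF rep])
  note r = chart_repD[OF rep]
  note T = frep_vel_t[OF rep] note S = frep_vel_s[OF rep]
  note T1 = frep_cov_t[OF rep T] note T2 = frep_cov_t[OF rep T1] note S1 = frep_cov_t[OF rep S]
  have g: "g (pos x) (U x) (U' x) = metric_coord A g c (h x) (u x) (u' x)"
    if "frep c W U u" "frep c W U' u'" for U U' u u'
    using metric_chart[OF field_repD(2)[OF that(1) x] field_repD(2)[OF that(2) x] r(5)[OF x]]
    by (simp add: r(6)[OF x] field_repD(3)[OF that(1) x] field_repD(3)[OF that(2) x])
  have "V (pos x) = (V \<circ> chart_inv c) (h x)"
    using r(1) r(7)[OF x] r(6)[OF x] by (metis chart_inv_left comp_apply)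
  then show "cIntegrand c h x = strip_integrand x" by (simp add: strip_integrand_def cv.integrand_def g[OF T1 T1])
  show "cBoundary c h x = strip_boundary x" by (simp add: strip_boundary_def cv.boundary_def g[OF S1 T1] g[OF S T2])
qed

text \<open>Here \<open>k c h\<close> is a smooth extension of \<open>F\<close> beyond the strip, built from a representation \<open>h\<close> of
  the variation in the chart \<open>c\<close>.\<close>

lemma smooth_on_by_rep:
  assumes "\<And>c W h. rep c W h \<Longrightarrow> C_inf_on W (k c h) \<and> (\<forall>x\<in>\<Sigma> \<inter> W. k c h x = F x)"
  shows "smooth_on \<Sigma> F"
proof (rule smooth_onI)
  fix x assume x: "x \<in> \<Sigma>"
  obtain c where c: "c \<in> charts_at A (pos x)" using ex_chart by (rule exE)
  from rep_exists[OF x c] obtain W h where W: "x \<in> W" "rep c W h" by (elim exE conjE)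
  show "\<exists>W h. open W \<and> x \<in> W \<and> C_inf_on W h \<and> (\<forall>y\<in>\<Sigma> \<inter> W. h y = F y)"
    by (rule exI[of _ W], rule exI[of _ "k c h"]) (use assms[OF W(2)] chart_repD(2)[OF W(2)] W(1) in simp)
qed

lemma partial_r:
  assumes W: "open W" "(r, s, t) \<in> W" and h: "C_inf_on W h" and x: "(r, s, t) \<in> \<Sigma>"
    and eq: "\<And>x. x \<in> \<Sigma> \<Longrightarrow> x \<in> W \<Longrightarrow> h x = F x"
  shows "((\<lambda>r. F (r, s, t)) has_real_derivative pd dr h (r, s, t)) (at r)"
  using has_real_derivative_line[OF W(1) h open_greaterThanLessThan[of "-er" er], of r "(0, s, t)" dr F] W(2) x eq
  by (simp add: \<Sigma>_def)

lemma partial_s: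
  assumes W: "open W" "(r, s, t) \<in> W" and h: "C_inf_on W h" and x: "(r, s, t) \<in> \<Sigma>"
    and eq: "\<And>x. x \<in> \<Sigma> \<Longrightarrow> x \<in> W \<Longrightarrow> h x = F x"
  shows "((\<lambda>s. F (r, s, t)) has_real_derivative pd ds h (r, s, t)) (at s)"
  using has_real_derivative_line[OF W(1) h open_greaterThanLessThan[of "-es" es], of s "(r, 0, t)" ds F] W(2) x eq
  by (simp add: \<Sigma>_def)

text \<open>Derivatives in the directions of the parameters, indicated by the suffix. They exist up to the
  ends of the strip because the parameters range over open intervals.\<close>

definition integrand_ds :: "param \<Rightarrow> real" where "integrand_ds = (\<lambda>(r, s, t). deriv (\<lambda>s. strip_integrand (r, s, t)) s)"
definition integrand_drs :: "param \<Rightarrow> real" where "integrand_drs = (\<lambda>(r, s, t). deriv (\<lambda>r. integrand_ds (r, s, t)) r)"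
definition boundary_dr :: "param \<Rightarrow> real" where "boundary_dr = (\<lambda>(r, s, t). deriv (\<lambda>r. strip_boundary (r, s, t)) r)"

lemma derivs_rep:
  assumes rep: "rep c W h"
  shows "x \<in> \<Sigma> \<Longrightarrow> x \<in> W \<Longrightarrow> pd ds (cIntegrand c h) x = integrand_ds x"
    and "x \<in> \<Sigma> \<Longrightarrow> x \<in> W \<Longrightarrow> pd dr (pd ds (cIntegrand c h)) x = integrand_drs x"
    and "x \<in> \<Sigma> \<Longrightarrow> x \<in> W \<Longrightarrow> pd dr (cBoundary c h) x = boundary_dr x"
    and "C_inf_on W (cIntegrand c h)" "C_inf_on W (cBoundary c h)"
proof -
  interpret cv: coord_variation "chart_range c" "christoffel A nabla c" "metric_coord A g c" W h
    "V \<circ> chart_inv c" "\<lambda>x. gradient A g V (chart_inv c x) c" dr ds dt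
    by (rule coord_variation_rep[OF rep])
  note W = chart_repD(2)[OF rep]
  show sI: "C_inf_on W (cIntegrand c h)" and sB: "C_inf_on W (cBoundary c h)"
    by (rule cv.smooth_integrand, rule cv.smooth_boundary)
  note smd = C_inf_on_imp_pd[OF sI, of ds]
  show 1: "pd ds (cIntegrand c h) x = integrand_ds x" if x: "x \<in> \<Sigma>" "x \<in> W" for x
    using partial_s[OF W _ sI _ integrand_rep(1)[OF rep]] x
    by (cases x) (simp add: integrand_ds_def DERIV_imp_deriv[symmetric])
  show "pd dr (pd ds (cIntegrand c h)) x = integrand_drs x" if x: "x \<in> \<Sigma>" "x \<in> W" for x
    using partial_r[OF W _ smd _ 1] x
    by (cases x) (simp add: integrand_drs_def DERIV_imp_deriv[symmetric])
  show "pd dr (cBoundary c h) x = boundary_dr x" if x: "x \<in> \<Sigma>" "x \<in> W" for x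
    using partial_r[OF W _ sB _ integrand_rep(2)[OF rep]] x
    by (cases x) (simp add: boundary_dr_def DERIV_imp_deriv[symmetric])
qed

lemma smooth_strip_integrand: "smooth_on \<Sigma> strip_integrand"
  by (rule smooth_on_by_rep[where k = "\<lambda>c h. cIntegrand c h"])
    (use derivs_rep(4) integrand_rep(1) in simp)

lemma smooth_integrand_ds: "smooth_on \<Sigma> integrand_ds"
  by (rule smooth_on_by_rep[where k = "\<lambda>c h. pd ds (cIntegrand c h)"])
    (use C_inf_on_imp_pd[OF derivs_rep(4)] derivs_rep(1) in simp)

lemma smooth_integrand_drs: "smooth_on \<Sigma> integrand_drs"
  by (rule smooth_on_by_rep[where k = "\<lambda>c h. pd dr (pd ds (cIntegrand c h))"])
    (use C_inf_on_imp_pd[OF C_inf_on_imp_pd[OF derivs_rep(4)]] derivs_rep(2) in simp)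

lemma smooth_boundary_dr: "smooth_on \<Sigma> boundary_dr"
  by (rule smooth_on_by_rep[where k = "\<lambda>c h. pd dr (cBoundary c h)"])
    (use C_inf_on_imp_pd[OF derivs_rep(5)] derivs_rep(3) in simp)

lemma has_derivative_integrand_ds:
  assumes x: "(r, s, t) \<in> \<Sigma>"
  shows "((\<lambda>s. strip_integrand (r, s, t)) has_real_derivative integrand_ds (r, s, t)) (at s)"
proof -
  obtain c where c: "c \<in> charts_at A (pos (r, s, t))" using ex_chart by (rule exE)
  from rep_exists[OF x c] obtain W h where W: "(r, s, t) \<in> W" "rep c W h" by (elim exE conjE)
  show ?thesis
    using partial_s[OF chart_repD(2)[OF W(2)] W(1) derivs_rep(4)[OF W(2)] x integrand_rep(1)[OF W(2)]]
      derivs_rep(1)[OF W(2) x W(1)] by simp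
qed

lemma has_derivative_integrand_drs:
  assumes x: "(r, s, t) \<in> \<Sigma>"
  shows "((\<lambda>r. integrand_ds (r, s, t)) has_real_derivative integrand_drs (r, s, t)) (at r)"
proof -
  obtain c where c: "c \<in> charts_at A (pos (r, s, t))" using ex_chart by (rule exE)
  from rep_exists[OF x c] obtain W h where W: "(r, s, t) \<in> W" "rep c W h" by (elim exE conjE)
  show ?thesis
    using partial_r[OF chart_repD(2)[OF W(2)] W(1) C_inf_on_imp_pd[OF derivs_rep(4)[OF W(2)]] x derivs_rep(1)[OF W(2)]]
      derivs_rep(2)[OF W(2) x W(1)] by simp
qed

lemma continuous_strip:
  assumes F: "continuous_on \<Sigma> F" and rs: "r \<in> {-er<..<er}" "s \<in> {-es<..<es}"
  shows "continuous_on {a..b} (\<lambda>t. F (r, s, t))"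
  by (rule continuous_on_compose2[OF F]) (use rs in \<open>auto simp: \<Sigma>_def intro!: continuous_intros\<close>)

lemma integral_strip_integrand_derivative:
  assumes r: "r \<in> {-er<..<er}"
  shows "((\<lambda>s. integral {a..b} (\<lambda>t. strip_integrand (r, s, t))) has_real_derivative integral {a..b} (\<lambda>t. integrand_ds (r, 0, t))) (at 0)"
proof -
  have "((\<lambda>s. integral (cbox a b) (\<lambda>t. strip_integrand (r, s, t))) has_real_derivative integral (cbox a b) (\<lambda>t. integrand_ds (r, 0, t)))
      (at 0 within {-es<..<es})"
  proof (rule leibniz_rule_field_derivative[where fx = "\<lambda>s t. integrand_ds (r, s, t)" and f = "\<lambda>s t. strip_integrand (r, s, t)" and ?x0.0 = 0])
    show "((\<lambda>s. strip_integrand (r, s, t)) has_real_derivative integrand_ds (r, s, t)) (at s within {-es<..<es})"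
      if "s \<in> {-es<..<es}" "t \<in> cbox a b" for s t
      using has_derivative_integrand_ds[of r s t] r that by (auto simp: \<Sigma>_def intro: has_field_derivative_at_within)
    show "(\<lambda>t. strip_integrand (r, s, t)) integrable_on cbox a b" if "s \<in> {-es<..<es}" for s
      using continuous_strip[OF smooth_on_continuous[OF smooth_strip_integrand] r that]
      by (simp add: integrable_continuous_interval)
    show "continuous_on ({-es<..<es} \<times> cbox a b) (\<lambda>(s, t). integrand_ds (r, s, t))"
      unfolding split_beta
      by (rule continuous_on_compose2[OF smooth_on_continuous[OF smooth_integrand_ds]])
        (use r in \<open>auto simp: \<Sigma>_def intro!: continuous_intros\<close>)
  qed (use es in auto)
  then show ?thesis using es by (simp add: at_within_open[OF _ open_greaterThanLessThan])
qed

lemma integral_integrand_ds_derivative: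
  "((\<lambda>r. integral {a..b} (\<lambda>t. integrand_ds (r, 0, t))) has_real_derivative integral {a..b} (\<lambda>t. integrand_drs (0, 0, t))) (at 0)"
proof -
  have "((\<lambda>r. integral (cbox a b) (\<lambda>t. integrand_ds (r, 0, t))) has_real_derivative integral (cbox a b) (\<lambda>t. integrand_drs (0, 0, t)))
      (at 0 within {-er<..<er})"
  proof (rule leibniz_rule_field_derivative[where fx = "\<lambda>r t. integrand_drs (r, 0, t)" and f = "\<lambda>r t. integrand_ds (r, 0, t)" and ?x0.0 = 0])
    show "((\<lambda>r. integrand_ds (r, 0, t)) has_real_derivative integrand_drs (r, 0, t)) (at r within {-er<..<er})"
      if "r \<in> {-er<..<er}" "t \<in> cbox a b" for r t
      using has_derivative_integrand_drs[of r 0 t] es that by (auto simp: \<Sigma>_def intro: has_field_derivative_at_within)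
    show "(\<lambda>t. integrand_ds (r, 0, t)) integrable_on cbox a b" if "r \<in> {-er<..<er}" for r
      using continuous_strip[OF smooth_on_continuous[OF smooth_integrand_ds] that, of 0] es
      by (simp add: integrable_continuous_interval)
    show "continuous_on ({-er<..<er} \<times> cbox a b) (\<lambda>(r, t). integrand_drs (r, 0, t))"
      unfolding split_beta
      by (rule continuous_on_compose2[OF smooth_on_continuous[OF smooth_integrand_drs]])
        (use es in \<open>auto simp: \<Sigma>_def intro!: continuous_intros\<close>)
  qed (use er in auto)
  then show ?thesis using er by (simp add: at_within_open[OF _ open_greaterThanLessThan])
qed

text \<open>This is the fundamental theorem of calculus for \<open>boundary_dr\<close> along \<open>r = s = 0\<close>, which is
  continuous up to the ends of the piece.\<close>

lemma second_variation_integral: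
  assumes p: "\<And>t c W h. t \<in> {a<..<b} \<Longrightarrow> (0, 0, t) \<in> W \<Longrightarrow> rep c W h \<Longrightarrow>
    integrand_drs (0, 0, t) = pd dt (pd dr (cBoundary c h)) (0, 0, t) + p t"
  shows "(p has_integral (integral {a..b} (\<lambda>t. integrand_drs (0, 0, t)) - (boundary_dr (0, 0, b) - boundary_dr (0, 0, a)))) {a..b}"
proof -
  have 0: "0 \<in> {-er<..<er}" "0 \<in> {-es<..<es}" using er es by auto
  have "((\<lambda>t. boundary_dr (0, 0, t)) has_vector_derivative integrand_drs (0, 0, t) - p t) (at t)" if t: "t \<in> {a<..<b}" for t
  proof -
    have x: "(0, 0, t) \<in> \<Sigma>" using 0 t by (auto simp: \<Sigma>_def)
    obtain c where c: "c \<in> charts_at A (pos (0, 0, t))" using ex_chart by (rule exE)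
    from rep_exists[OF x c] obtain W h where W: "(0, 0, t) \<in> W" "rep c W h" by (elim exE conjE)
    let ?h = "pd dr (cBoundary c h)"
    have sh: "C_inf_on W ?h" by (rule C_inf_on_imp_pd[OF derivs_rep(5)[OF W(2)]])
    have "((\<lambda>t. boundary_dr ((0, 0, 0) + t *\<^sub>R dt)) has_real_derivative pd dt ?h ((0, 0, 0) + t *\<^sub>R dt)) (at t)"
      by (rule has_real_derivative_line[OF chart_repD(2)[OF W(2)] sh open_greaterThanLessThan[of a b]])
        (use t W(1) 0 derivs_rep(3)[OF W(2)] in \<open>auto simp: \<Sigma>_def\<close>)
    then have "((\<lambda>t. boundary_dr (0, 0, t)) has_vector_derivative pd dt ?h (0, 0, t)) (at t)"
      by (simp add: has_real_derivative_iff_has_vector_derivative)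
    then show ?thesis using p[OF t W] by simp
  qed
  then have 1: "((\<lambda>t. integrand_drs (0, 0, t) - p t) has_integral (boundary_dr (0, 0, b) - boundary_dr (0, 0, a))) {a..b}"
    using ab continuous_strip[OF smooth_on_continuous[OF smooth_boundary_dr] 0]
    by (intro fundamental_theorem_of_calculus_interior) auto
  have 2: "((\<lambda>t. integrand_drs (0, 0, t)) has_integral integral {a..b} (\<lambda>t. integrand_drs (0, 0, t))) {a..b}"
    using continuous_strip[OF smooth_on_continuous[OF smooth_integrand_drs] 0]
    by (intro integrable_integral integrable_continuous_interval)
  from has_integral_diff[OF 2 1] show ?thesis by simp
qed

end

section \<open>Velocities and covariant derivatives on subintervals\<close>

context smooth_manifold begin

lemma velocity_cong:
  assumes N: "open N" "t \<in> N" and t: "t \<in> I" and I: "I \<inter> N = I' \<inter> N"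
    and eq: "\<And>s. s \<in> I \<Longrightarrow> s \<in> N \<Longrightarrow> \<gamma> s = \<gamma>' s"
  shows "velocity A I \<gamma> t = velocity A I' \<gamma>' t"
proof -
  have w: "at t within I = at t within I'" by (rule at_within_nhd[OF N(2,1)]) (use I in auto)
  have v: "vector_derivative (\<lambda>s. snd c (\<gamma> s)) (at t within I) = vector_derivative (\<lambda>s. snd c (\<gamma>' s)) (at t within I)" for c
  proof (rule vector_derivative_cong_eq)
    show "\<forall>\<^sub>F s in nhds t. s \<in> I \<longrightarrow> snd c (\<gamma> s) = snd c (\<gamma>' s)"
      using eventually_nhds_in_open[OF N] by eventually_elim (use eq in auto)
  qed (use t in auto)
  show ?thesis unfolding velocity_def v eq[OF t N(2)] unfolding w by (rule refl)
qed

lemma cov_deriv_cong: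
  assumes N: "open N" "t \<in> N" and t: "t \<in> I" and I: "I \<inter> N = I' \<inter> N"
    and eq: "\<And>s. s \<in> I \<Longrightarrow> s \<in> N \<Longrightarrow> \<gamma> s = \<gamma>' s"
    and eqX: "\<And>s. s \<in> I \<Longrightarrow> s \<in> N \<Longrightarrow> X s = X' s"
  shows "cov_deriv A nabla I \<gamma> X t = cov_deriv A nabla I' \<gamma>' X' t"
proof -
  have w: "at t within I = at t within I'" by (rule at_within_nhd[OF N(2,1)]) (use I in auto)
  have v: "vector_derivative (\<lambda>s. X s c) (at t within I) = vector_derivative (\<lambda>s. X' s c) (at t within I)" for c
  proof (rule vector_derivative_cong_eq)
    show "\<forall>\<^sub>F s in nhds t. s \<in> I \<longrightarrow> X s c = X' s c"
      using eventually_nhds_in_open[OF N] by eventually_elim (use eqX in auto)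
  qed (use t in auto)
  have vel: "velocity A I \<gamma> t = velocity A I' \<gamma>' t" by (rule velocity_cong[OF N t I eq])
  show ?thesis unfolding cov_deriv_def vel v eq[OF t N(2)] eqX[OF t N(2)] unfolding w by (rule refl)
qed

end

lemma vector_derivative_subinterval:
  assumes f: "f differentiable (at t within J)" and I: "I \<subseteq> J" "t \<in> I" "at t within I \<noteq> bot"
    and eq: "\<And>s. s \<in> I \<Longrightarrow> f s = f' s"
  shows "vector_derivative f (at t within J) = vector_derivative f' (at t within I)"
proof -
  have "(f has_vector_derivative vector_derivative f (at t within J)) (at t within I)"
    using f I(1) by (intro has_vector_derivative_within_subset[OF _ I(1)]) (simp add: vector_derivative_works)
  then have "vector_derivative f (at t within I) = vector_derivative f (at t within J)"
    by (rule vector_derivative_within[OF I(3)])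
  moreover have "vector_derivative f (at t within I) = vector_derivative f' (at t within I)"
    by (rule vector_derivative_cong_eq) (use eq I(2) in auto)
  ultimately show ?thesis by simp
qed

text \<open>As a member of \<open>Omega\<close> is \<open>C\<^sup>1\<close>, its one-sided derivatives at a node exist and are equal.\<close>

lemma velocity_subinterval:
  assumes \<gamma>: "\<gamma> \<in> Omega A T \<xi> \<eta>" and ab: "a < b" "0 \<le> a" "b \<le> T" and t: "t \<in> {a..b}"
  shows "velocity A {a..b} \<gamma> t = velocity A {0..T} \<gamma> t"
proof -
  have *: "vector_derivative (\<lambda>s. snd c (\<gamma> s)) (at t within {0..T})
      = vector_derivative (\<lambda>s. snd c (\<gamma> s)) (at t within {a..b})" if c: "c \<in> charts_at A (\<gamma> t)" for c
  proof (rule vector_derivative_subinterval[OF _ _ t at_within_Icc_ne_bot[OF ab(1) t]])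
    show "{a..b} \<subseteq> {0..T}" using ab by auto
    have "C1_within {0..T} {t \<in> {0..T}. \<gamma> t \<in> fst c} (\<lambda>t. snd c (\<gamma> t))"
      using \<gamma> c by (simp add: Omega_def charts_at_iff)
    then show "(\<lambda>s. snd c (\<gamma> s)) differentiable at t within {0..T}"
      using c t ab by (simp add: C1_within_def charts_at_iff)
  qed simp
  show ?thesis unfolding velocity_def by (rule ext) (simp add: *)
qed

lemma field_rep_cong:
  assumes "field_rep A c S W \<alpha> U u" "open W" "\<And>x. x \<in> W \<Longrightarrow> u x = u' x"
  shows "field_rep A c S W \<alpha> U u'"
  using assms(1,3) C_inf_on_cong[OF assms(2) field_repD(1)[OF assms(1)] assms(3)]
  by (simp add: field_rep_def)

lemma tensor_rep_cong:
  assumes K: "tensor_rep A c S W \<alpha> K k" and W: "open W" and eq: "\<And>x. x \<in> W \<Longrightarrow> k x = k' x"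
  shows "tensor_rep A c S W \<alpha> K k'"
proof -
  have "C_inf_on W (\<lambda>y. k' y u v w)" for u v w
  proof (rule C_inf_on_cong[OF W])
    show "C_inf_on W (\<lambda>y. k y u v w)" using tensor_repD(1)[OF K] by (simp add: tri_fam_def)
  qed (simp add: eq)
  then have "tri_fam W k'" using tensor_repD(1)[OF K] eq by (simp add: tri_fam_def)
  then show ?thesis using K eq by (simp add: tensor_rep_def)
qed

section \<open>A strip of a variation of a modified cubic\<close>

text \<open>Two strips meet in a slice \<open>t = \<tau>\<close>. Derivatives in the directions of the parameters are determined
  by the values on it, so they agree from both sides if the values do.\<close>

definition slice :: "real \<Rightarrow> real \<Rightarrow> real \<Rightarrow> param set" where
  "slice er es \<tau> = {-er<..<er} \<times> {-es<..<es} \<times> {\<tau>}"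

lemma pd_slice:
  fixes F F' :: "param \<Rightarrow> 'b::euclidean_space"
  assumes W: "open W" and F: "C_inf_on W F" "C_inf_on W F'"
    and eq: "\<And>x. x \<in> slice er es \<tau> \<inter> W \<Longrightarrow> F x = F' x" and x: "x \<in> slice er es \<tau> \<inter> W"
  shows "pd dr F x = pd dr F' x" "pd ds F x = pd ds F' x"
proof -
  obtain r s where rs: "x = (r, s, \<tau>)" "r \<in> {-er<..<er}" "s \<in> {-es<..<es}" using x by (auto simp: slice_def)
  show "pd dr F x = pd dr F' x"
    using pd_line_cong[OF W open_greaterThanLessThan[of "-er" er] _ _ F, of r "(0, s, \<tau>)" dr] rs x eq
    by (simp add: slice_def)
  show "pd ds F x = pd ds F' x"
    using pd_line_cong[OF W open_greaterThanLessThan[of "-es" es] _ _ F, of s "(r, 0, \<tau>)" ds] rs x eq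
    by (simp add: slice_def)
qed

text \<open>A strip together with the fields and the curve on all of \<open>{0..T}\<close> to which it belongs.\<close>

locale variation_piece = variation_strip A g nabla V er es \<alpha> a b
  for A :: "('q::{t2_space, second_countable_topology}, 'e::euclidean_space) chart set"
    and g :: "'q \<Rightarrow> ('q, 'e) tvec \<Rightarrow> ('q, 'e) tvec \<Rightarrow> real"
    and nabla :: "('q, 'e) conn" and V er es \<alpha> a b +
  fixes T :: real and \<xi> \<eta> :: "'q \<times> ('q, 'e) tvec" and q :: "real \<Rightarrow> 'q" and X Y :: "real \<Rightarrow> ('q, 'e) tvec"
  assumes variation: "two_parameter_variation A nabla T \<xi> \<eta> q er es \<alpha> X Y"
    and cubic: "modified_cubic A g nabla V T q"
    and a0: "0 \<le> a" and bT: "b \<le> T"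
begin

abbreviation "cd \<equiv> cov_deriv A nabla {0..T} q"

lemma alpha_Omega: "r \<in> {-er<..<er} \<Longrightarrow> s \<in> {-es<..<es} \<Longrightarrow> \<alpha> r s \<in> Omega A T \<xi> \<eta>"
  using variation unfolding two_parameter_variation_def by blast

lemma zero_mem: "0 \<in> {-er<..<er}" "0 \<in> {-es<..<es}"
  using er es by auto

lemma q_eq: "t \<in> {0..T} \<Longrightarrow> \<alpha> 0 0 t = q t" "t \<in> {a..b} \<Longrightarrow> pos (0, 0, t) = q t"
  using variation a0 bT unfolding two_parameter_variation_def by (auto simp: pos_def)

lemma XY_eq: "t \<in> {a..b} \<Longrightarrow> X t = vel_r (0, 0, t)" "t \<in> {a..b} \<Longrightarrow> Y t = vel_s (0, 0, t)"
  using variation a0 bT unfolding two_parameter_variation_def by (auto simp: vel_r_def vel_s_def)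

lemma axis_mem: "t \<in> {a..b} \<Longrightarrow> (0, 0, t) \<in> \<Sigma>"
  using zero_mem by (simp add: \<Sigma>_def)

lemma ne_bot: "t \<in> {0..T} \<Longrightarrow> at t within {0..T} \<noteq> bot"
  by (rule at_within_Icc_ne_bot) (use ab a0 bT in auto)

lemma vel_t_eq: "(r, s, t) \<in> \<Sigma> \<Longrightarrow> vel_t (r, s, t) = velocity A {0..T} (\<alpha> r s) t"
  unfolding vel_t_def using velocity_subinterval[OF alpha_Omega ab a0 bT, of r s t]
  by (auto simp: \<Sigma>_def)

text \<open>In the interior of the piece, everything along \<open>q\<close> is read off from a representation of the
  variation.\<close>

lemma interior_rep:
  assumes rep: "rep c W h" and N: "N = ((\<lambda>\<tau>. (0, 0, 0) + \<tau> *\<^sub>R dt) -` W) \<inter> {a<..<b}"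
  shows "chart_rep A c {0..T} N q (\<lambda>\<tau>. h (0, 0, \<tau>))"
    and "frep c W U u \<Longrightarrow> (\<And>\<tau>. \<tau> \<in> {a..b} \<Longrightarrow> Z \<tau> = U (0, 0, \<tau>)) \<Longrightarrow>
      field_rep A c {0..T} N q Z (\<lambda>\<tau>. u (0, 0, \<tau>))"
    and "field_rep A c {0..T} N q (velocity A {0..T} q) (\<lambda>\<tau>. pd dt h (0, 0, \<tau>))"
    and "field_rep A c {0..T} N q Z (\<lambda>\<tau>. u (0, 0, \<tau>)) \<Longrightarrow> C_inf_on W u \<Longrightarrow>
      field_rep A c {0..T} N q (cd Z) (\<lambda>\<tau>. Dv (christoffel A nabla c) h dt u (0, 0, \<tau>))"
    and "tensor_rep A c {0..T} N q K (\<lambda>\<tau>. k (0, 0, \<tau>)) \<Longrightarrow> tri_fam W k \<Longrightarrow>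
      tensor_rep A c {0..T} N q (cov_deriv_tensor A nabla {0..T} q K)
        (\<lambda>\<tau>. Dtri (christoffel A nabla c) h dt k (0, 0, \<tau>))"
proof -
  note r = chart_repD[OF rep]
  have oN: "open N" unfolding N by (intro open_Int open_line_vimage r(2) open_greaterThanLessThan)
  have NW: "(0, 0, \<tau>) \<in> W" "\<tau> \<in> {a..b}" "\<tau> \<in> {0..T}" if "\<tau> \<in> N" for \<tau> using that a0 bT unfolding N by auto
  have sub: "C_inf_on N (\<lambda>\<tau>. u (0, 0, \<tau>))" if "C_inf_on W u" for u :: "param \<Rightarrow> 'e"
    using C_inf_on_subset[OF C_inf_on_compose_line[OF r(2) that, of "(0, 0, 0)" dt], of N] unfolding N by simp
  have \<Sigma>N: "(0, 0, \<tau>) \<in> \<Sigma>" if "\<tau> \<in> N" for \<tau> using NW(2)[OF that] by (rule axis_mem)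
  show qrep: "chart_rep A c {0..T} N q (\<lambda>\<tau>. h (0, 0, \<tau>))"
    unfolding chart_rep_def
  proof (intro conjI ballI)
    show "(\<lambda>\<tau>. h (0, 0, \<tau>)) ` N \<subseteq> chart_range c" using NW(1) r(4) by blast
    fix \<tau> assume "\<tau> \<in> {0..T} \<inter> N"
    then have \<tau>: "\<tau> \<in> N" by simp
    show "q \<tau> \<in> fst c" using r(7)[OF \<Sigma>N[OF \<tau>] NW(1)[OF \<tau>]] q_eq(2)[OF NW(2)[OF \<tau>]] by simp
    show "snd c (q \<tau>) = h (0, 0, \<tau>)" using r(6)[OF \<Sigma>N[OF \<tau>] NW(1)[OF \<tau>]] q_eq(2)[OF NW(2)[OF \<tau>]] by simp
  qed (rule r(1) oN sub[OF r(3)])+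
  show "field_rep A c {0..T} N q Z (\<lambda>\<tau>. u (0, 0, \<tau>))"
    if U: "frep c W U u" and Z: "\<And>\<tau>. \<tau> \<in> {a..b} \<Longrightarrow> Z \<tau> = U (0, 0, \<tau>)" for U u Z
    unfolding field_rep_def
    using sub[OF field_repD(1)[OF U]] field_repD(2,3)[OF U \<Sigma>N NW(1)] Z[OF NW(2)] q_eq(2)[OF NW(2)]
    by simp
  have diff: "u differentiable (at (0, 0, \<tau>))" if "C_inf_on W u" "\<tau> \<in> N" for u :: "param \<Rightarrow> 'e" and \<tau>
    by (rule C_inf_on_differentiable[OF that(1) NW(1)[OF that(2)]])
  show "field_rep A c {0..T} N q (velocity A {0..T} q) (\<lambda>\<tau>. pd dt h (0, 0, \<tau>))"
    by (rule field_rep_cong[OF field_rep_velocity[OF qrep ne_bot] oN])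
      (use pd_compose_line[of h "(0, 0, 0)" _ dt] diff[OF r(3)] in simp_all)
  show "field_rep A c {0..T} N q (cd Z) (\<lambda>\<tau>. Dv (christoffel A nabla c) h dt u (0, 0, \<tau>))"
    if Z: "field_rep A c {0..T} N q Z (\<lambda>\<tau>. u (0, 0, \<tau>))" and u: "C_inf_on W u" for Z u
    by (rule field_rep_cong[OF field_rep_cov_deriv[OF qrep Z ne_bot] oN])
      (use Dv_compose_line[OF r(3) u, of "(0, 0, 0)" _ dt] NW(1) in simp_all)
  show "tensor_rep A c {0..T} N q (cov_deriv_tensor A nabla {0..T} q K)
      (\<lambda>\<tau>. Dtri (christoffel A nabla c) h dt k (0, 0, \<tau>))"
    if K: "tensor_rep A c {0..T} N q K (\<lambda>\<tau>. k (0, 0, \<tau>))" and k: "tri_fam W k" for K k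
  proof (rule tensor_rep_cong[OF tensor_rep_cov_deriv[OF qrep K ne_bot] oN])
    have sm: "C_inf_on W (\<lambda>y. k y u v w)" for u v w using k by (simp add: tri_fam_def)
    show "Dtri (christoffel A nabla c) (\<lambda>\<tau>. h (0, 0, \<tau>)) 1 (\<lambda>\<tau>. k (0, 0, \<tau>)) \<tau>
        = Dtri (christoffel A nabla c) h dt k (0, 0, \<tau>)" if "\<tau> \<in> N" for \<tau>
      using Dtri_compose_line[OF r(3) sm, of "(0, 0, 0)" \<tau> dt] NW(1)[OF that] by simp
  qed
qed

text \<open>Here the local computation meets the invariant one: each term of \<open>F_term\<close> has the corresponding
  term of \<open>F_coord\<close> as its coordinates.\<close>

lemma second_variation_at:
  assumes t: "t \<in> {a<..<b}" and tW: "(0, 0, t) \<in> W" and rep: "rep c W h"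
  shows "integrand_drs (0, 0, t) = pd dt (pd dr (cBoundary c h)) (0, 0, t)
    + g (q t) (Y t) (cov_deriv_pow A nabla {0..T} q 4 X t + F_term A nabla {0..T} q X t
        + nabla (q t) (X t) (gradient A g V))"
proof -
  interpret cv: coord_variation "chart_range c" "christoffel A nabla c" "metric_coord A g c" W h
    "V \<circ> chart_inv c" "\<lambda>x. gradient A g V (chart_inv c x) c" dr ds dt
    by (rule coord_variation_rep[OF rep])
  define N where "N = ((\<lambda>\<tau>. (0, 0, 0) + \<tau> *\<^sub>R dt) -` W) \<inter> {a<..<b}"
  let ?y = "(0, 0, t) :: param"
  have tN: "t \<in> N" and tI: "t \<in> {a..b}" and tT: "t \<in> {0..T}" using t tW a0 bT by (auto simp: N_def)
  have y\<Sigma>: "?y \<in> \<Sigma>" by (rule axis_mem[OF tI])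
  note r = chart_repD[OF rep]
  have ct: "c \<in> charts_at A (q t)" using r(5)[OF y\<Sigma> tW] q_eq(2)[OF tI] by simp
  have hq: "snd c (q t) = h ?y" using r(6)[OF y\<Sigma> tW] q_eq(2)[OF tI] by simp
  have invq: "chart_inv c (h ?y) = q t" using ct hq[symmetric] by (simp add: charts_at_iff)
  note qrep = interior_rep(1)[OF rep N_def]
  note FX = interior_rep(2)[OF rep N_def frep_vel_r[OF rep] XY_eq(1)]
  note FY = interior_rep(2)[OF rep N_def frep_vel_s[OF rep] XY_eq(2)]
  note FT = interior_rep(3)[OF rep N_def]
  note step = interior_rep(4)[OF rep N_def]
  note sm = cv.smooth_pd_h cv.smooth_D
  note X1 = step[OF FX sm(1)]
  note X2 = step[OF X1 sm(2)[OF sm(1)]]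
  note X3 = step[OF X2 sm(2)[OF sm(2)[OF sm(1)]]]
  note X4 = step[OF X3 sm(2)[OF sm(2)[OF sm(2)[OF sm(1)]]]]
  note A1 = step[OF FT sm(1)]
  note A2 = step[OF A1 sm(2)[OF sm(1)]]
  note A3 = step[OF A2 sm(2)[OF sm(2)[OF sm(1)]]]
  note R0 = tensor_rep_curvature[OF qrep]
  note R1 = interior_rep(5)[OF rep N_def R0 cv.tri_Rmh]
  note R2 = interior_rep(5)[OF rep N_def R1 cv.tri_fam_Dtri[OF cv.tri_Rmh]]
  note tan = field_repD(2)[OF FX tT tN] field_repD(2)[OF FY tT tN] field_repD(2)[OF FT tT tN]
    field_repD(2)[OF X1 tT tN] field_repD(2)[OF X2 tT tN] field_repD(2)[OF X3 tT tN] field_repD(2)[OF X4 tT tN]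
    field_repD(2)[OF A1 tT tN] field_repD(2)[OF A2 tT tN] field_repD(2)[OF A3 tT tN]
  note co = field_repD(3)[OF FX tT tN] field_repD(3)[OF FY tT tN] field_repD(3)[OF FT tT tN]
    field_repD(3)[OF X1 tT tN] field_repD(3)[OF X2 tT tN] field_repD(3)[OF X3 tT tN] field_repD(3)[OF X4 tT tN]
    field_repD(3)[OF A1 tT tN] field_repD(3)[OF A2 tT tN] field_repD(3)[OF A3 tT tN]
  note Rt = tensor_repD(2)[OF R0 tT tN] tensor_repD(2)[OF R1 tT tN] tensor_repD(2)[OF R2 tT tN]
  note Rc = tensor_repD(3)[OF R0 tT tN] tensor_repD(3)[OF R1 tT tN] tensor_repD(3)[OF R2 tT tN]
  note nR = nabla_curvature_chart[OF tan(1) tan(8) tan(3) tan(3) ct]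
  have pow: "(cd ^^ 1) Z = cd Z" "(cd ^^ 2) Z = cd (cd Z)" "(cd ^^ 3) Z = cd (cd (cd Z))"
    "(cd ^^ 4) Z = cd (cd (cd (cd Z)))" for Z
    by (simp_all add: eval_nat_numeral)
  have Ft: "F_term A nabla {0..T} q X t \<in> tangent_space A (q t)"
    unfolding F_term_def Let_def pow
    by (intro tangent_space_add tangent_space_scaleR Rt tan nR(1))
  have Fc: "F_term A nabla {0..T} q X t c = cv.F_coord ?y"
    unfolding F_term_def Let_def pow cv.F_coord_def
    by (simp only: fun_vector_simps Rc Rt tan co nR(2) hq)
  note gr = nabla_gradient_chart[OF V tan(1) ct]
  have Zt: "(cd ^^ 4) X t + F_term A nabla {0..T} q X t + nabla (q t) (X t) (gradient A g V) \<in> tangent_space A (q t)"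
    unfolding pow by (intro tangent_space_add tan Ft gr(1))
  have Zc: "((cd ^^ 4) X t + F_term A nabla {0..T} q X t + nabla (q t) (X t) (gradient A g V)) c
      = cv.D dr cv.euler_lagrange ?y"
    unfolding pow cv.D_er_euler_lagrange[OF tW] by (simp only: fun_vector_simps Fc co gr(2) hq invq)
  have "(cd ^^ 3) (velocity A {0..T} q) t + curvature A nabla (q t) ((cd ^^ 1) (velocity A {0..T} q) t)
      (velocity A {0..T} q t) (velocity A {0..T} q t) + gradient A g V (q t) = 0"
    using cubic tT unfolding modified_cubic_def Let_def by blast
  then have "(cd (cd (cd (velocity A {0..T} q))) t + curvature A nabla (q t) (cd (velocity A {0..T} q) t)
      (velocity A {0..T} q t) (velocity A {0..T} q t) + gradient A g V (q t)) c = 0"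
    unfolding pow by (simp only: zero_fun_apply)
  then have EL: "cv.euler_lagrange ?y = 0"
    unfolding cv.euler_lagrange_def by (simp only: fun_vector_simps Rc tan co invq)
  show ?thesis
    using cv.second_variation[OF tW EL] derivs_rep(2)[OF rep y\<Sigma> tW] metric_chart[OF tan(2) Zt ct]
    by (simp only: Zc co hq)
qed

section \<open>The boundary terms at the end points of a piece\<close>

lemma interior_pow: "s \<in> {a<..<b} \<Longrightarrow> (cd ^^ k) X s = (cov_t ^^ k) vel_r (0, 0, s)"
proof (induction k arbitrary: s)
  case 0
  then show ?case using XY_eq(1)[of s] by simp
next
  case (Suc k)
  have "cov_deriv A nabla {0..T} q ((cd ^^ k) X) s
      = cov_deriv A nabla {a..b} (\<alpha> 0 0) (\<lambda>t. (cov_t ^^ k) vel_r (0, 0, t)) s"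
    by (rule cov_deriv_cong[OF open_greaterThanLessThan Suc.prems]) (use Suc a0 bT q_eq(1) in auto)
  then show ?case by (simp add: cov_t_def[of "(cov_t ^^ k) vel_r"])
qed

lemma frep_pow: "rep c W h \<Longrightarrow> frep c W ((cov_t ^^ k) vel_r) ((Dv (christoffel A nabla c) h dt ^^ k) (pd dr h))"
  by (induction k) (auto intro: frep_vel_r frep_cov_t)

text \<open>Inside the piece \<open>D\<^sup>k X\<close> coincides with a derivative within \<open>{a..b}\<close>, which is continuous up to the
  ends. So the one-sided limit is the one-sided derivative.\<close>

lemma field_limit_end:
  assumes \<tau>: "\<tau> \<in> {a..b}" and F: "F \<noteq> bot" "F \<le> at \<tau>" "eventually (\<lambda>s. s \<in> {a<..<b}) F"
  shows "field_limit A q ((cd ^^ k) X) \<tau> F = (cov_t ^^ k) vel_r (0, 0, \<tau>)"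
proof
  fix c
  note y = axis_mem[OF \<tau>]
  show "field_limit A q ((cd ^^ k) X) \<tau> F c = (cov_t ^^ k) vel_r (0, 0, \<tau>) c"
  proof (cases "c \<in> charts_at A (q \<tau>)")
    case True
    then have "c \<in> charts_at A (pos (0, 0, \<tau>))" using q_eq(2)[OF \<tau>] by simp
    from rep_exists[OF y this] obtain W h where W: "(0, 0, \<tau>) \<in> W" "rep c W h" by (elim exE conjE)
    let ?u = "(Dv (christoffel A nabla c) h dt ^^ k) (pd dr h)"
    note U = frep_pow[OF W(2), of k]
    let ?N = "(\<lambda>\<tau>. (0, 0, 0) + \<tau> *\<^sub>R dt) -` W"
    have N1: "open ?N" by (rule open_line_vimage[OF chart_repD(2)[OF W(2)]])
    have N2: "\<tau> \<in> ?N" using W(1) by simp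
    have "continuous_on ?N (\<lambda>s. ?u ((0, 0, 0) + s *\<^sub>R dt))"
      by (rule C_inf_on_continuous[OF C_inf_on_compose_line[OF chart_repD(2)[OF W(2)] field_repD(1)[OF U]]])
    then have "isCont (\<lambda>s. ?u ((0, 0, 0) + s *\<^sub>R dt)) \<tau>"
      unfolding continuous_on_eq_continuous_at[OF N1] using N2 by (rule bspec)
    then have "isCont (\<lambda>s. ?u (0, 0, s)) \<tau>" by simp
    then have "((\<lambda>s. ?u (0, 0, s)) \<longlongrightarrow> ?u (0, 0, \<tau>)) F"
      unfolding isCont_def using F(2) by (rule tendsto_mono[rotated])
    moreover have "\<forall>\<^sub>F s in F. ?u (0, 0, s) = (cd ^^ k) X s c"
    proof -
      have "\<forall>\<^sub>F s in F. s \<in> ?N"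
        using F(2) eventually_at_in_open'[OF N1 N2] by (rule filter_leD)
      with F(3) show ?thesis
      proof eventually_elim
        case (elim s)
        then have "(0, 0, s) \<in> \<Sigma>" "(0, 0, s) \<in> W" using axis_mem[of s] by auto
        from field_repD(3)[OF U this] show ?case using interior_pow[OF elim(1)] by simp
      qed
    qed
    ultimately have "((\<lambda>s. (cd ^^ k) X s c) \<longlongrightarrow> ?u (0, 0, \<tau>)) F"
      by (rule Lim_transform_eventually)
    then have "Lim F (\<lambda>s. (cd ^^ k) X s c) = ?u (0, 0, \<tau>)" by (rule tendsto_Lim[OF F(1)])
    then show ?thesis using True field_repD(3)[OF U y W(1)] by (simp add: field_limit_def)
  next
    case False
    obtain d where d: "d \<in> charts_at A (pos (0, 0, \<tau>))" using ex_chart by (rule exE)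
    from rep_exists[OF y d] obtain W h where W: "(0, 0, \<tau>) \<in> W" "rep d W h" by (elim exE conjE)
    have "(cov_t ^^ k) vel_r (0, 0, \<tau>) \<in> tangent_space A (q \<tau>)"
      using field_repD(2)[OF frep_pow[OF W(2)] y W(1), of k] q_eq(2)[OF \<tau>] by simp
    from tangent_spaceD(1)[OF this False] show ?thesis using False by (simp add: field_limit_def)
  qed
qed

text \<open>At the ends of the piece this uses that \<open>Y\<close> is \<open>C\<^sup>1\<close>.\<close>

lemma cov_deriv_Y: "\<tau> \<in> {a..b} \<Longrightarrow> cd Y \<tau> = cov_t vel_s (0, 0, \<tau>)"
proof
  fix c assume \<tau>: "\<tau> \<in> {a..b}"
  have \<tau>T: "\<tau> \<in> {0..T}" using \<tau> a0 bT by auto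
  have vel: "velocity A {0..T} q \<tau> = velocity A {a..b} (\<alpha> 0 0) \<tau>"
    using velocity_subinterval[OF alpha_Omega[OF zero_mem] ab a0 bT \<tau>]
      velocity_cong[OF open_UNIV UNIV_I \<tau>T, of "{0..T}" q "\<alpha> 0 0"] q_eq(1) by simp
  show "cd Y \<tau> c = cov_t vel_s (0, 0, \<tau>) c"
  proof (cases "c \<in> charts_at A (q \<tau>)")
    case True
    have "Y \<in> tangent_Omega A nabla T q" using variation unfolding two_parameter_variation_def by blast
    then have "C1_within {0..T} {t \<in> {0..T}. q t \<in> fst c} (\<lambda>t. Y t c)"
      using True by (simp add: tangent_Omega_def charts_at_iff)
    then have d: "(\<lambda>s. Y s c) differentiable (at \<tau> within {0..T})"
      using True \<tau>T by (simp add: C1_within_def charts_at_iff)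
    have "vector_derivative (\<lambda>s. Y s c) (at \<tau> within {0..T})
        = vector_derivative (\<lambda>s. vel_s (0, 0, s) c) (at \<tau> within {a..b})"
      by (rule vector_derivative_subinterval[OF d _ \<tau> at_within_Icc_ne_bot[OF ab \<tau>]])
        (use a0 bT XY_eq(2) in auto)
    then show ?thesis
      using True q_eq(1)[OF \<tau>T] XY_eq(2)[OF \<tau>] by (simp add: cov_t_def cov_deriv_def vel)
  next
    case False
    then show ?thesis using q_eq(1)[OF \<tau>T] by (simp add: cov_t_def cov_deriv_def)
  qed
qed

text \<open>The covariant derivatives of the velocity of \<open>q\<close> do not depend on the piece, as \<open>q\<close> is smooth.\<close>

lemma cov_t_vel_t:
  assumes rep: "chart_rep A c {0..T} N q \<kappa>" and \<tau>: "\<tau> \<in> {a..b}" "\<tau> \<in> N"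
  shows "cov_t vel_t (0, 0, \<tau>) c = Dv (christoffel A nabla c) \<kappa> 1 (pd 1 \<kappa>) \<tau>"
    and "cov_t (cov_t vel_t) (0, 0, \<tau>) c = Dv (christoffel A nabla c) \<kappa> 1 (Dv (christoffel A nabla c) \<kappa> 1 (pd 1 \<kappa>)) \<tau>"
proof -
  have sub: "{a..b} \<subseteq> {0..T}" using a0 bT by auto
  have "chart_rep A c {a..b} N q \<kappa>"
    by (rule chart_rep_subset[OF rep chart_repD(2)[OF rep] order_refl sub])
  then have rep': "chart_rep A c {a..b} N (\<alpha> 0 0) \<kappa>"
    using q_eq(1) sub by (auto simp: chart_rep_def)
  note nt = at_within_Icc_ne_bot[OF ab]
  note v = field_rep_velocity[OF rep' nt]
  note v1 = field_rep_cov_deriv[OF rep' v nt]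
  note v2 = field_rep_cov_deriv[OF rep' v1 nt]
  show "cov_t vel_t (0, 0, \<tau>) c = Dv (christoffel A nabla c) \<kappa> 1 (pd 1 \<kappa>) \<tau>"
    using field_repD(3)[OF v1 \<tau>] by (simp add: cov_t_def vel_t_def)
  show "cov_t (cov_t vel_t) (0, 0, \<tau>) c = Dv (christoffel A nabla c) \<kappa> 1 (Dv (christoffel A nabla c) \<kappa> 1 (pd 1 \<kappa>)) \<tau>"
    using field_repD(3)[OF v2 \<tau>] by (simp add: cov_t_def vel_t_def)
qed

text \<open>At time \<open>\<tau>\<close> the field \<open>vel_s\<close> vanishes, and its covariant derivative is the derivative with
  respect to \<open>s\<close> of the velocity, which is prescribed.\<close>

lemma boundary_dr_end:
  assumes \<tau>: "\<tau> \<in> {a..b}"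
    and fixed: "\<And>r s. r \<in> {-er<..<er} \<Longrightarrow> s \<in> {-es<..<es} \<Longrightarrow>
      (\<alpha> r s \<tau>, velocity A {0..T} (\<alpha> r s) \<tau>) = (p, v)"
  shows "boundary_dr (0, 0, \<tau>) = 0"
proof -
  let ?y = "(0, 0, \<tau>) :: param"
  note y\<Sigma> = axis_mem[OF \<tau>]
  obtain c where c: "c \<in> charts_at A (pos ?y)" using ex_chart by (rule exE)
  from rep_exists[OF y\<Sigma> c] obtain W h where W: "?y \<in> W" and rep: "rep c W h" by (elim exE conjE)
  interpret cv: coord_variation "chart_range c" "christoffel A nabla c" "metric_coord A g c" W h
    "V \<circ> chart_inv c" "\<lambda>x. gradient A g V (chart_inv c x) c" dr ds dt
    by (rule coord_variation_rep[OF rep])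
  note r = chart_repD[OF rep]
  let ?S = "slice er es \<tau> \<inter> W"
  have S\<Sigma>: "x \<in> \<Sigma>" "x \<in> W" if "x \<in> ?S" for x using that \<tau> by (auto simp: slice_def \<Sigma>_def)
  have h: "h x = snd c p" if x: "x \<in> ?S" for x
  proof -
    have "pos x = p" using x fixed by (auto simp: pos_def slice_def)
    then show ?thesis using r(6)[OF S\<Sigma>[OF x]] by simp
  qed
  have T: "pd dt h x = v c" if x: "x \<in> ?S" for x
  proof -
    obtain r s where rs: "x = (r, s, \<tau>)" "r \<in> {-er<..<er}" "s \<in> {-es<..<es}" using x by (auto simp: slice_def)
    have "vel_t x = v" using vel_t_eq[of r s \<tau>] S\<Sigma>[OF x] fixed[OF rs(2,3)] rs(1) by simp
    then show ?thesis using field_repD(3)[OF frep_vel_t[OF rep] S\<Sigma>[OF x]] by simp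
  qed
  have s0: "pd ds h x = 0" if x: "x \<in> ?S" for x
    using pd_slice(2)[OF cv.open_W cv.smooth_h C_inf_on_const[of _ "snd c p"] h x] by simp
  have t0: "pd ds (pd dt h) x = 0" if x: "x \<in> ?S" for x
    using pd_slice(2)[OF cv.open_W cv.smooth_pd_h C_inf_on_const[of _ "v c"] T x] by simp
  have "cBoundary c h x = 0" if x: "x \<in> ?S" for x
  proof -
    have "x \<in> W" using x by simp
    note G = cv.G_simps[OF cv.h_mem[OF this]]
    \<comment> \<open>The covariant derivative of \<open>S\<close> is that of the velocity in the direction of \<open>s\<close>, and the velocity
      does not depend on \<open>s\<close>.\<close>
    have "cv.D dt (pd ds h) x = cv.D ds (pd dt h) x" by (rule cv.D_sym[OF \<open>x \<in> W\<close>])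
    also have "\<dots> = 0" using cv.\<Gamma>_simps[OF cv.h_mem[OF \<open>x \<in> W\<close>]] by (simp add: Dv_def s0[OF x] t0[OF x])
    finally show ?thesis by (simp add: cv.boundary_def s0[OF x] G)
  qed
  then have "pd dr (cBoundary c h) ?y = pd dr (\<lambda>_. 0) ?y"
    by (rule pd_slice(1)[where er = er and es = es and \<tau> = \<tau>, OF cv.open_W cv.smooth_boundary C_inf_on_const]) (use W zero_mem in \<open>auto simp: slice_def\<close>)
  then show ?thesis using derivs_rep(3)[OF rep y\<Sigma> W] by simp
qed

end

section \<open>The jump of the boundary terms between two pieces\<close>

lemma (in coord_variation) boundary_derivative:
  assumes y: "y \<in> W"
  shows "pd er boundary y = G (h y) (D er (D et SS) y) (A1 y) + G (h y) (D et SS y) (D er A1 y)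
    - (G (h y) (D er SS y) (A2 y) + G (h y) (SS y) (D er A2 y))"
proof -
  note sm = smooth_fields
  have "pd er boundary y = pd er (\<lambda>y. G (h y) (D et SS y) (A1 y)) y - pd er (\<lambda>y. G (h y) (SS y) (A2 y)) y"
    unfolding boundary_def[abs_def]
    by (intro pd_diff C_inf_on_differentiable[OF smooth_Gh y] sm)
  then show ?thesis by (simp add: G_leibniz[OF _ _ y] sm)
qed

locale variation_node =
  L: variation_piece A g nabla V er es \<alpha> a \<tau> T \<xi> \<eta> q X Y +
  R: variation_piece A g nabla V er es \<alpha> \<tau> b T \<xi> \<eta> q X Y
  for A :: "('q::{t2_space, second_countable_topology}, 'e::euclidean_space) chart set"
    and g :: "'q \<Rightarrow> ('q, 'e) tvec \<Rightarrow> ('q, 'e) tvec \<Rightarrow> real"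
    and nabla :: "('q, 'e) conn" and V er es \<alpha> a \<tau> b T \<xi> \<eta> q X Y
begin

text \<open>The velocity is continuous at \<open>\<tau>\<close> for all parameters, so the derivatives of position and
  velocity in the directions of the parameters agree from both sides; also the accelerations of
  \<open>q\<close> agree, as \<open>q\<close> is smooth. What remains are the jumps of the higher derivatives of \<open>X\<close>.\<close>

lemma boundary_dr_jump:
  "L.boundary_dr (0, 0, \<tau>) - R.boundary_dr (0, 0, \<tau>) =
    - g (q \<tau>) (cov_deriv A nabla {0..T} q Y \<tau>)
        (field_limit A q (cov_deriv_pow A nabla {0..T} q 2 X) \<tau> (at_right \<tau>)
         - field_limit A q (cov_deriv_pow A nabla {0..T} q 2 X) \<tau> (at_left \<tau>))
    + g (q \<tau>) (Y \<tau>)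
        (field_limit A q (cov_deriv_pow A nabla {0..T} q 3 X) \<tau> (at_right \<tau>)
         - field_limit A q (cov_deriv_pow A nabla {0..T} q 3 X) \<tau> (at_left \<tau>))"
proof -
  let ?y = "(0, 0, \<tau>) :: param"
  have \<tau>L: "\<tau> \<in> {a..\<tau>}" and \<tau>R: "\<tau> \<in> {\<tau>..b}" and \<tau>T: "\<tau> \<in> {0..T}"
    using L.ab R.ab L.a0 R.bT by auto
  note yL = L.axis_mem[OF \<tau>L] and yR = R.axis_mem[OF \<tau>R]
  have alq: "L.pos ?y = q \<tau>" by (rule L.q_eq(2)[OF \<tau>L])
  obtain c where c: "c \<in> charts_at A (q \<tau>)" using L.ex_chart by (rule exE)
  then have cal: "c \<in> charts_at A (L.pos ?y)" by (simp only: alq)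
  have "smooth_map_on A {0..T} q" using L.cubic by (simp add: modified_cubic_def)
  from L.chart_rep_exists[OF this \<tau>T c] obtain N \<kappa> where
    \<kappa>: "\<tau> \<in> N" "chart_rep A c {0..T} N q \<kappa>" by (elim exE conjE)
  from L.rep_exists[OF yL cal] obtain WL hL where WL: "?y \<in> WL" "L.rep c WL hL" by (elim exE conjE)
  from R.rep_exists[OF yR cal] obtain WR hR where WR: "?y \<in> WR" "R.rep c WR hR" by (elim exE conjE)
  \<comment> \<open>One chart around \<open>q \<tau>\<close> and one neighbourhood for both sides, with different maps \<open>hL\<close>, \<open>hR\<close>
    which agree on the slice \<open>t = \<tau>\<close>.\<close>
  define W where "W = WL \<inter> WR"
  have W: "open W" "W \<subseteq> WL" "W \<subseteq> WR" "?y \<in> W"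
    using chart_repD(2)[OF WL(2)] chart_repD(2)[OF WR(2)] WL(1) WR(1) by (auto simp: W_def)
  have repL: "L.rep c W hL" by (rule chart_rep_subset[OF WL(2) W(1,2) order_refl])
  have repR: "R.rep c W hR" by (rule chart_rep_subset[OF WR(2) W(1,3) order_refl])
  let ?\<Gamma> = "christoffel A nabla c" and ?G = "metric_coord A g c"
  interpret l: coord_variation "chart_range c" ?\<Gamma> ?G W hL
    "V \<circ> chart_inv c" "\<lambda>x. gradient A g V (chart_inv c x) c" dr ds dt
    by (rule L.coord_variation_rep[OF repL])
  interpret r: coord_variation "chart_range c" ?\<Gamma> ?G W hR
    "V \<circ> chart_inv c" "\<lambda>x. gradient A g V (chart_inv c x) c" dr ds dt
    by (rule R.coord_variation_rep[OF repR])
  let ?S = "slice er es \<tau> \<inter> W"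
  have SL: "x \<in> L.\<Sigma>" "x \<in> W" and SR: "x \<in> R.\<Sigma>" if "x \<in> ?S" for x
    using that \<tau>L \<tau>R by (auto simp: slice_def L.\<Sigma>_def R.\<Sigma>_def)
  have yS: "?y \<in> ?S" using W(4) L.zero_mem by (simp add: slice_def)
  note slice1 = pd_slice(1)[OF W(1), where er = er and es = es and \<tau> = \<tau>]
  note slice2 = pd_slice(2)[OF W(1), where er = er and es = es and \<tau> = \<tau>]
  have h: "hL x = hR x" if x: "x \<in> ?S" for x
    using chart_repD(6)[OF repL SL[OF x]] chart_repD(6)[OF repR SR[OF x] SL(2)[OF x]] by simp
  have T: "pd dt hL x = pd dt hR x" if x: "x \<in> ?S" for x
  proof -
    obtain r s where rs: "x = (r, s, \<tau>)" using x by (auto simp: slice_def)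
    have "L.vel_t x = R.vel_t x" using L.vel_t_eq[of r s \<tau>] R.vel_t_eq[of r s \<tau>] SL[OF x] SR[OF x] rs by simp
    then show ?thesis
      using field_repD(3)[OF L.frep_vel_t[OF repL] SL[OF x]] field_repD(3)[OF R.frep_vel_t[OF repR] SR[OF x] SL(2)[OF x]]
      by simp
  qed
  have Sx: "pd ds hL x = pd ds hR x" if x: "x \<in> ?S" for x
    by (rule slice2[OF l.smooth_h r.smooth_h h x])
  have Xx: "pd dr hL x = pd dr hR x" if x: "x \<in> ?S" for x
    by (rule slice1[OF l.smooth_h r.smooth_h h x])
  have S1: "l.D dt (pd ds hL) x = r.D dt (pd ds hR) x" if x: "x \<in> ?S" for x
  proof -
    have "pd ds (pd dt hL) x = pd ds (pd dt hR) x"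
      by (rule slice2[OF l.smooth_pd_h r.smooth_pd_h T x])
    then have "l.D ds (pd dt hL) x = r.D ds (pd dt hR) x"
      by (simp add: Dv_def h[OF x] T[OF x] Sx[OF x])
    then show ?thesis using l.D_sym[OF SL(2)[OF x], of dt ds] r.D_sym[OF SL(2)[OF x], of dt ds] by simp
  qed
  have rS1: "l.D dr (l.D dt (pd ds hL)) ?y = r.D dr (r.D dt (pd ds hR)) ?y"
  proof -
    have "pd dr (l.D dt (pd ds hL)) ?y = pd dr (r.D dt (pd ds hR)) ?y"
      by (rule slice1[OF l.smooth_D[OF l.smooth_pd_h] r.smooth_D[OF r.smooth_pd_h] S1 yS])
    then show ?thesis
      by (simp add: Dv_def[of _ _ dr "l.D dt (pd ds hL)"] Dv_def[of _ _ dr "r.D dt (pd ds hR)"] h[OF yS] Xx[OF yS] S1[OF yS])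
  qed
  have rS: "l.D dr (pd ds hL) ?y = r.D dr (pd ds hR) ?y"
    using slice1[OF l.smooth_pd_h r.smooth_pd_h Sx yS] by (simp add: Dv_def h[OF yS] Xx[OF yS] Sx[OF yS])
  have X1: "l.X1 ?y = r.X1 ?y"
  proof -
    have "l.D dr (pd dt hL) ?y = r.D dr (pd dt hR) ?y"
      using slice1[OF l.smooth_pd_h r.smooth_pd_h T yS] by (simp add: Dv_def h[OF yS] Xx[OF yS] T[OF yS])
    then show ?thesis using l.D_er_TT[OF W(4)] r.D_er_TT[OF W(4)] by simp
  qed
  note fT_L = L.frep_vel_t[OF repL] and fT_R = R.frep_vel_t[OF repR]
  note A1_L = L.frep_cov_t[OF repL fT_L] and A1_R = R.frep_cov_t[OF repR fT_R]
  note A2_L = L.frep_cov_t[OF repL A1_L] and A2_R = R.frep_cov_t[OF repR A1_R]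
  have A1: "l.A1 ?y = r.A1 ?y"
    using field_repD(3)[OF A1_L yL W(4)] field_repD(3)[OF A1_R yR W(4)]
      L.cov_t_vel_t(1)[OF \<kappa>(2) \<tau>L \<kappa>(1)] R.cov_t_vel_t(1)[OF \<kappa>(2) \<tau>R \<kappa>(1)] by simp
  have A2: "l.A2 ?y = r.A2 ?y"
    using field_repD(3)[OF A2_L yL W(4)] field_repD(3)[OF A2_R yR W(4)]
      L.cov_t_vel_t(2)[OF \<kappa>(2) \<tau>L \<kappa>(1)] R.cov_t_vel_t(2)[OF \<kappa>(2) \<tau>R \<kappa>(1)] by simp
  note eqs = h[OF yS] T[OF yS] Sx[OF yS] Xx[OF yS] S1[OF yS] rS1 rS X1 A1 A2
  have rA1: "l.D dr l.A1 ?y - r.D dr r.A1 ?y = l.X2 ?y - r.X2 ?y"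
    unfolding l.D_er_A1[OF W(4)] r.D_er_A1[OF W(4)] eqs by simp
  have rA2: "l.D dr l.A2 ?y - r.D dr r.A2 ?y = l.X3 ?y - r.X3 ?y"
    unfolding l.D_er_A2[OF W(4)] r.D_er_A2[OF W(4)] l.Dtri_Rm[OF W(4)] r.Dtri_Rm[OF W(4)] eqs by simp
  note G = l.G_simps[OF r.h_mem[OF W(4)]]
  have "L.boundary_dr ?y - R.boundary_dr ?y = ?G (hR ?y) (r.D dt (pd ds hR) ?y) (l.D dr l.A1 ?y - r.D dr r.A1 ?y)
      - ?G (hR ?y) (pd ds hR ?y) (l.D dr l.A2 ?y - r.D dr r.A2 ?y)"
    unfolding L.derivs_rep(3)[OF repL yL W(4), symmetric] R.derivs_rep(3)[OF repR yR W(4), symmetric]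
      l.boundary_derivative[OF W(4)] r.boundary_derivative[OF W(4)] eqs by (simp add: G)
  then have jump: "L.boundary_dr ?y - R.boundary_dr ?y = ?G (hR ?y) (r.D dt (pd ds hR) ?y) (l.X2 ?y - r.X2 ?y)
      - ?G (hR ?y) (pd ds hR ?y) (l.X3 ?y - r.X3 ?y)"
    by (simp only: rA1 rA2)
  have limR: "field_limit A q (cov_deriv_pow A nabla {0..T} q k X) \<tau> (at_right \<tau>) = (R.cov_t ^^ k) R.vel_r ?y" for k
    by (rule R.field_limit_end[OF \<tau>R _ _ eventually_at_right_real[OF R.ab]]) (auto simp: at_le)
  have limL: "field_limit A q (cov_deriv_pow A nabla {0..T} q k X) \<tau> (at_left \<tau>) = (L.cov_t ^^ k) L.vel_r ?y" for k
    by (rule L.field_limit_end[OF \<tau>L _ _ eventually_at_left_real[OF L.ab]]) (auto simp: at_le)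
  note fL = L.frep_pow[OF repL] and fR = R.frep_pow[OF repR]
  have coR: "(R.cov_t ^^ k) R.vel_r ?y \<in> tangent_space A (q \<tau>)" "(R.cov_t ^^ k) R.vel_r ?y c = (r.D dt ^^ k) (pd dr hR) ?y" for k
    using field_repD(2,3)[OF fR yR W(4)] alq by simp_all
  have coL: "(L.cov_t ^^ k) L.vel_r ?y \<in> tangent_space A (q \<tau>)" "(L.cov_t ^^ k) L.vel_r ?y c = (l.D dt ^^ k) (pd dr hL) ?y" for k
    using field_repD(2,3)[OF fL yL W(4)] alq by simp_all
  have diff: "(R.cov_t ^^ k) R.vel_r ?y - (L.cov_t ^^ k) L.vel_r ?y \<in> tangent_space A (q \<tau>)" for k
    by (rule L.tangent_space_diff[OF coR(1) coL(1)])
  have hq: "snd c (q \<tau>) = hR ?y" using chart_repD(6)[OF repR yR W(4)] alq by simp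
  note fS_R = R.frep_vel_s[OF repR]
  note S1_R = R.frep_cov_t[OF repR fS_R]
  have Y: "Y \<tau> \<in> tangent_space A (q \<tau>)" "Y \<tau> c = pd ds hR ?y"
    using field_repD(2,3)[OF fS_R yR W(4)] R.XY_eq(2)[OF \<tau>R] alq by simp_all
  have DY: "cov_deriv A nabla {0..T} q Y \<tau> \<in> tangent_space A (q \<tau>)"
    "cov_deriv A nabla {0..T} q Y \<tau> c = r.D dt (pd ds hR) ?y"
    using field_repD(2,3)[OF S1_R yR W(4)] R.cov_deriv_Y[OF \<tau>R] alq by simp_all
  have pow: "(f ^^ 2) u = f (f u)" "(f ^^ 3) u = f (f (f u))" for f and u :: "param \<Rightarrow> 'e"
    by (simp_all add: eval_nat_numeral)
  show ?thesis
    unfolding limR limL L.metric_chart[OF DY(1) diff c] L.metric_chart[OF Y(1) diff c] jump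
    by (simp add: hq Y(2) DY(2) coR(2) coL(2) pow G)
qed

end

section \<open>Summation over the pieces\<close>

context variation_piece begin

lemma integrand_has_integral:
  assumes rs: "r \<in> {-er<..<er}" "s \<in> {-es<..<es}"
    and acc: "acc = cov_deriv A nabla {0..T} (\<alpha> r s) (velocity A {0..T} (\<alpha> r s))"
  shows "((\<lambda>u. 1/2 * g (\<alpha> r s u) (acc u) (acc u) + V (\<alpha> r s u)) has_integral
    integral {a..b} (\<lambda>u. strip_integrand (r, s, u))) {a..b}"
proof -
  have "((\<lambda>u. strip_integrand (r, s, u)) has_integral integral {a..b} (\<lambda>u. strip_integrand (r, s, u))) (cbox a b)"
    using integrable_continuous_interval[OF continuous_strip[OF smooth_on_continuous[OF smooth_strip_integrand] rs]]
    by (simp add: integrable_integral)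
  moreover have "1/2 * g (\<alpha> r s u) (acc u) (acc u) + V (\<alpha> r s u) = strip_integrand (r, s, u)" if u: "u \<in> box a b" for u
  proof -
    have u': "u \<in> {a<..<b}" using u by simp
    have I: "{0..T} \<inter> {a<..<b} = {a..b} \<inter> {a<..<b}" using a0 bT by auto
    have "acc u = cov_deriv A nabla {a..b} (\<alpha> r s) (\<lambda>t. vel_t (r, s, t)) u"
      unfolding acc
    proof (rule cov_deriv_cong[OF open_greaterThanLessThan u' _ I])
      fix v assume "v \<in> {0..T}" "v \<in> {a<..<b}"
      then show "velocity A {0..T} (\<alpha> r s) v = vel_t (r, s, v)"
        unfolding vel_t_def split by (intro velocity_cong[OF open_greaterThanLessThan _ _ I]) auto
    qed (use u' a0 bT in auto)
    then show ?thesis by (simp add: strip_integrand_def pos_def cov_t_def)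
  qed
  ultimately show ?thesis unfolding box_real(2)[symmetric] by (rule has_integral_spike_interior)
qed

end

lemma has_integral_subdivision:
  fixes t :: "nat \<Rightarrow> real" and f :: "real \<Rightarrow> real"
  assumes "\<And>i. i \<le> l \<Longrightarrow> t i < t (Suc i)" "\<And>i. i \<le> l \<Longrightarrow> (f has_integral F i) {t i..t (Suc i)}"
  shows "(f has_integral (\<Sum>i\<le>l. F i)) {t 0..t (Suc l)} \<and> t 0 < t (Suc l)"
  using assms
proof (induction l)
  case 0
  then show ?case by simp
next
  case (Suc l)
  have IH: "(f has_integral (\<Sum>i\<le>l. F i)) {t 0..t (Suc l)}" "t 0 < t (Suc l)"
    using Suc.IH Suc.prems by auto
  have lt: "t (Suc l) < t (Suc (Suc l))" using Suc.prems(1) by simp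
  have "(f has_integral (\<Sum>i\<le>l. F i) + F (Suc l)) {t 0..t (Suc (Suc l))}"
    by (rule has_integral_combine[OF _ _ IH(1)]) (use IH(2) lt Suc.prems(2) in auto)
  then show ?case using IH(2) lt by simp
qed

text \<open>Summation by parts: the values at the two ends of each piece are regrouped into jumps at the nodes;
  \<open>f i j\<close> stands for the value on piece \<open>i\<close> at node \<open>j\<close>.\<close>

lemma sum_telescope_jumps:
  fixes f :: "nat \<Rightarrow> nat \<Rightarrow> real"
  shows "(\<Sum>i\<le>l. f i (Suc i) - f i i) = f l (Suc l) - f 0 0 + (\<Sum>i=1..l. f (i - 1) i - f i i)"
  by (induction l) auto

lemma subdivision_bounds:
  assumes "subdivision T l t" "i \<le> l"
  shows "t i < t (Suc i)" "0 \<le> t i" "t (Suc i) \<le> T"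
proof -
  have st: "t 0 = 0" "t (Suc l) = T" "\<And>i. i \<le> l \<Longrightarrow> t i < t (Suc i)"
    using assms(1) by (auto simp: subdivision_def)
  show "t i < t (Suc i)" using st(3) assms(2) .
  have "i \<le> l \<Longrightarrow> 0 \<le> t i" for i
  proof (induction i)
    case (Suc i)
    then show ?case using st(3)[of i] by simp
  qed (simp add: st)
  then show "0 \<le> t i" using assms(2) .
  have "t (Suc (l - j)) \<le> T" for j
  proof (induction j)
    case (Suc j)
    have "t (Suc (l - Suc j)) \<le> t (Suc (l - j))"
    proof (cases "j < l")
      case True
      then have "Suc (l - Suc j) = l - j" by simp
      then show ?thesis using st(3)[of "l - j"] by simp
    qed simp
    then show ?case using Suc by simp
  qed (simp add: st)
  from this[of "l - i"] show "t (Suc i) \<le> T" using assms(2) by simp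
qed

theorem lemma3p2:
  fixes A :: "('q::{t2_space, second_countable_topology}, 'e::euclidean_space) chart set"
    and g :: "'q \<Rightarrow> ('q, 'e) tvec \<Rightarrow> ('q, 'e) tvec \<Rightarrow> real"
    and nabla :: "('q, 'e) conn"
    and V :: "'q \<Rightarrow> real"
    and T :: real
    and \<xi> \<eta> :: "'q \<times> ('q, 'e) tvec"
    and q :: "real \<Rightarrow> 'q"
    and er es :: real
    and \<alpha> :: "real \<Rightarrow> real \<Rightarrow> real \<Rightarrow> 'q"
    and X Y :: "real \<Rightarrow> ('q, 'e) tvec"
    and l :: nat
    and t :: "nat \<Rightarrow> real"
  defines "D \<equiv> cov_deriv_pow A nabla {0..T} q"
  assumes "connected (UNIV :: 'q set)"
    and "levi_civita A g nabla"
    and "geodesically_complete A nabla"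
    and "smooth_fun_on A UNIV V"
    and "\<forall>p. 0 \<le> V p"
    and "0 < T"
    and "\<xi> \<in> tangent_bundle A" and "\<eta> \<in> tangent_bundle A"
    and "q \<in> Omega A T \<xi> \<eta>"
    and "modified_cubic A g nabla V T q"
    and "two_parameter_variation A nabla T \<xi> \<eta> q er es \<alpha> X Y"
    and "subdivision T l t"
    and "\<forall>i\<le>l. smooth_strip A er es {t i..t (Suc i)} \<alpha>"
  shows "\<exists>dJ. (\<forall>r\<in>{-er<..<er}.
             ((\<lambda>s. J_functional A g nabla V T (\<alpha> r s)) has_real_derivative dJ r) (at 0)) \<and>
           (dJ has_real_derivative
             integral {0..T} (\<lambda>u. g (q u) (Y u)
               (D 4 X u + F_term A nabla {0..T} q X u + nabla (q u) (X u) (gradient A g V)))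
             - (\<Sum>i=1..l. g (q (t i)) (D 1 Y (t i))
                 (field_limit A q (D 2 X) (t i) (at_right (t i))
                  - field_limit A q (D 2 X) (t i) (at_left (t i))))
             + (\<Sum>i=1..l. g (q (t i)) (Y (t i))
                 (field_limit A q (D 3 X) (t i) (at_right (t i))
                  - field_limit A q (D 3 X) (t i) (at_left (t i)))))
             (at 0)"
proof -
  have Omega: "\<alpha> r s \<in> Omega A T \<xi> \<eta>" if "r \<in> {-er<..<er}" "s \<in> {-es<..<es}" for r s
    using assms(12) that unfolding two_parameter_variation_def by blast
  have er: "0 < er" and es: "0 < es" using assms(12) unfolding two_parameter_variation_def by auto
  note bounds = subdivision_bounds[OF assms(13)]
  have t0: "t 0 = 0" and tl: "t (Suc l) = T" using assms(13) by (auto simp: subdivision_def)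
  have piece: "variation_piece A g nabla V er es \<alpha> (t i) (t (Suc i)) T \<xi> \<eta> q X Y" if i: "i \<le> l" for i
  proof -
    have "smooth_strip A er es {t i..t (Suc i)} \<alpha>" using assms(14) i by simp
    then show ?thesis
      using assms(3,5,11,12) er es bounds[OF i]
      by (simp add: variation_piece_def variation_strip_def variation_strip_axioms_def variation_piece_axioms_def)
  qed
  let ?strip_integrand = "\<lambda>i. variation_strip.strip_integrand A g nabla V \<alpha> (t i) (t (Suc i))"
  let ?integrand_ds = "\<lambda>i. variation_strip.integrand_ds A g nabla V \<alpha> (t i) (t (Suc i))"
  let ?integrand_drs = "\<lambda>i. variation_strip.integrand_drs A g nabla V \<alpha> (t i) (t (Suc i))"
  let ?boundary_dr = "\<lambda>i j. variation_strip.boundary_dr A g nabla es \<alpha> (t i) (t (Suc i)) (0, 0, t j)"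
  let ?I = "\<lambda>i. {t i..t (Suc i)}"
  let ?p = "\<lambda>u. g (q u) (Y u)
               (D 4 X u + F_term A nabla {0..T} q X u + nabla (q u) (X u) (gradient A g V))"
  have strip: "variation_strip A g nabla V er es \<alpha> (t i) (t (Suc i))" if "i \<le> l" for i
    using piece[OF that] by (simp add: variation_piece_def)
  have J: "J_functional A g nabla V T (\<alpha> r s) = (\<Sum>i\<le>l. integral (?I i) (\<lambda>u. ?strip_integrand i (r, s, u)))"
    if rs: "r \<in> {-er<..<er}" "s \<in> {-es<..<es}" for r s
  proof -
    let ?acc = "cov_deriv A nabla {0..T} (\<alpha> r s) (velocity A {0..T} (\<alpha> r s))"
    have "((\<lambda>u. 1/2 * g (\<alpha> r s u) (?acc u) (?acc u) + V (\<alpha> r s u)) has_integral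
        (\<Sum>i\<le>l. integral (?I i) (\<lambda>u. ?strip_integrand i (r, s, u)))) {t 0..t (Suc l)} \<and> t 0 < t (Suc l)"
      by (rule has_integral_subdivision[of l t, OF bounds(1)])
        (assumption, rule variation_piece.integrand_has_integral[OF piece rs refl])
    then show ?thesis unfolding t0 tl by (simp add: J_functional_def Let_def integral_unique)
  qed
  define dJ where "dJ = (\<lambda>r. \<Sum>i\<le>l. integral (?I i) (\<lambda>u. ?integrand_ds i (r, 0, u)))"
  have first: "((\<lambda>s. J_functional A g nabla V T (\<alpha> r s)) has_real_derivative dJ r) (at 0)"
    if r: "r \<in> {-er<..<er}" for r
  proof -
    have "((\<lambda>s. \<Sum>i\<le>l. integral (?I i) (\<lambda>u. ?strip_integrand i (r, s, u))) has_real_derivative dJ r) (at 0)"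
      unfolding dJ_def
      by (rule DERIV_sum) (use variation_strip.integral_strip_integrand_derivative[OF strip r] in simp)
    then show ?thesis
      by (rule has_field_derivative_transform_within_open[OF _ open_greaterThanLessThan[of "-es" es]])
        (use es J[OF r] in auto)
  qed
  have second: "(dJ has_real_derivative (\<Sum>i\<le>l. integral (?I i) (\<lambda>u. ?integrand_drs i (0, 0, u)))) (at 0)"
    unfolding dJ_def
    by (rule DERIV_sum) (use variation_strip.integral_integrand_ds_derivative[OF strip] in simp)
  have pi: "(?p has_integral integral (?I i) (\<lambda>u. ?integrand_drs i (0, 0, u)) - (?boundary_dr i (Suc i) - ?boundary_dr i i)) (?I i)"
    if i: "i \<le> l" for i
  proof -
    interpret variation_piece A g nabla V er es \<alpha> "t i" "t (Suc i)" T \<xi> \<eta> q X Y by (rule piece[OF i])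
    show ?thesis
      unfolding D_def by (rule second_variation_integral[OF second_variation_at])
  qed
  have "(?p has_integral (\<Sum>i\<le>l. integral (?I i) (\<lambda>u. ?integrand_drs i (0, 0, u)) - (?boundary_dr i (Suc i) - ?boundary_dr i i))) {t 0..t (Suc l)}
      \<and> t 0 < t (Suc l)"
    by (rule has_integral_subdivision[of l t]) (rule bounds(1) pi, assumption)+
  then have "(?p has_integral (\<Sum>i\<le>l. integral (?I i) (\<lambda>u. ?integrand_drs i (0, 0, u)) - (?boundary_dr i (Suc i) - ?boundary_dr i i))) {0..T}"
    unfolding t0 tl by (rule conjunct1)
  then have "(\<Sum>i\<le>l. integral (?I i) (\<lambda>u. ?integrand_drs i (0, 0, u)))
      = integral {0..T} ?p + (\<Sum>i\<le>l. ?boundary_dr i (Suc i) - ?boundary_dr i i)"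
    by (simp add: integral_unique sum_subtractf)
  also have "(\<Sum>i\<le>l. ?boundary_dr i (Suc i) - ?boundary_dr i i) = ?boundary_dr l (Suc l) - ?boundary_dr 0 0 + (\<Sum>i=1..l. ?boundary_dr (i - 1) i - ?boundary_dr i i)"
    by (rule sum_telescope_jumps[of "\<lambda>i j. ?boundary_dr i j"])
  also have "?boundary_dr 0 0 = 0"
  proof -
    interpret variation_piece A g nabla V er es \<alpha> "t 0" "t (Suc 0)" T \<xi> \<eta> q X Y by (rule piece) simp
    show ?thesis
      by (rule boundary_dr_end[where p = "fst \<xi>" and v = "snd \<xi>"])
        (use ab Omega in \<open>auto simp: Omega_def t0\<close>)
  qed
  also have "?boundary_dr l (Suc l) = 0"
  proof -
    interpret variation_piece A g nabla V er es \<alpha> "t l" "t (Suc l)" T \<xi> \<eta> q X Y by (rule piece) simp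
    show ?thesis
      by (rule boundary_dr_end[where p = "fst \<eta>" and v = "snd \<eta>"])
        (use ab Omega in \<open>auto simp: Omega_def tl\<close>)
  qed
  also have "(\<Sum>i=1..l. ?boundary_dr (i - 1) i - ?boundary_dr i i) = (\<Sum>i=1..l. - g (q (t i)) (D 1 Y (t i))
                 (field_limit A q (D 2 X) (t i) (at_right (t i))
                  - field_limit A q (D 2 X) (t i) (at_left (t i)))
             + g (q (t i)) (Y (t i))
                 (field_limit A q (D 3 X) (t i) (at_right (t i))
                  - field_limit A q (D 3 X) (t i) (at_left (t i))))"
  proof (rule sum.cong[OF refl])
    fix i assume "i \<in> {1..l}"
    then obtain j where j: "i = Suc j" "Suc j \<le> l" by (cases i) auto
    have "variation_node A g nabla V er es \<alpha> (t j) (t (Suc j)) (t (Suc (Suc j))) T \<xi> \<eta> q X Y"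
      using piece[of j] piece[of "Suc j"] j(2) by (simp add: variation_node_def)
    note jump = variation_node.boundary_dr_jump[OF this]
    have pow1: "cov_deriv_pow A nabla {0..T} q 1 Y = cov_deriv A nabla {0..T} q Y" by simp
    from jump show "?boundary_dr (i - 1) i - ?boundary_dr i i = - g (q (t i)) (D 1 Y (t i))
                 (field_limit A q (D 2 X) (t i) (at_right (t i))
                  - field_limit A q (D 2 X) (t i) (at_left (t i)))
             + g (q (t i)) (Y (t i))
                 (field_limit A q (D 3 X) (t i) (at_right (t i))
                  - field_limit A q (D 3 X) (t i) (at_left (t i)))"
      unfolding D_def j(1) pow1 diff_Suc_1 .
  qed
  finally have "(\<Sum>i\<le>l. integral (?I i) (\<lambda>u. ?integrand_drs i (0, 0, u))) = integral {0..T} ?p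
             - (\<Sum>i=1..l. g (q (t i)) (D 1 Y (t i))
                 (field_limit A q (D 2 X) (t i) (at_right (t i))
                  - field_limit A q (D 2 X) (t i) (at_left (t i))))
             + (\<Sum>i=1..l. g (q (t i)) (Y (t i))
                 (field_limit A q (D 3 X) (t i) (at_right (t i))
                  - field_limit A q (D 3 X) (t i) (at_left (t i))))"
    unfolding sum.distrib sum_negf by linarith
  with first second show ?thesis by (intro exI[of _ dJ]) simp
qed

end
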